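(* The following hold for the monotone functions $I_\downarrow,I_\downarrow^*,I_{sq},J_\downarrow,J_\downarrow^*$ and the sets $\mathcal{S}_I,\mathcal{S}_I^*,\mathcal{S}_{\rm sep},\mathcal{S}_J,\mathcal{S}_J^*$: - $I_\downarrow^*(\rho)=0$ for any $\rho\in\mathcal{S}_I^*$; - $I_\downarrow(\rho)=0$ for any $\rho\in\mathcal{S}_I$; - $I_{sq}(\rho)=0$ for any $\rho\in\mathcal{S}_{\rm sep}$; - $J_\downarrow^*(\rho)=0$ for any $\rho\in\mathcal{S}_J^*$; - $J_\downarrow(\rho)=0$ for any $\rho\in\mathcal{S}_J$.
   Context: All Hilbert spaces are finite-dimensional. A quantum operation is a linear CPTP map; its input and output spaces may differ. Maps act as the identity on systems not mentioned, and linear isometries $\mathcal{W}$ are identified with the maps they induce on states. $\mathcal{S}_{\rm all}$ is the set of all density operators on $\mathcal{H}^A\otimes\mathcal{H}^B\otimes\mathcal{H}^E$. Superscripts on a state denote the corresponding reduced state. Auxiliary systems $F,F_A,F_B,E_A,E_B,R$ are arbitrary finite-dimensional. An extension of $\rho^{ABE}$ is a state $\varrho^{ABEF}$ with ${\rm Tr}_F[\varrho^{ABEF}]=\rho^{ABE}$ (similarly for bipartite states). $I(A:B|E)_\rho:=S(AE)_\rho+S(BE)_\rho-S(ABE)_\rho-S(E)_\rho$, with $S$ the von Neumann entropy. $\mathcal{S}_{\rm Markov}$ is the set of states on $ABE$ with $I(A:B|E)=0$; $\mathcal{S}_{\rm Markov}^{A:B|F}$ is the set of states on $ABF$ with $I(A:B|F)=0$.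 $\mathcal{S}_{\rm sep}^{X:Y}$ is the set of separable states between $X$ and $Y$. $\mathbb{L}_E$ is the set of all quantum operations on $E$. Functions of $\rho\in\mathcal{S}_{\rm all}$: - $I_\downarrow(\rho):=\inf_{\mathcal{T}\in\mathbb{L}_E}I(A:B|E)_{\mathcal{T}(\rho)}$. - $I_\downarrow^*(\rho):=\inf_{\varrho}I(A:B|F)_{\varrho}$, over all extensions $\varrho^{ABEF}$ of $\rho^{ABE}$. - $I_{sq}(\rho):=2E_{sq}({\rm Tr}_E[\rho^{ABE}])$, where $E_{sq}(\tau):=\frac12\inf_{\omega}I(A:B|R)_\omega$ over all extensions $\omega^{ABR}$ of $\tau^{AB}$. - $J_\downarrow(\rho):=\inf_{\phi_\rho}\inf_{\mathcal{T}\in\mathbb{L}_E}I(AF_A:BF_B|E)_{\mathcal{T}(\phi_\rho)}$, over all purifications $|\phi_\rho\rangle^{ABEF_AF_B}$ of $\rho^{ABE}$. - $J_\downarrow^*(\rho):=\inf_{\mathcal{W}}\inf_{\varrho}I(AE_A:BE_B|F)_{\mathcal{W}(\varrho)}$, over all linear isometries $\mathcal{W}:E\to E_AE_B$ and all extensions $\varrho^{ABEF}$ of $\rho^{ABE}$. Sets: - $\mathcal{S}_I:=\{\rho\in\mathcal{S}_{\rm all}\mid\exists\mathcal{T}\in\mathbb{L}_E:\ \mathcal{T}(\rho)\in\mathcal{S}_{\rm Markov}\}$. - $\mathcal{S}_I^*:=\{\rho\in\mathcal{S}_{\rm all}\mid\exists\text{ a state }\varrho^{ABEF}:\ \varrho^{ABE}=\rho^{ABE},\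 \varrho^{ABF}\in\mathcal{S}_{\rm Markov}^{A:B|F}\}$. - $\mathcal{S}_{\rm sep}:=\{\rho\in\mathcal{S}_{\rm all}\mid\rho^{AB}\text{ is separable}\}$. - $\mathcal{S}_J^*:=\{\rho\in\mathcal{S}_{\rm all}\mid\exists\text{ a linear isometry }\mathcal{W}:E\to E_AE_B:\ \mathcal{W}(\rho^{ABE})\in\mathcal{S}_{\rm sep}^{AE_A:BE_B}\}$. - $\mathcal{S}_J:=\{\rho\in\mathcal{S}_{\rm all}\mid\exists\text{ a purification }|\phi_\rho\rangle^{ABEF_AF_B}\text{ of }\rho^{ABE}:\ \phi_\rho^{ABF_AF_B}\in\mathcal{S}_{\rm sep}^{AF_A:BF_B}\}$. *)

theory Defs
  imports
    Complex_Main
    "HOL-Library.Countable_Set"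
    "HOL-Library.Complex_Order"
    "Jordan_Normal_Form.Char_Poly"
begin

text \<open>
  A finite-dimensional Hilbert space is given by a finite set \<open>I\<close> labelling an orthonormal basis, and
  a tensor product by the product of the label sets.  An operator is the function of its matrix
  entries, required to vanish outside \<open>I\<close> so that equality of operators is equality of functions.
  Tripartite systems \<open>XYZ\<close> are nested to the left, \<open>(X \<times> Y) \<times> Z\<close>, so that the last system can be
  traced out or acted upon.  Auxiliary systems, whose dimension is quantified over, are labelled by
  initial segments of the natural numbers.
\<close>

type_synonym 'i op = "'i \<Rightarrow> 'i \<Rightarrow> complex"

definition ops :: "'i set \<Rightarrow> 'i op set" where
  "ops I = {\<rho>. \<forall>i j. i \<notin> I \<or> j \<notin> I \<longrightarrow> \<rho> i j = 0}"

definition op_trace :: "'i set \<Rightarrow> 'i op \<Rightarrow> complex" where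
  "op_trace I \<rho> = (\<Sum>i\<in>I. \<rho> i i)"

text \<open>In the order of \<open>Complex_Order\<close>, \<open>0 \<le> z\<close> says that \<open>z\<close> is real and nonnegative; hence
  positive operators are Hermitian.\<close>

definition psd :: "'i set \<Rightarrow> 'i op \<Rightarrow> bool" where
  "psd I \<rho> \<longleftrightarrow> (\<forall>v. 0 \<le> (\<Sum>i\<in>I. \<Sum>j\<in>I. cnj (v i) * \<rho> i j * v j))"

definition state :: "'i set \<Rightarrow> 'i op \<Rightarrow> bool" where
  "state I \<rho> \<longleftrightarrow> \<rho> \<in> ops I \<and> psd I \<rho> \<and> op_trace I \<rho> = 1"

text \<open>The characteristic polynomial does not depend on the enumeration \<open>from_nat_into I\<close> of the
  basis.\<close>

definition op_mat :: "'i set \<Rightarrow> 'i op \<Rightarrow> complex mat" where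
  "op_mat I \<rho> = mat (card I) (card I) (\<lambda>(k, l). \<rho> (from_nat_into I k) (from_nat_into I l))"

text \<open>\<open>- Tr (\<rho> log \<rho>)\<close>, evaluated on the eigenvalues counted with multiplicity; \<open>0 log 0 = 0\<close>.\<close>

definition entropy :: "'i set \<Rightarrow> 'i op \<Rightarrow> real" where
  "entropy I \<rho> = - (\<Sum>x\<in>#proots (char_poly (op_mat I \<rho>)). Re x * log 2 (Re x))"

definition tr_snd :: "'y set \<Rightarrow> ('x \<times> 'y) op \<Rightarrow> 'x op" where
  "tr_snd Y \<rho> = (\<lambda>x x'. \<Sum>y\<in>Y. \<rho> (x, y) (x', y))"

definition tr_fst :: "'x set \<Rightarrow> ('x \<times> 'y) op \<Rightarrow> 'y op" where
  "tr_fst X \<rho> = (\<lambda>y y'. \<Sum>x\<in>X. \<rho> (x, y) (x, y'))"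

definition tr_mid :: "'y set \<Rightarrow> (('x \<times> 'y) \<times> 'z) op \<Rightarrow> ('x \<times> 'z) op" where
  "tr_mid Y \<rho> = (\<lambda>(x, z) (x', z'). \<Sum>y\<in>Y. \<rho> ((x, y), z) ((x', y), z'))"

definition tr_first :: "'x set \<Rightarrow> (('x \<times> 'y) \<times> 'z) op \<Rightarrow> ('y \<times> 'z) op" where
  "tr_first X \<rho> = (\<lambda>(y, z) (y', z'). \<Sum>x\<in>X. \<rho> ((x, y), z) ((x, y'), z'))"

text \<open>\<open>cmi X Y Z \<rho>\<close> is \<open>I(X:Y|Z)\<close>.\<close>

definition cmi :: "'x set \<Rightarrow> 'y set \<Rightarrow> 'z set \<Rightarrow> (('x \<times> 'y) \<times> 'z) op \<Rightarrow> real" where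
  "cmi X Y Z \<rho> =
     entropy (X \<times> Z) (tr_mid Y \<rho>) + entropy (Y \<times> Z) (tr_first X \<rho>)
     - entropy ((X \<times> Y) \<times> Z) \<rho> - entropy Z (tr_fst (X \<times> Y) \<rho>)"

definition markov_states :: "'x set \<Rightarrow> 'y set \<Rightarrow> 'z set \<Rightarrow> (('x \<times> 'y) \<times> 'z) op set" where
  "markov_states X Y Z = {\<rho>. state ((X \<times> Y) \<times> Z) \<rho> \<and> cmi X Y Z \<rho> = 0}"

definition sep_states :: "'x set \<Rightarrow> 'y set \<Rightarrow> ('x \<times> 'y) op set" where
  "sep_states X Y = {\<sigma>. \<exists>(n::nat) (p :: nat \<Rightarrow> real) \<alpha> \<beta>.
     (\<forall>k<n. 0 \<le> p k \<and> state X (\<alpha> k) \<and> state Y (\<beta> k)) \<and> (\<Sum>k<n. p k) = 1 \<and>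
     \<sigma> = (\<lambda>(x, y) (x', y'). \<Sum>k<n. of_real (p k) * \<alpha> k x x' * \<beta> k y y')}"

text \<open>\<open>id \<otimes> T\<close>: \<open>T\<close> is applied to each block of the block matrix.\<close>

definition on_snd :: "('e op \<Rightarrow> 'f op) \<Rightarrow> ('x \<times> 'e) op \<Rightarrow> ('x \<times> 'f) op" where
  "on_snd T \<rho> = (\<lambda>(x, f) (x', f'). T (\<lambda>e e'. \<rho> (x, e) (x', e')) f f')"

definition linear_map :: "'e set \<Rightarrow> 'f set \<Rightarrow> ('e op \<Rightarrow> 'f op) \<Rightarrow> bool" where
  "linear_map E F T \<longleftrightarrow>
     (\<forall>\<rho>\<in>ops E. T \<rho> \<in> ops F) \<and>
     (\<forall>\<rho>\<in>ops E. \<forall>\<sigma>\<in>ops E. T (\<lambda>i j. \<rho> i j + \<sigma> i j) = (\<lambda>i j. T \<rho> i j + T \<sigma> i j)) \<and>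
     (\<forall>c. \<forall>\<rho>\<in>ops E. T (\<lambda>i j. c * \<rho> i j) = (\<lambda>i j. c * T \<rho> i j))"

definition completely_positive :: "'e set \<Rightarrow> 'f set \<Rightarrow> ('e op \<Rightarrow> 'f op) \<Rightarrow> bool" where
  "completely_positive E F T \<longleftrightarrow>
     (\<forall>n::nat. \<forall>\<rho>\<in>ops ({..<n} \<times> E). psd ({..<n} \<times> E) \<rho> \<longrightarrow> psd ({..<n} \<times> F) (on_snd T \<rho>))"

definition trace_preserving :: "'e set \<Rightarrow> 'f set \<Rightarrow> ('e op \<Rightarrow> 'f op) \<Rightarrow> bool" where
  "trace_preserving E F T \<longleftrightarrow> (\<forall>\<rho>\<in>ops E. op_trace F (T \<rho>) = op_trace E \<rho>)"

definition quantum_operation :: "'e set \<Rightarrow> 'f set \<Rightarrow> ('e op \<Rightarrow> 'f op) \<Rightarrow> bool" where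
  "quantum_operation E F T \<longleftrightarrow>
     linear_map E F T \<and> completely_positive E F T \<and> trace_preserving E F T"

text \<open>An isometry \<open>E \<rightarrow> K\<close> as a matrix \<open>W\<close> with \<open>W\<^sup>* W = 1\<close>, and the induced map \<open>\<rho> \<mapsto> W \<rho> W\<^sup>*\<close>.\<close>

definition isometry :: "'e set \<Rightarrow> 'k set \<Rightarrow> ('k \<Rightarrow> 'e \<Rightarrow> complex) \<Rightarrow> bool" where
  "isometry E K W \<longleftrightarrow>
     (\<forall>k e. k \<notin> K \<or> e \<notin> E \<longrightarrow> W k e = 0) \<and>
     (\<forall>e\<in>E. \<forall>e'\<in>E. (\<Sum>k\<in>K. cnj (W k e) * W k e') = (if e = e' then 1 else 0))"

definition isometry_map :: "'e set \<Rightarrow> ('k \<Rightarrow> 'e \<Rightarrow> complex) \<Rightarrow> 'e op \<Rightarrow> 'k op" where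
  "isometry_map E W \<rho> = (\<lambda>k k'. \<Sum>e\<in>E. \<Sum>e'\<in>E. W k e * \<rho> e e' * cnj (W k' e'))"

definition extension :: "'i set \<Rightarrow> 'f set \<Rightarrow> 'i op \<Rightarrow> ('i \<times> 'f) op \<Rightarrow> bool" where
  "extension I F \<rho> \<omega> \<longleftrightarrow> state (I \<times> F) \<omega> \<and> tr_snd F \<omega> = \<rho>"

definition pure :: "('i \<Rightarrow> complex) \<Rightarrow> 'i op" where
  "pure \<phi> = (\<lambda>i j. \<phi> i * cnj (\<phi> j))"

definition purification :: "'i set \<Rightarrow> 'f set \<Rightarrow> 'i op \<Rightarrow> ('i \<times> 'f \<Rightarrow> complex) \<Rightarrow> bool" where
  "purification I F \<rho> \<phi> \<longleftrightarrow>
     (\<forall>i. i \<notin> I \<times> F \<longrightarrow> \<phi> i = 0) \<and> tr_snd F (pure \<phi>) = \<rho>"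

text \<open>Reorderings of tensor factors: \<open>XEF \<rightarrow> XFE\<close>, and \<open>(ABE)(GH) \<rightarrow> (AG)(BH)E\<close>.\<close>

definition swap_last :: "(('x \<times> 'e) \<times> 'f) op \<Rightarrow> (('x \<times> 'f) \<times> 'e) op" where
  "swap_last \<rho> = (\<lambda>((x, f), e) ((x', f'), e'). \<rho> ((x, e), f) ((x', e'), f'))"

definition regroup ::
  "((('a \<times> 'b) \<times> 'e) \<times> ('g \<times> 'h)) op \<Rightarrow> ((('a \<times> 'g) \<times> ('b \<times> 'h)) \<times> 'e) op" where
  "regroup \<rho> = (\<lambda>(((a, g), (b, h)), e) (((a', g'), (b', h')), e').
     \<rho> (((a, b), e), (g, h)) (((a', b'), e'), (g', h')))"

definition regroup2 :: "(('a \<times> 'b) \<times> ('g \<times> 'h)) op \<Rightarrow> (('a \<times> 'g) \<times> ('b \<times> 'h)) op" where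
  "regroup2 \<rho> = (\<lambda>((a, g), (b, h)) ((a', g'), (b', h')).
     \<rho> ((a, b), (g, h)) ((a', b'), (g', h')))"

type_synonym ('a, 'b, 'e) op3 = "(('a \<times> 'b) \<times> 'e) op"

definition S_all :: "'a set \<Rightarrow> 'b set \<Rightarrow> 'e set \<Rightarrow> ('a, 'b, 'e) op3 set" where
  "S_all A B E = {\<rho>. state ((A \<times> B) \<times> E) \<rho>}"

definition I_down :: "'a set \<Rightarrow> 'b set \<Rightarrow> 'e set \<Rightarrow> ('a, 'b, 'e) op3 \<Rightarrow> real" where
  "I_down A B E \<rho> =
     Inf {cmi A B {..<n} (on_snd T \<rho>) | (n::nat) T. quantum_operation E {..<n} T}"

definition I_down_star :: "'a set \<Rightarrow> 'b set \<Rightarrow> 'e set \<Rightarrow> ('a, 'b, 'e) op3 \<Rightarrow> real" where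
  "I_down_star A B E \<rho> =
     Inf {cmi A B {..<n} (tr_snd E (swap_last \<omega>)) | (n::nat) \<omega>.
            extension ((A \<times> B) \<times> E) {..<n} \<rho> \<omega>}"

definition E_sq :: "'a set \<Rightarrow> 'b set \<Rightarrow> ('a \<times> 'b) op \<Rightarrow> real" where
  "E_sq A B \<tau> = 1/2 * Inf {cmi A B {..<n} \<omega> | (n::nat) \<omega>. extension (A \<times> B) {..<n} \<tau> \<omega>}"

definition I_sq :: "'a set \<Rightarrow> 'b set \<Rightarrow> 'e set \<Rightarrow> ('a, 'b, 'e) op3 \<Rightarrow> real" where
  "I_sq A B E \<rho> = 2 * E_sq A B (tr_snd E \<rho>)"

definition J_down :: "'a set \<Rightarrow> 'b set \<Rightarrow> 'e set \<Rightarrow> ('a, 'b, 'e) op3 \<Rightarrow> real" where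
  "J_down A B E \<rho> =
     Inf {Inf {cmi (A \<times> {..<m}) (B \<times> {..<n}) {..<k} (on_snd T (regroup (pure \<phi>))) | (k::nat) T.
                 quantum_operation E {..<k} T} | (m::nat) (n::nat) \<phi>.
            purification ((A \<times> B) \<times> E) ({..<m} \<times> {..<n}) \<rho> \<phi>}"

definition J_down_star :: "'a set \<Rightarrow> 'b set \<Rightarrow> 'e set \<Rightarrow> ('a, 'b, 'e) op3 \<Rightarrow> real" where
  "J_down_star A B E \<rho> =
     Inf {Inf {cmi (A \<times> {..<m}) (B \<times> {..<n}) {..<k}
                   (regroup (on_snd (isometry_map E W) (swap_last \<omega>))) | (k::nat) \<omega>.
                 extension ((A \<times> B) \<times> E) {..<k} \<rho> \<omega>} | (m::nat) (n::nat) W.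
            isometry E ({..<m} \<times> {..<n}) W}"

definition S_I :: "'a set \<Rightarrow> 'b set \<Rightarrow> 'e set \<Rightarrow> ('a, 'b, 'e) op3 set" where
  "S_I A B E = {\<rho>\<in>S_all A B E. \<exists>(n::nat) T. quantum_operation E {..<n} T \<and>
     on_snd T \<rho> \<in> markov_states A B {..<n}}"

definition S_I_star :: "'a set \<Rightarrow> 'b set \<Rightarrow> 'e set \<Rightarrow> ('a, 'b, 'e) op3 set" where
  "S_I_star A B E = {\<rho>\<in>S_all A B E. \<exists>(n::nat) \<omega>. extension ((A \<times> B) \<times> E) {..<n} \<rho> \<omega> \<and>
     tr_snd E (swap_last \<omega>) \<in> markov_states A B {..<n}}"

definition S_sep :: "'a set \<Rightarrow> 'b set \<Rightarrow> 'e set \<Rightarrow> ('a, 'b, 'e) op3 set" where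
  "S_sep A B E = {\<rho>\<in>S_all A B E. tr_snd E \<rho> \<in> sep_states A B}"

definition S_J :: "'a set \<Rightarrow> 'b set \<Rightarrow> 'e set \<Rightarrow> ('a, 'b, 'e) op3 set" where
  "S_J A B E = {\<rho>\<in>S_all A B E. \<exists>(m::nat) (n::nat) \<phi>.
     purification ((A \<times> B) \<times> E) ({..<m} \<times> {..<n}) \<rho> \<phi> \<and>
     tr_snd E (regroup (pure \<phi>)) \<in> sep_states (A \<times> {..<m}) (B \<times> {..<n})}"

definition S_J_star :: "'a set \<Rightarrow> 'b set \<Rightarrow> 'e set \<Rightarrow> ('a, 'b, 'e) op3 set" where
  "S_J_star A B E = {\<rho>\<in>S_all A B E. \<exists>(m::nat) (n::nat) W. isometry E ({..<m} \<times> {..<n}) W \<and>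
     regroup2 (on_snd (isometry_map E W) \<rho>) \<in> sep_states (A \<times> {..<m}) (B \<times> {..<n})}"

end

theory Submission
  imports Defs
begin

text \<open>
  Each infimum is over nonnegative reals by strong subadditivity, so it suffices to exhibit the value
  \<open>0\<close>.

  Strong subadditivity follows from monotonicity of the relative entropy under partial trace, applied to
  \<open>\<rho>\<^sup>A\<^sup>B\<^sup>E\<close> and \<open>1\<^sup>A \<otimes> (\<rho>\<^sup>B\<^sup>E + \<epsilon> 1)\<close> as \<open>\<epsilon> \<rightarrow> 0\<close>; the perturbation avoids any
  discussion of supports.  Write \<open>p\<close>, \<open>q\<close> for the eigenvalues of \<open>\<rho>\<close>, \<open>\<sigma>\<close> and \<open>c\<^sub>l\<^sub>k\<close> for the squared
  overlaps of their eigenvectors.  The function \<open>\<Sum> c\<^sub>l\<^sub>k p\<^sub>k ln (q\<^sub>l + s p\<^sub>k)\<close> of \<open>s\<close> interpolates between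
  \<open>Tr \<rho> ln \<sigma>\<close> and \<open>Tr \<rho> ln \<rho>\<close>, and its derivative is the maximum over operators \<open>X\<close> of
  \<open>2 Re Tr X\<^sup>*\<rho> - Tr X X\<^sup>*\<sigma> - s Tr X\<^sup>*X\<rho>\<close>.  Restricting \<open>X\<close> to operators \<open>X \<otimes> 1\<close> gives the derivative
  for the reduced states, which is therefore smaller.

  A separable state \<open>\<Sum> w\<^sub>k \<alpha>\<^sub>k \<otimes> \<beta>\<^sub>k\<close> has the extension \<open>\<Sum> w\<^sub>k \<alpha>\<^sub>k \<otimes> \<beta>\<^sub>k \<otimes> |k\<rangle>\<langle>k|\<close> of vanishing conditional
  mutual information.  For \<open>J\<^sub>\<down>\<close> it is prepared by a measurement on the purifying system \<open>E\<close>; for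
  \<open>J\<^sub>\<down>\<^sup>*\<close> it is supported on the range of the isometry and can be pulled back.
\<close>

section \<open>Matrices\<close>

text \<open>Write D for the relative entropy with natural logarithms. Tracing out B compares
  D(rho^AE || 1 x rho^E) = S(E) - S(AE) with D(rho^ABE || 1 x rho^BE) = S(BE) - S(ABE), and the
  difference of the two is the conditional mutual information up to the factor ln 2. Operator
  logarithms never occur: entropic quantities are scalar sums over eigenvalues and overlaps, and the
  derivative in s is <rho, (L + s R)^-1 rho>, where L multiplies by sigma from the left and R by rho
  from the right. The two multiplications commute, which is why the quadratic form splits into
  scalar squares in the pair of eigenbases. It is linear in rho and in sigma, which is why operators
  X x 1 see the reduced states only. The infimum of an empty set of reals has no useful value, so
  for the nested infima of the two J functions every inner set must also be shown to be
  inhabited.\<close>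

definition mm :: "('i \<Rightarrow> 'j \<Rightarrow> complex) \<Rightarrow> 'j set \<Rightarrow> ('j \<Rightarrow> 'k \<Rightarrow> complex) \<Rightarrow> 'i \<Rightarrow> 'k \<Rightarrow> complex"
    ("(_ \<odot>\<^bsub>_\<^esub> _)" [71, 0, 70] 70) where
  "A \<odot>\<^bsub>J\<^esub> B = (\<lambda>i k. \<Sum>j\<in>J. A i j * B j k)"

definition adj :: "('i \<Rightarrow> 'j \<Rightarrow> complex) \<Rightarrow> 'j \<Rightarrow> 'i \<Rightarrow> complex" where
  "adj A = (\<lambda>j i. cnj (A i j))"

definition diag :: "'i set \<Rightarrow> ('i \<Rightarrow> complex) \<Rightarrow> 'i op" where
  "diag I d = (\<lambda>i j. if i = j \<and> i \<in> I then d i else 0)"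

abbreviation one :: "'i set \<Rightarrow> 'i op" where
  "one I \<equiv> diag I (\<lambda>_. 1)"

text \<open>Two one-sided conditions refine membership in \<open>ops\<close>, since isometries and
  eigenvector matrices are rectangular, with rows and columns in different label sets; each makes
  \<open>one I\<close> a unit on its side.\<close>

definition row_supp :: "'i set \<Rightarrow> ('i \<Rightarrow> 'j \<Rightarrow> complex) \<Rightarrow> bool" where
  "row_supp I A \<longleftrightarrow> (\<forall>i j. i \<notin> I \<longrightarrow> A i j = 0)"

definition col_supp :: "'j set \<Rightarrow> ('i \<Rightarrow> 'j \<Rightarrow> complex) \<Rightarrow> bool" where
  "col_supp J A \<longleftrightarrow> (\<forall>i j. j \<notin> J \<longrightarrow> A i j = 0)"

lemma ops_iff_supp: "\<rho> \<in> ops I \<longleftrightarrow> row_supp I \<rho> \<and> col_supp I \<rho>"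
  by (auto simp: ops_def row_supp_def col_supp_def)

lemma mm_assoc [simp]: "(A \<odot>\<^bsub>I\<^esub> B) \<odot>\<^bsub>J\<^esub> C = A \<odot>\<^bsub>I\<^esub> B \<odot>\<^bsub>J\<^esub> C"
proof (intro ext)
  fix x y
  have "((A \<odot>\<^bsub>I\<^esub> B) \<odot>\<^bsub>J\<^esub> C) x y = (\<Sum>j\<in>J. \<Sum>i\<in>I. A x i * (B i j * C j y))"
    by (simp add: mm_def sum_distrib_right mult.assoc)
  also have "\<dots> = (\<Sum>i\<in>I. \<Sum>j\<in>J. A x i * (B i j * C j y))"
    by (rule sum.swap)
  also have "\<dots> = (A \<odot>\<^bsub>I\<^esub> B \<odot>\<^bsub>J\<^esub> C) x y"
    by (simp add: mm_def sum_distrib_left)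
  finally show "((A \<odot>\<^bsub>I\<^esub> B) \<odot>\<^bsub>J\<^esub> C) x y = (A \<odot>\<^bsub>I\<^esub> B \<odot>\<^bsub>J\<^esub> C) x y" .
qed

lemma adj_mm [simp]: "adj (A \<odot>\<^bsub>I\<^esub> B) = adj B \<odot>\<^bsub>I\<^esub> adj A"
  by (auto simp: adj_def mm_def mult.commute)

lemma adj_adj [simp]: "adj (adj A) = A"
  by (simp add: adj_def)

lemma adj_diag: "adj (diag I d) = diag I (\<lambda>i. cnj (d i))"
  by (auto simp: adj_def diag_def fun_eq_iff)

lemma adj_one [simp]: "adj (one I) = one I"
  by (simp add: adj_diag)

lemma row_supp_mm [simp]: "row_supp I A \<Longrightarrow> row_supp I (A \<odot>\<^bsub>J\<^esub> B)"
  by (simp add: row_supp_def mm_def)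

lemma col_supp_mm [simp]: "col_supp I B \<Longrightarrow> col_supp I (A \<odot>\<^bsub>J\<^esub> B)"
  by (simp add: col_supp_def mm_def)

lemma row_supp_adj [simp]: "row_supp I (adj A) \<longleftrightarrow> col_supp I A"
  by (auto simp: row_supp_def col_supp_def adj_def)

lemma col_supp_adj [simp]: "col_supp I (adj A) \<longleftrightarrow> row_supp I A"
  by (auto simp: row_supp_def col_supp_def adj_def)

lemma row_supp_diag [simp]: "row_supp I (diag I d)"
  and col_supp_diag [simp]: "col_supp I (diag I d)"
  by (auto simp: row_supp_def col_supp_def diag_def)

lemma diag_mm_apply:
  assumes "finite I"
  shows "(diag I d \<odot>\<^bsub>I\<^esub> A) i k = (if i \<in> I then d i * A i k else 0)"
proof -
  have "(diag I d \<odot>\<^bsub>I\<^esub> A) i k = (\<Sum>j\<in>I. if j = i then d i * A i k else 0)"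
    unfolding mm_def diag_def by (intro sum.cong) auto
  then show ?thesis using assms by (simp add: sum.delta)
qed

lemma mm_diag_apply:
  assumes "finite I"
  shows "(A \<odot>\<^bsub>I\<^esub> diag I d) i k = (if k \<in> I then A i k * d k else 0)"
proof -
  have "(A \<odot>\<^bsub>I\<^esub> diag I d) i k = (\<Sum>j\<in>I. if j = k then A i k * d k else 0)"
    unfolding mm_def diag_def by (intro sum.cong) auto
  then show ?thesis using assms by (simp add: sum.delta)
qed

lemma one_mm [simp]: "finite I \<Longrightarrow> row_supp I A \<Longrightarrow> one I \<odot>\<^bsub>I\<^esub> A = A"
  by (auto simp: diag_mm_apply row_supp_def fun_eq_iff)

lemma mm_one [simp]: "finite I \<Longrightarrow> col_supp I A \<Longrightarrow> A \<odot>\<^bsub>I\<^esub> one I = A"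
  by (auto simp: mm_diag_apply col_supp_def fun_eq_iff)

lemma op_trace_mm_commute: "op_trace I (A \<odot>\<^bsub>J\<^esub> B) = op_trace J (B \<odot>\<^bsub>I\<^esub> A)"
  unfolding op_trace_def mm_def by (subst sum.swap) (simp add: mult.commute)

section \<open>Positive operators\<close>

definition quad :: "'i set \<Rightarrow> 'i op \<Rightarrow> ('i \<Rightarrow> complex) \<Rightarrow> complex" where
  "quad I \<rho> v = (\<Sum>i\<in>I. \<Sum>j\<in>I. cnj (v i) * \<rho> i j * v j)"

lemma psd_iff_quad: "psd I \<rho> \<longleftrightarrow> (\<forall>v. 0 \<le> quad I \<rho> v)"
  by (simp add: psd_def quad_def)

text \<open>A vector is read as a matrix with the single column \<open>()\<close>, so that
  congruences become instances of associativity.\<close>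

lemma quad_eq_mm: "quad I \<rho> v = (adj (\<lambda>i (_::unit). v i) \<odot>\<^bsub>I\<^esub> \<rho> \<odot>\<^bsub>I\<^esub> (\<lambda>i _. v i)) () ()"
  by (simp add: quad_def mm_def adj_def sum_distrib_left mult.assoc)

lemma quad_congruence:
  "quad J (adj B \<odot>\<^bsub>I\<^esub> \<rho> \<odot>\<^bsub>I\<^esub> B) v = quad I \<rho> (\<lambda>i. \<Sum>j\<in>J. B i j * v j)"
proof -
  have "(\<lambda>i (_::unit). \<Sum>j\<in>J. B i j * v j) = B \<odot>\<^bsub>J\<^esub> (\<lambda>j _. v j)"
    by (simp add: mm_def)
  then show ?thesis
    unfolding quad_eq_mm by simp
qed

lemma psd_congruence: "psd I \<rho> \<Longrightarrow> psd J (adj B \<odot>\<^bsub>I\<^esub> \<rho> \<odot>\<^bsub>I\<^esub> B)"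
  by (simp add: psd_iff_quad quad_congruence)

lemma quad_two:
  assumes "finite I" "i \<in> I" "j \<in> I" "i \<noteq> j"
  shows "quad I \<rho> (\<lambda>k. if k = i then a else if k = j then b else 0)
    = cnj a * \<rho> i i * a + cnj a * \<rho> i j * b + cnj b * \<rho> j i * a + cnj b * \<rho> j j * b"
proof -
  let ?v = "\<lambda>k. if k = i then a else if k = j then b else 0"
  have inner: "(\<Sum>l\<in>I. cnj (?v k) * \<rho> k l * ?v l) = cnj (?v k) * \<rho> k i * a + cnj (?v k) * \<rho> k j * b" for k
  proof -
    have "(\<Sum>l\<in>I. cnj (?v k) * \<rho> k l * ?v l) = (\<Sum>l\<in>{i,j}. cnj (?v k) * \<rho> k l * ?v l)"
      using assms by (intro sum.mono_neutral_right) auto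
    then show ?thesis using assms by simp
  qed
  have "quad I \<rho> ?v = (\<Sum>k\<in>I. cnj (?v k) * \<rho> k i * a + cnj (?v k) * \<rho> k j * b)"
    unfolding quad_def inner ..
  also have "\<dots> = (\<Sum>k\<in>{i,j}. cnj (?v k) * \<rho> k i * a + cnj (?v k) * \<rho> k j * b)"
    using assms by (intro sum.mono_neutral_right) auto
  finally show ?thesis using assms by simp
qed

lemma quad_single:
  assumes "finite I" "i \<in> I"
  shows "quad I \<rho> (\<lambda>k. if k = i then 1 else 0) = \<rho> i i"
proof -
  let ?v = "\<lambda>k. if k = i then 1 else (0::complex)"
  have "(\<Sum>l\<in>I. cnj (?v k) * \<rho> k l * ?v l) = (if k = i then \<rho> i i else 0)" for k
    using assms by (auto simp: sum.delta if_distrib cong: if_cong)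
  then have "quad I \<rho> ?v = (\<Sum>k\<in>I. if k = i then \<rho> i i else 0)"
    unfolding quad_def by simp
  then show ?thesis using assms by simp
qed

lemma psd_diag_nonneg: "finite I \<Longrightarrow> psd I \<rho> \<Longrightarrow> i \<in> I \<Longrightarrow> 0 \<le> \<rho> i i"
  by (metis psd_iff_quad quad_single)

lemma psd_hermitian:
  assumes fin: "finite I" and psd: "psd I \<rho>" and ij: "i \<in> I" "j \<in> I"
  shows "\<rho> j i = cnj (\<rho> i j)"
proof (cases "i = j")
  case True
  then show ?thesis using psd_diag_nonneg[OF fin psd ij(1)]
    by (auto simp: complex_eq_iff less_eq_complex_def)
next
  case False
  have diag: "Im (\<rho> i i) = 0" "Im (\<rho> j j) = 0"
    using psd_diag_nonneg[OF fin psd] ij by (auto simp: less_eq_complex_def)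
  have *: "Im (cnj a * \<rho> i i * a + cnj a * \<rho> i j * b + cnj b * \<rho> j i * a + cnj b * \<rho> j j * b) = 0" for a b
    using psd quad_two[OF fin ij False, of \<rho> a b]
    by (metis less_eq_complex_def psd_iff_quad zero_complex.sel(2))
  \<comment> \<open>The vector with both entries 1 shows that the imaginary parts of the two
    off-diagonal entries cancel, the one with entries 1 and the imaginary unit that their real parts
    agree.\<close>
  from *[of 1 1] *[of 1 "\<i>"] diag show ?thesis
    by (auto simp: complex_eq_iff)
qed

definition hermitian :: "'i set \<Rightarrow> 'i op \<Rightarrow> bool" where
  "hermitian I \<rho> \<longleftrightarrow> \<rho> \<in> ops I \<and> adj \<rho> = \<rho>"

lemma psd_ops_hermitian: "finite I \<Longrightarrow> psd I \<rho> \<Longrightarrow> \<rho> \<in> ops I \<Longrightarrow> hermitian I \<rho>"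
  unfolding hermitian_def adj_def ops_def
  by (safe; rule ext; rule ext) (metis (mono_tags, lifting) complex_cnj_zero mem_Collect_eq psd_hermitian)

section \<open>Spectral decomposition\<close>

text \<open>The eigenvectors carry their own label set \<open>K\<close>: for a tensor product the
  labels are pairs, for a block operator an eigenvector and a block, and reordering the tensor
  factors of \<open>I\<close> leaves the labels of the eigenvalues alone. Real \<open>p\<close>
  restricts the notion to Hermitian operators.\<close>

definition eigdec :: "'i set \<Rightarrow> 'k set \<Rightarrow> 'i op \<Rightarrow> ('k \<Rightarrow> real) \<Rightarrow> ('i \<Rightarrow> 'k \<Rightarrow> complex) \<Rightarrow> bool" where
  "eigdec I K \<rho> p U \<longleftrightarrow> row_supp I U \<and> col_supp K U \<and>
     adj U \<odot>\<^bsub>I\<^esub> U = one K \<and> U \<odot>\<^bsub>K\<^esub> adj U = one I \<and>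
     \<rho> = U \<odot>\<^bsub>K\<^esub> diag K (\<lambda>k. of_real (p k)) \<odot>\<^bsub>K\<^esub> adj U"

text \<open>Products are nested to the right by \<open>mm_assoc\<close>, which hides
  \<open>adj U \<odot> U\<close> inside a longer chain; the last two facts perform the cancellation
  there.\<close>

lemma eigdecD:
  assumes "eigdec I K \<rho> p U"
  shows "row_supp I U" "col_supp K U" "adj U \<odot>\<^bsub>I\<^esub> U = one K" "U \<odot>\<^bsub>K\<^esub> adj U = one I"
    "\<rho> = U \<odot>\<^bsub>K\<^esub> diag K (\<lambda>k. of_real (p k)) \<odot>\<^bsub>K\<^esub> adj U"
    "adj U \<odot>\<^bsub>I\<^esub> U \<odot>\<^bsub>J\<^esub> Z = one K \<odot>\<^bsub>J\<^esub> Z" "U \<odot>\<^bsub>K\<^esub> adj U \<odot>\<^bsub>J'\<^esub> Z' = one I \<odot>\<^bsub>J'\<^esub> Z'"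
  using assms mm_assoc[of "adj U" I U J Z] mm_assoc[of U K "adj U" J' Z']
  unfolding eigdec_def by auto

text \<open>The characteristic polynomial has positive degree \<open>card I\<close>, hence a complex
  root; the eigenvector is carried back from matrix indices along
  \<open>from_nat_into I\<close>.\<close>

lemma ex_eigenvector:
  fixes \<rho> :: "'i op"
  assumes fin: "finite I" and ne: "I \<noteq> {}"
  shows "\<exists>v l. (\<exists>i\<in>I. v i \<noteq> 0) \<and> (\<forall>i\<in>I. (\<Sum>j\<in>I. \<rho> i j * v j) = l * v i)"
proof -
  let ?n = "card I" and ?A = "op_mat I \<rho>"
  have bij: "bij_betw (from_nat_into I) {..<?n} I"
    using bij_betw_from_nat_into_finite[OF fin] .
  have carr: "?A \<in> carrier_mat ?n ?n" by (simp add: op_mat_def)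
  have n0: "?n \<noteq> 0" using fin ne by simp
  have "degree (char_poly ?A) = ?n" using degree_monic_char_poly[OF carr] by simp
  then have "\<not> constant (poly (char_poly ?A))"
    using n0 by (simp add: constant_degree)
  then obtain l where "poly (char_poly ?A) l = 0"
    using fundamental_theorem_of_algebra by blast
  then have "eigenvalue ?A l"
    using eigenvalue_root_char_poly[OF carr] by simp
  then obtain v where v: "v \<in> carrier_vec ?n" "v \<noteq> 0\<^sub>v ?n" "?A *\<^sub>v v = l \<cdot>\<^sub>v v"
    using carr unfolding eigenvalue_def eigenvector_def by auto
  define g where "g = the_inv_into {..<?n} (from_nat_into I)"
  have g: "g (from_nat_into I k) = k" if "k < ?n" for k
    unfolding g_def using bij that by (simp add: bij_betw_def the_inv_into_f_f)
  define w where "w i = v $ g i" for i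
  have w: "w (from_nat_into I k) = v $ k" if "k < ?n" for k
    using g[OF that] by (simp add: w_def)
  have surj: "\<exists>k<?n. i = from_nat_into I k" if "i \<in> I" for i
    using bij that unfolding bij_betw_def by auto
  have mem: "from_nat_into I k \<in> I" for k
    using ne by (rule from_nat_into)
  obtain k where k: "k < ?n" "v $ k \<noteq> 0"
    using v(1,2) by (metis carrier_vecD eq_vecI index_zero_vec(1) index_zero_vec(2))
  have "\<exists>i\<in>I. w i \<noteq> 0" using k w mem by metis
  moreover have "(\<Sum>j\<in>I. \<rho> i j * w j) = l * w i" if i: "i \<in> I" for i
  proof -
    obtain a where a: "a < ?n" "i = from_nat_into I a" using surj i by blast
    have "(\<Sum>j\<in>I. \<rho> i j * w j) = (\<Sum>b<?n. \<rho> i (from_nat_into I b) * w (from_nat_into I b))"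
      by (rule sum.reindex_bij_betw[OF bij, symmetric])
    also have "\<dots> = (\<Sum>b<?n. ?A $$ (a, b) * v $ b)"
      using a by (intro sum.cong) (auto simp: op_mat_def w)
    also have "\<dots> = (?A *\<^sub>v v) $ a"
      using a v(1) carr by (simp add: scalar_prod_def lessThan_atLeast0)
    also have "\<dots> = l * w i" using v(1) v(3) a w by simp
    finally show ?thesis .
  qed
  ultimately show ?thesis by blast
qed

lemma op_trace_one: "finite I \<Longrightarrow> op_trace I (one I) = of_nat (card I)"
  by (simp add: op_trace_def diag_def)

text \<open>By cyclicity \<open>U \<odot> adj U\<close> and \<open>adj U \<odot> U\<close> have the
  same trace, which counts \<open>I\<close> and \<open>K\<close> respectively.\<close>

lemma eigdec_card:
  assumes "eigdec I K \<rho> p U" "finite I" "finite K"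
  shows "card I = card K"
proof -
  have "op_trace I (U \<odot>\<^bsub>K\<^esub> adj U) = op_trace K (adj U \<odot>\<^bsub>I\<^esub> U)"
    by (rule op_trace_mm_commute)
  then show ?thesis
    using assms by (simp add: eigdecD[OF assms(1)] op_trace_one)
qed

lemma eigdec_unitary:
  assumes e: "eigdec I K M p V" and "finite I" "finite K"
    and H: "row_supp I H" "col_supp I H" "adj H \<odot>\<^bsub>I\<^esub> H = one I" "H \<odot>\<^bsub>I\<^esub> adj H = one I"
  shows "eigdec I K (H \<odot>\<^bsub>I\<^esub> M \<odot>\<^bsub>I\<^esub> adj H) p (H \<odot>\<^bsub>I\<^esub> V)"
proof -
  have *: "adj H \<odot>\<^bsub>I\<^esub> H \<odot>\<^bsub>I\<^esub> V = V"
    using assms eigdecD(1)[OF e] by (metis mm_assoc one_mm)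
  note D = eigdecD[OF e]
  show ?thesis
    unfolding eigdec_def using assms D(1,2) by (auto simp: * D(3,4,6,7) D(5))
qed

lemma mm_insert:
  "finite F \<Longrightarrow> x \<notin> F \<Longrightarrow> (A \<odot>\<^bsub>insert x F\<^esub> B) i k = A i x * B x k + (A \<odot>\<^bsub>F\<^esub> B) i k"
  by (simp add: mm_def)

lemma mm_diag_mm: "finite K \<Longrightarrow> (A \<odot>\<^bsub>K\<^esub> diag K d \<odot>\<^bsub>K\<^esub> B) i j = (\<Sum>k\<in>K. A i k * d k * B k j)"
  by (simp only: mm_def[of A] diag_mm_apply) (simp add: mult.assoc)

text \<open>The phase making \<open>u x\<close> real and nonpositive is the one that suits the
  reflection below: its denominator is \<open>1 - r\<close>, which is then at least 1.\<close>

lemma ex_unit_eigenvector: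
  fixes \<rho> :: "'i op"
  assumes fin: "finite I" and x: "x \<in> I"
  shows "\<exists>u l r. (\<forall>i. i \<notin> I \<longrightarrow> u i = 0) \<and> (\<Sum>i\<in>I. cnj (u i) * u i) = 1 \<and> u x = of_real r \<and> r \<le> 0
    \<and> (\<forall>i\<in>I. (\<Sum>j\<in>I. \<rho> i j * u j) = l * u i)"
proof -
  obtain v l where v: "\<exists>i\<in>I. v i \<noteq> 0" "\<And>i. i \<in> I \<Longrightarrow> (\<Sum>j\<in>I. \<rho> i j * v j) = l * v i"
    using ex_eigenvector[OF fin, of \<rho>] x by blast
  define N where "N = (\<Sum>i\<in>I. (cmod (v i))\<^sup>2)"
  have N: "N > 0"
    unfolding N_def using v(1) fin by (auto intro!: sum_pos2)
  \<comment> \<open>Minus the conjugate phase of \<open>v x\<close> turns \<open>c * v x\<close>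
    into minus its modulus; if \<open>v x\<close> vanishes any unit phase will do, here 1.\<close>
  define c where "c = (if v x = 0 then 1 else - cnj (v x) / of_real (cmod (v x)))"
  have cc: "cnj c * c = 1"
  proof -
    have "cmod c = 1" by (simp add: c_def norm_divide)
    then show ?thesis using complex_norm_square[of c] by (simp add: mult.commute)
  qed
  have cv: "c * v x = of_real (- cmod (v x))"
    by (auto simp: c_def field_simps complex_norm_square[symmetric] power2_eq_square)
  define d where "d = c / of_real (sqrt N)"
  define u where "u i = (if i \<in> I then d * v i else 0)" for i
  have dd: "cnj d * d = 1 / of_real N"
  proof -
    have "cnj d * d = (cnj c * c) / (of_real (sqrt N) * of_real (sqrt N))"
      by (simp add: d_def)
    also have "of_real (sqrt N) * of_real (sqrt N) = (of_real N :: complex)"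
      using N by (simp flip: of_real_mult)
    finally show ?thesis by (simp add: cc)
  qed
  have "(\<Sum>i\<in>I. cnj (u i) * u i) = (\<Sum>i\<in>I. (cnj d * d) * of_real ((cmod (v i))\<^sup>2))"
    by (intro sum.cong) (auto simp: u_def complex_norm_square[symmetric] mult_ac simp del: of_real_power)
  also have "\<dots> = (cnj d * d) * of_real N"
    by (simp add: N_def sum_distrib_left del: of_real_power)
  also have "\<dots> = 1" using N by (simp add: dd)
  finally have "(\<Sum>i\<in>I. cnj (u i) * u i) = 1" .
  moreover have "u x = of_real (- cmod (v x) / sqrt N)"
    using x cv by (simp add: u_def d_def)
  moreover have "- cmod (v x) / sqrt N \<le> 0" using N by simp
  moreover have "(\<Sum>j\<in>I. \<rho> i j * u j) = l * u i" if "i \<in> I" for i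
  proof -
    have "(\<Sum>j\<in>I. \<rho> i j * u j) = d * (\<Sum>j\<in>I. \<rho> i j * v j)"
      by (simp add: u_def sum_distrib_left mult_ac)
    then show ?thesis using v(2)[OF that] that by (simp add: u_def)
  qed
  moreover have "\<forall>i. i \<notin> I \<longrightarrow> u i = 0" by (simp add: u_def)
  ultimately show ?thesis by blast
qed

text \<open>The Householder reflection sending the basis vector \<open>x\<close> to \<open>u\<close>.\<close>

lemma householder:
  fixes u :: "'i \<Rightarrow> complex"
  assumes fin: "finite I" and x: "x \<in> I" and supp: "\<And>i. i \<notin> I \<Longrightarrow> u i = 0"
    and unit: "(\<Sum>i\<in>I. cnj (u i) * u i) = 1" and r: "u x = of_real r" "r \<le> 0"
  shows "\<exists>H. H \<in> ops I \<and> adj H = H \<and> H \<odot>\<^bsub>I\<^esub> H = one I \<and> (\<forall>i. H i x = u i)"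
proof -
  define t :: complex where "t = of_real (1 - r)"
  have "1 - r \<noteq> 0" using r(2) by simp
  then have t0: "t \<noteq> 0" unfolding t_def of_real_eq_0_iff .
  have ct: "cnj t = t" by (simp add: t_def)
  define z where "z i = (if i = x then 1 else 0) - u i" for i
  have zx: "z x = t" by (simp add: z_def t_def r)
  have zsupp: "z i = 0" if "i \<notin> I" for i using that supp x by (auto simp: z_def)
  have zz: "(\<Sum>i\<in>I. cnj (z i) * z i) = 2 * t"
  proof -
    have "(\<Sum>i\<in>I. cnj (z i) * z i)
      = (\<Sum>i\<in>I. (if i = x then 1 - u i - cnj (u i) else 0) + cnj (u i) * u i)"
      by (intro sum.cong) (auto simp: z_def algebra_simps)
    also have "\<dots> = (1 - u x - cnj (u x)) + 1"
      using fin x unit by (simp add: sum.distrib)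
    finally show ?thesis by (simp add: t_def r)
  qed
  \<comment> \<open>Since <z, z> = 2 t, this is twice the projection onto \<open>z\<close>, so
    subtracting it from the identity gives an involution; as \<open>z x\<close> is the real number
    \<open>t\<close>, the column of \<open>H\<close> at \<open>x\<close> is
    \<open>u\<close>.\<close>
  define P where "P i j = z i * cnj (z j) / t" for i j
  define H where "H i j = one I i j - P i j" for i j
  have P: "P \<in> ops I" by (auto simp: ops_def P_def zsupp)
  have PP: "(P \<odot>\<^bsub>I\<^esub> P) i j = 2 * P i j" for i j
  proof -
    have "(P \<odot>\<^bsub>I\<^esub> P) i j = z i * cnj (z j) / (t * t) * (\<Sum>k\<in>I. cnj (z k) * z k)"
      unfolding mm_def P_def sum_distrib_left by (intro sum.cong) (auto simp: field_simps)
    then show ?thesis by (simp add: zz P_def t0)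
  qed
  have "H \<odot>\<^bsub>I\<^esub> H = one I"
  proof (intro ext)
    fix i j
    have "(H \<odot>\<^bsub>I\<^esub> H) i j
      = (one I \<odot>\<^bsub>I\<^esub> one I) i j - (one I \<odot>\<^bsub>I\<^esub> P) i j - (P \<odot>\<^bsub>I\<^esub> one I) i j + (P \<odot>\<^bsub>I\<^esub> P) i j"
      unfolding mm_def H_def by (simp add: algebra_simps sum.distrib sum_subtractf)
    also have "\<dots> = one I i j"
      using P fin by (simp add: PP ops_iff_supp)
    finally show "(H \<odot>\<^bsub>I\<^esub> H) i j = one I i j" .
  qed
  moreover have "adj H = H"
    by (auto simp: adj_def H_def P_def ct diag_def fun_eq_iff)
  moreover have "H i x = u i" for i
  proof -
    have "H i x = one I i x - z i" by (simp add: H_def P_def zx ct t0)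
    then show ?thesis using supp x by (auto simp: diag_def z_def)
  qed
  moreover have "H \<in> ops I"
    using P by (auto simp: ops_def H_def diag_def)
  ultimately show ?thesis by blast
qed

text \<open>Induction on the dimension. Conjugation by a reflection that carries the basis vector
  \<open>x\<close> to an eigenvector clears the column at \<open>x\<close> up to its diagonal entry;
  hermiticity clears the row and makes that entry real, leaving a Hermitian operator on
  \<open>F\<close>.\<close>

theorem hermitian_eigdec:
  assumes "finite I" "hermitian I \<rho>"
  shows "\<exists>p U. eigdec I I \<rho> p U"
  using assms
proof (induction I arbitrary: \<rho> rule: finite_induct)
  case empty
  then have "eigdec {} {} \<rho> (\<lambda>_. 0) (\<lambda>_ _. 0)"
    by (auto simp: eigdec_def row_supp_def col_supp_def mm_def diag_def hermitian_def ops_def fun_eq_iff)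
  then show ?case by blast
next
  case (insert x F)
  let ?I = "insert x F"
  have fin: "finite ?I" using insert by simp
  have \<rho>: "row_supp ?I \<rho>" "col_supp ?I \<rho>" "adj \<rho> = \<rho>"
    using insert.prems by (auto simp: hermitian_def ops_iff_supp)
  obtain u l r where u: "\<And>i. i \<notin> ?I \<Longrightarrow> u i = 0" "(\<Sum>i\<in>?I. cnj (u i) * u i) = 1"
    "u x = of_real r" "r \<le> 0" "\<And>i. i \<in> ?I \<Longrightarrow> (\<Sum>j\<in>?I. \<rho> i j * u j) = l * u i"
    using ex_unit_eigenvector[OF fin, of x \<rho>] by blast
  obtain H where H: "row_supp ?I H" "col_supp ?I H" "adj H = H" "H \<odot>\<^bsub>?I\<^esub> H = one ?I" "\<And>i. H i x = u i"
    using householder[OF fin _ u(1,2,3,4)] by (auto simp: ops_iff_supp)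
  define M where "M = H \<odot>\<^bsub>?I\<^esub> \<rho> \<odot>\<^bsub>?I\<^esub> H"
  have Msupp: "row_supp ?I M" "col_supp ?I M" using H(1,2) by (auto simp: M_def)
  have Madj: "adj M = M" using H(3) \<rho>(3) by (simp add: M_def)
  have \<rho>H: "(\<rho> \<odot>\<^bsub>?I\<^esub> H) i x = l * H i x" for i
  proof (cases "i \<in> ?I")
    case True
    then show ?thesis using u(5)[OF True] by (simp add: mm_def H(5))
  next
    case False
    then show ?thesis using \<rho>(1) u(1) by (simp add: mm_def H(5) row_supp_def)
  qed
  have "M i x = l * (H \<odot>\<^bsub>?I\<^esub> H) i x" for i
    unfolding M_def mm_def[of H] sum_distrib_left by (simp add: \<rho>H mult.left_commute)
  then have Mx: "M i x = (if i = x then l else 0)" for i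
    by (simp add: H(4) diag_def)
  have Mx': "M x i = (if i = x then cnj l else 0)" for i
    using Mx[of i] Madj by (metis adj_def complex_cnj_zero)
  have l: "of_real (Re l) = l"
    using Mx[of x] Mx'[of x] by (simp add: complex_eq_iff)
  define N where "N i j = (if i \<in> F \<and> j \<in> F then M i j else 0)" for i j
  have "hermitian F N"
    using Madj unfolding hermitian_def ops_def N_def adj_def by (auto simp: fun_eq_iff)
  then obtain p V where pV: "eigdec F F N p V" using insert.IH by blast
  note D = eigdecD[OF pV]
  define V' where "V' i k = (if i = x \<and> k = x then 1 else V i k)" for i k
  have Vx: "V x k = 0" "V k x = 0" for k
    using D(1,2) insert.hyps by (auto simp: row_supp_def col_supp_def)
  have V'x: "V' x k = (if k = x then 1 else 0)" "V' k x = (if k = x then 1 else 0)" for k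
    by (auto simp: V'_def Vx)
  have V'F: "V' k i = V k i" "V' i k = V i k" if "k \<in> F" for i k
    using that insert.hyps by (auto simp: V'_def)
  have aV'F: "adj V' k i = adj V k i" "adj V' i k = adj V i k" if "k \<in> F" for i k
    using V'F that by (auto simp: adj_def)
  have aV'x: "adj V' x k = (if k = x then 1 else 0)" "adj V' k x = (if k = x then 1 else 0)" for k
    by (auto simp: adj_def V'x)
  have oneI: "one ?I i j = (if i = x \<and> j = x then 1 else 0) + one F i j" for i j
    using insert.hyps by (auto simp: diag_def)
  have "eigdec ?I ?I M (p(x := Re l)) V'"
    unfolding eigdec_def
  proof (intro conjI)
    show "row_supp ?I V'" "col_supp ?I V'"
      using D(1,2) by (auto simp: row_supp_def col_supp_def V'_def)
    have "(adj V' \<odot>\<^bsub>F\<^esub> V') i j = (adj V \<odot>\<^bsub>F\<^esub> V) i j" "(V' \<odot>\<^bsub>F\<^esub> adj V') i j = (V \<odot>\<^bsub>F\<^esub> adj V) i j" for i j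
      unfolding mm_def by (auto intro!: sum.cong simp: V'F aV'F)
    then show "adj V' \<odot>\<^bsub>?I\<^esub> V' = one ?I" "V' \<odot>\<^bsub>?I\<^esub> adj V' = one ?I"
      using insert.hyps
      by (auto simp: fun_eq_iff mm_insert V'x aV'x oneI D(3,4))
    show "M = V' \<odot>\<^bsub>?I\<^esub> diag ?I (\<lambda>k. of_real ((p(x := Re l)) k)) \<odot>\<^bsub>?I\<^esub> adj V'"
    proof (intro ext)
      fix i j
      have "(V' \<odot>\<^bsub>?I\<^esub> diag ?I (\<lambda>k. of_real ((p(x := Re l)) k)) \<odot>\<^bsub>?I\<^esub> adj V') i j
        = (\<Sum>k\<in>?I. V' i k * of_real ((p(x := Re l)) k) * adj V' k j)"
        by (rule mm_diag_mm[OF fin])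
      also have "\<dots> = (if i = x \<and> j = x then l else 0) + (\<Sum>k\<in>F. V' i k * of_real ((p(x := Re l)) k) * adj V' k j)"
        using insert.hyps l by (simp add: V'x aV'x)
      also have "(\<Sum>k\<in>F. V' i k * of_real ((p(x := Re l)) k) * adj V' k j) = (\<Sum>k\<in>F. V i k * of_real (p k) * adj V k j)"
        using insert.hyps by (intro sum.cong) (auto simp: V'F aV'F)
      also have "\<dots> = N i j"
        by (subst D(5)) (rule mm_diag_mm[OF insert.hyps(1), symmetric])
      also have "(if i = x \<and> j = x then l else 0) + N i j = M i j"
        using insert.hyps Msupp
        by (cases "i = x"; cases "j = x") (auto simp: N_def row_supp_def col_supp_def Mx Mx')
      finally show "M i j = (V' \<odot>\<^bsub>?I\<^esub> diag ?I (\<lambda>k. of_real ((p(x := Re l)) k)) \<odot>\<^bsub>?I\<^esub> adj V') i j" ..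
    qed
  qed
  then have "eigdec ?I ?I (H \<odot>\<^bsub>?I\<^esub> M \<odot>\<^bsub>?I\<^esub> adj H) (p(x := Re l)) (H \<odot>\<^bsub>?I\<^esub> V')"
    by (rule eigdec_unitary) (use fin H in auto)
  moreover have "H \<odot>\<^bsub>?I\<^esub> M \<odot>\<^bsub>?I\<^esub> adj H = \<rho>"
  proof -
    have "H \<odot>\<^bsub>?I\<^esub> M \<odot>\<^bsub>?I\<^esub> adj H = (H \<odot>\<^bsub>?I\<^esub> H) \<odot>\<^bsub>?I\<^esub> \<rho> \<odot>\<^bsub>?I\<^esub> (H \<odot>\<^bsub>?I\<^esub> H)"
      by (simp only: M_def mm_assoc H(3))
    then show ?thesis using \<rho> fin by (simp only: H(4) one_mm mm_one)
  qed
  ultimately show ?case by auto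
qed

section \<open>Positivity, trace and entropy from a spectral decomposition\<close>

lemma quad_eigdec:
  assumes e: "eigdec I K \<rho> p U" and fin: "finite K"
  shows "quad I \<rho> v = (\<Sum>k\<in>K. of_real (p k * (cmod (\<Sum>i\<in>I. cnj (U i k) * v i))\<^sup>2))"
proof -
  let ?w = "\<lambda>k. \<Sum>i\<in>I. adj U k i * v i"
  have "quad I \<rho> v = quad I (adj (adj U) \<odot>\<^bsub>K\<^esub> diag K (\<lambda>k. of_real (p k)) \<odot>\<^bsub>K\<^esub> adj U) v"
    by (subst eigdecD(5)[OF e]) simp
  also have "\<dots> = quad K (diag K (\<lambda>k. of_real (p k))) ?w"
    by (rule quad_congruence)
  also have "\<dots> = (\<Sum>k\<in>K. \<Sum>l\<in>K. if k = l then of_real (p k) * (cnj (?w k) * ?w k) else 0)"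
    unfolding quad_def diag_def by (intro sum.cong) auto
  also have "\<dots> = (\<Sum>k\<in>K. of_real (p k) * (?w k * cnj (?w k)))"
    using fin by (simp add: mult.commute)
  also have "\<dots> = (\<Sum>k\<in>K. of_real (p k * (cmod (?w k))\<^sup>2))"
    by (simp only: of_real_mult complex_norm_square)
  finally show ?thesis by (simp add: adj_def)
qed

lemma eigdec_diag_entry:
  assumes e: "eigdec I K \<rho> p U" and fin: "finite K" and k: "k \<in> K"
  shows "quad I \<rho> (\<lambda>i. U i k) = of_real (p k)"
proof -
  have "(\<Sum>i\<in>I. cnj (U i j) * U i k) = (if j = k then 1 else 0)" if "j \<in> K" for j
    using fun_cong[OF fun_cong[OF eigdecD(3)[OF e], of j], of k] that
    by (simp add: mm_def adj_def diag_def)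
  then have "quad I \<rho> (\<lambda>i. U i k) = (\<Sum>j\<in>K. if j = k then of_real (p j) else 0)"
    unfolding quad_eigdec[OF e fin] by (intro sum.cong) auto
  then show ?thesis using fin k by simp
qed

lemma psd_eigdec_nonneg:
  assumes "eigdec I K \<rho> p U" "finite K" "psd I \<rho>" "k \<in> K"
  shows "0 \<le> p k"
  using eigdec_diag_entry[OF assms(1,2,4)] assms(3) unfolding psd_iff_quad
  by (metis Re_complex_of_real less_eq_complex_def zero_complex.sel(1))

lemma psd_eigdec:
  assumes "finite I" "psd I \<rho>" "\<rho> \<in> ops I"
  shows "\<exists>p U. eigdec I I \<rho> p U \<and> (\<forall>k\<in>I. 0 \<le> p k)"
  using hermitian_eigdec[OF assms(1) psd_ops_hermitian[OF assms]] psd_eigdec_nonneg assms by metis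

lemma eigdec_trace:
  assumes e: "eigdec I K \<rho> p U" and fin: "finite I" "finite K"
  shows "op_trace I \<rho> = of_real (\<Sum>k\<in>K. p k)"
proof -
  have "op_trace I \<rho> = op_trace K ((diag K (\<lambda>k. of_real (p k)) \<odot>\<^bsub>K\<^esub> adj U) \<odot>\<^bsub>I\<^esub> U)"
    by (subst eigdecD(5)[OF e]) (rule op_trace_mm_commute)
  also have "\<dots> = op_trace K (diag K (\<lambda>k. of_real (p k)))"
    using fin by (simp add: eigdecD(3)[OF e])
  finally show ?thesis by (simp add: op_trace_def diag_def)
qed

text \<open>Frees the entropy from the characteristic polynomial: along enumerations of
  \<open>I\<close> and \<open>K\<close>, \<open>U\<close> is a similarity between
  \<open>op_mat I \<rho>\<close> and a diagonal matrix, so the roots with multiplicity are the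
  \<open>p k\<close>.\<close>

lemma entropy_eigdec:
  assumes e: "eigdec I K \<rho> p U" and fin: "finite I" "finite K"
  shows "entropy I \<rho> = - (\<Sum>k\<in>K. p k * log 2 (p k))"
proof -
  let ?n = "card I"
  have card: "card K = ?n" using eigdec_card[OF e fin] by simp
  define g where "g = from_nat_into I"
  define h where "h = from_nat_into K"
  have g: "bij_betw g {..<?n} I"
    unfolding g_def using bij_betw_from_nat_into_finite[OF fin(1)] .
  have h: "bij_betw h {..<?n} K"
    unfolding h_def using bij_betw_from_nat_into_finite[OF fin(2)] card by simp
  have gI: "g i \<in> I" "h i \<in> K" if "i < ?n" for i
    using g h that by (auto simp: bij_betw_def)
  have inj: "g i = g j \<longleftrightarrow> i = j" "h i = h j \<longleftrightarrow> i = j" if "i < ?n" "j < ?n" for i j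
    using g h that by (auto simp: bij_betw_def inj_on_def)
  define P where "P = mat ?n ?n (\<lambda>(a, b). U (g a) (h b))"
  define Q where "Q = mat ?n ?n (\<lambda>(a, b). cnj (U (g b) (h a)))"
  define D where "D = mat ?n ?n (\<lambda>(a, b). if a = b then complex_of_real (p (h a)) else 0)"
  have carr: "{op_mat I \<rho>, D, P, Q} \<subseteq> carrier_mat ?n ?n"
    by (auto simp: op_mat_def D_def P_def Q_def)
  have PQ: "P * Q = 1\<^sub>m ?n"
  proof (rule eq_matI)
    fix a b assume ab: "a < dim_row (1\<^sub>m ?n :: complex mat)" "b < dim_col (1\<^sub>m ?n :: complex mat)"
    then have "(P * Q) $$ (a, b) = (\<Sum>c<?n. U (g a) (h c) * cnj (U (g b) (h c)))"
      by (simp add: P_def Q_def scalar_prod_def lessThan_atLeast0)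
    also have "\<dots> = (U \<odot>\<^bsub>K\<^esub> adj U) (g a) (g b)"
      unfolding mm_def adj_def by (rule sum.reindex_bij_betw[OF h])
    finally show "(P * Q) $$ (a, b) = 1\<^sub>m ?n $$ (a, b)"
      using ab gI inj by (simp add: eigdecD(4)[OF e] diag_def)
  qed (auto simp: P_def Q_def)
  have QP: "Q * P = 1\<^sub>m ?n"
  proof (rule eq_matI)
    fix a b assume ab: "a < dim_row (1\<^sub>m ?n :: complex mat)" "b < dim_col (1\<^sub>m ?n :: complex mat)"
    then have "(Q * P) $$ (a, b) = (\<Sum>c<?n. cnj (U (g c) (h a)) * U (g c) (h b))"
      by (simp add: P_def Q_def scalar_prod_def lessThan_atLeast0)
    also have "\<dots> = (adj U \<odot>\<^bsub>I\<^esub> U) (h a) (h b)"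
      unfolding mm_def adj_def by (rule sum.reindex_bij_betw[OF g])
    finally show "(Q * P) $$ (a, b) = 1\<^sub>m ?n $$ (a, b)"
      using ab gI inj by (simp add: eigdecD(3)[OF e] diag_def)
  qed (auto simp: P_def Q_def)
  have "op_mat I \<rho> = P * D * Q"
  proof (rule eq_matI)
    fix a b assume "a < dim_row (P * D * Q)" "b < dim_col (P * D * Q)"
    then have ab: "a < ?n" "b < ?n" by (auto simp: P_def Q_def)
    have PD: "(P * D) $$ (a, c) = U (g a) (h c) * of_real (p (h c))" if "c < ?n" for c
    proof -
      have "(P * D) $$ (a, c) = (\<Sum>d<?n. U (g a) (h d) * (if d = c then of_real (p (h d)) else 0))"
        using ab that by (simp add: P_def D_def scalar_prod_def lessThan_atLeast0)
      also have "\<dots> = (\<Sum>d<?n. if d = c then U (g a) (h d) * of_real (p (h d)) else 0)"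
        by (intro sum.cong) auto
      finally show ?thesis using that by simp
    qed
    have "(P * D * Q) $$ (a, b) = (\<Sum>c<?n. (P * D) $$ (a, c) * Q $$ (c, b))"
      using ab by (simp add: P_def D_def Q_def scalar_prod_def lessThan_atLeast0)
    also have "\<dots> = (\<Sum>c<?n. U (g a) (h c) * of_real (p (h c)) * adj U (h c) (g b))"
      using ab by (intro sum.cong) (auto simp: PD Q_def adj_def)
    also have "\<dots> = (\<Sum>k\<in>K. U (g a) k * of_real (p k) * adj U k (g b))"
      by (rule sum.reindex_bij_betw[OF h])
    also have "\<dots> = \<rho> (g a) (g b)"
      by (subst eigdecD(5)[OF e]) (rule mm_diag_mm[OF fin(2), symmetric])
    finally show "op_mat I \<rho> $$ (a, b) = (P * D * Q) $$ (a, b)"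
      using ab by (simp add: op_mat_def g_def)
  qed (auto simp: P_def Q_def op_mat_def)
  then have "similar_mat (op_mat I \<rho>) D"
    by (rule similar_matI[OF carr PQ QP])
  then have "char_poly (op_mat I \<rho>) = char_poly D" by (rule char_poly_similar)
  also have "\<dots> = (\<Prod>a\<leftarrow>diag_mat D. [:- a, 1:])"
    using carr by (intro char_poly_upper_triangular[of D ?n]) (auto simp: D_def upper_triangular_def)
  finally have "char_poly (op_mat I \<rho>) = (\<Prod>a\<leftarrow>diag_mat D. [:- a, 1:])" .
  moreover have "proots (\<Prod>a\<leftarrow>xs. [:- a, 1:]) = mset xs" for xs :: "complex list"
  proof (induction xs)
    case (Cons a xs)
    have "(\<Prod>a\<leftarrow>xs. [:- a, 1:]) \<noteq> 0" by (auto simp: prod_list_zero_iff)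
    then have "proots ([:- a, 1:] * (\<Prod>a\<leftarrow>xs. [:- a, 1:])) = proots [:- a, 1:] + mset xs"
      using Cons by (subst proots_mult) auto
    then show ?case by simp
  qed simp
  moreover have "diag_mat D = map (\<lambda>c. complex_of_real (p (h c))) [0..<?n]"
    by (auto simp: diag_mat_def D_def)
  ultimately have roots: "proots (char_poly (op_mat I \<rho>)) = mset (map (\<lambda>c. complex_of_real (p (h c))) [0..<?n])"
    by (simp only:)
  have "entropy I \<rho> = - (\<Sum>x\<leftarrow>map (\<lambda>c. complex_of_real (p (h c))) [0..<?n]. Re x * log 2 (Re x))"
    unfolding entropy_def roots by (simp only: mset_map[symmetric] sum_mset_sum_list)
  also have "\<dots> = - (\<Sum>c<?n. p (h c) * log 2 (p (h c)))"
    by (simp add: o_def interv_sum_list_conv_sum_set_nat lessThan_atLeast0)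
  also have "(\<Sum>c<?n. p (h c) * log 2 (p (h c))) = (\<Sum>k\<in>K. p k * log 2 (p k))"
    by (rule sum.reindex_bij_betw[OF h])
  finally show ?thesis .
qed

section \<open>Monotonicity of the relative entropy\<close>

text \<open>With <X, Y> = Tr (adj X) Y this is 2 Re <X, rho> - <X, sigma X + s X rho>, a concave
  function of \<open>X\<close> for positive operators and nonnegative \<open>s\<close>; sigma acts
  from the left and rho from the right.\<close>

definition petz_form :: "'i set \<Rightarrow> 'i op \<Rightarrow> 'i op \<Rightarrow> real \<Rightarrow> 'i op \<Rightarrow> real" where
  "petz_form I \<rho> \<sigma> s X = 2 * Re (op_trace I (adj X \<odot>\<^bsub>I\<^esub> \<rho>))
     - Re (op_trace I ((X \<odot>\<^bsub>I\<^esub> adj X) \<odot>\<^bsub>I\<^esub> \<sigma>)) - s * Re (op_trace I ((adj X \<odot>\<^bsub>I\<^esub> X) \<odot>\<^bsub>I\<^esub> \<rho>))"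

text \<open>In the coordinates x = (adj W) X U the map sending X to sigma X + s X rho multiplies the
  entry at (l, k) by \<open>q l + s * p k\<close>, so the entries decouple.\<close>

lemma petz_form_eigdec:
  assumes r: "eigdec I K \<rho> p U" and t: "eigdec I L \<sigma> q W" and fin: "finite I" "finite K" "finite L"
    and x: "row_supp L x" "col_supp K x"
  shows "petz_form I \<rho> \<sigma> s (W \<odot>\<^bsub>L\<^esub> x \<odot>\<^bsub>K\<^esub> adj U) =
    (\<Sum>l\<in>L. \<Sum>k\<in>K. 2 * p k * Re (cnj (x l k) * (adj W \<odot>\<^bsub>I\<^esub> U) l k) - (q l + s * p k) * (cmod (x l k))\<^sup>2)"
proof -
  let ?P = "diag K (\<lambda>k. of_real (p k))" and ?Q = "diag L (\<lambda>l. of_real (q l))"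
  let ?X = "W \<odot>\<^bsub>L\<^esub> x \<odot>\<^bsub>K\<^esub> adj U"
  note R = eigdecD[OF r] and T = eigdecD[OF t]
  have sq: "cnj z * z * complex_of_real y = complex_of_real (y * (cmod z)\<^sup>2)" for y z
    by (simp add: complex_norm_square mult_ac del: of_real_power)
  have "adj ?X \<odot>\<^bsub>I\<^esub> \<rho> = U \<odot>\<^bsub>K\<^esub> (adj x \<odot>\<^bsub>L\<^esub> (adj W \<odot>\<^bsub>I\<^esub> U) \<odot>\<^bsub>K\<^esub> ?P \<odot>\<^bsub>K\<^esub> adj U)"
    by (subst R(5)) simp
  then have "op_trace I (adj ?X \<odot>\<^bsub>I\<^esub> \<rho>) = op_trace K ((adj x \<odot>\<^bsub>L\<^esub> (adj W \<odot>\<^bsub>I\<^esub> U) \<odot>\<^bsub>K\<^esub> ?P \<odot>\<^bsub>K\<^esub> adj U) \<odot>\<^bsub>I\<^esub> U)"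
    by (simp only: op_trace_mm_commute[of I U])
  also have "\<dots> = op_trace K ((adj x \<odot>\<^bsub>L\<^esub> (adj W \<odot>\<^bsub>I\<^esub> U)) \<odot>\<^bsub>K\<^esub> ?P)"
    using fin by (simp add: R(3))
  also have "\<dots> = (\<Sum>k\<in>K. \<Sum>l\<in>L. cnj (x l k) * (adj W \<odot>\<^bsub>I\<^esub> U) l k * of_real (p k))"
    using fin unfolding op_trace_def
    by (simp add: mm_diag_apply del: mm_assoc) (simp add: mm_def[of "adj x"] sum_distrib_right, simp add: adj_def[of x])
  finally have 1: "Re (op_trace I (adj ?X \<odot>\<^bsub>I\<^esub> \<rho>)) = (\<Sum>l\<in>L. \<Sum>k\<in>K. p k * Re (cnj (x l k) * (adj W \<odot>\<^bsub>I\<^esub> U) l k))"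
    by (subst sum.swap) (simp add: mult.commute del: complex_cnj_cnj)
  have "(?X \<odot>\<^bsub>I\<^esub> adj ?X) \<odot>\<^bsub>I\<^esub> \<sigma> = W \<odot>\<^bsub>L\<^esub> (x \<odot>\<^bsub>K\<^esub> adj x \<odot>\<^bsub>L\<^esub> ?Q \<odot>\<^bsub>L\<^esub> adj W)"
    by (subst T(5)) (simp add: R(3,6) T(3,6) x fin)
  then have "op_trace I ((?X \<odot>\<^bsub>I\<^esub> adj ?X) \<odot>\<^bsub>I\<^esub> \<sigma>) = op_trace L ((x \<odot>\<^bsub>K\<^esub> adj x \<odot>\<^bsub>L\<^esub> ?Q \<odot>\<^bsub>L\<^esub> adj W) \<odot>\<^bsub>I\<^esub> W)"
    by (simp only: op_trace_mm_commute[of I W])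
  also have "\<dots> = op_trace L ((x \<odot>\<^bsub>K\<^esub> adj x) \<odot>\<^bsub>L\<^esub> ?Q)"
    using fin by (simp add: T(3))
  also have "\<dots> = (\<Sum>l\<in>L. \<Sum>k\<in>K. x l k * cnj (x l k) * of_real (q l))"
    using fin unfolding op_trace_def
    by (simp add: mm_diag_apply del: mm_assoc) (simp add: mm_def[of x] adj_def[of x] sum_distrib_right)
  finally have 2: "Re (op_trace I ((?X \<odot>\<^bsub>I\<^esub> adj ?X) \<odot>\<^bsub>I\<^esub> \<sigma>)) = (\<Sum>l\<in>L. \<Sum>k\<in>K. q l * (cmod (x l k))\<^sup>2)"
    by (simp only: mult.commute[of "x _ _"] sq of_real_sum[symmetric] Re_complex_of_real)
  have "(adj ?X \<odot>\<^bsub>I\<^esub> ?X) \<odot>\<^bsub>I\<^esub> \<rho> = U \<odot>\<^bsub>K\<^esub> (adj x \<odot>\<^bsub>L\<^esub> x \<odot>\<^bsub>K\<^esub> ?P \<odot>\<^bsub>K\<^esub> adj U)"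
    by (subst R(5)) (simp add: R(3,6) T(3,6) x fin)
  then have "op_trace I ((adj ?X \<odot>\<^bsub>I\<^esub> ?X) \<odot>\<^bsub>I\<^esub> \<rho>) = op_trace K ((adj x \<odot>\<^bsub>L\<^esub> x \<odot>\<^bsub>K\<^esub> ?P \<odot>\<^bsub>K\<^esub> adj U) \<odot>\<^bsub>I\<^esub> U)"
    by (simp only: op_trace_mm_commute[of I U])
  also have "\<dots> = op_trace K ((adj x \<odot>\<^bsub>L\<^esub> x) \<odot>\<^bsub>K\<^esub> ?P)"
    using fin by (simp add: R(3))
  also have "\<dots> = (\<Sum>k\<in>K. \<Sum>l\<in>L. cnj (x l k) * x l k * of_real (p k))"
    using fin unfolding op_trace_def
    by (simp add: mm_diag_apply del: mm_assoc) (simp add: mm_def[of "adj x"] sum_distrib_right, simp add: adj_def[of x])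
  finally have 3: "Re (op_trace I ((adj ?X \<odot>\<^bsub>I\<^esub> ?X) \<odot>\<^bsub>I\<^esub> \<rho>)) = (\<Sum>l\<in>L. \<Sum>k\<in>K. p k * (cmod (x l k))\<^sup>2)"
    by (subst sum.swap) (simp only: sq of_real_sum[symmetric] Re_complex_of_real)
  show ?thesis
    unfolding petz_form_def 1 2 3
    by (simp add: sum_distrib_left sum_subtractf sum.distrib algebra_simps)
qed

text \<open>Each entry contributes a concave scalar quadratic, bounded separately by completing the
  square; positivity of \<open>q\<close> keeps the divisor \<open>q l + s * p k\<close> positive
  even where \<open>p k\<close> vanishes.\<close>

lemma petz_form_le:
  assumes r: "eigdec I K \<rho> p U" and t: "eigdec I L \<sigma> q W" and fin: "finite I" "finite K" "finite L"
    and pos: "\<And>k. k \<in> K \<Longrightarrow> 0 \<le> p k" "\<And>l. l \<in> L \<Longrightarrow> 0 < q l" "0 \<le> s"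
    and X: "X \<in> ops I"
  shows "petz_form I \<rho> \<sigma> s X \<le> (\<Sum>l\<in>L. \<Sum>k\<in>K. (cmod ((adj W \<odot>\<^bsub>I\<^esub> U) l k))\<^sup>2 * (p k)\<^sup>2 / (q l + s * p k))"
proof -
  note R = eigdecD[OF r] and T = eigdecD[OF t]
  define x where "x = adj W \<odot>\<^bsub>I\<^esub> X \<odot>\<^bsub>I\<^esub> U"
  have x: "row_supp L x" "col_supp K x" using R(2) T(2) by (auto simp: x_def)
  have "W \<odot>\<^bsub>L\<^esub> x \<odot>\<^bsub>K\<^esub> adj U = X"
    using X fin by (simp add: x_def T(7) R(4) ops_iff_supp)
  then have "petz_form I \<rho> \<sigma> s X = (\<Sum>l\<in>L. \<Sum>k\<in>K. 2 * p k * Re (cnj (x l k) * (adj W \<odot>\<^bsub>I\<^esub> U) l k)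
      - (q l + s * p k) * (cmod (x l k))\<^sup>2)"
    using petz_form_eigdec[OF r t fin x, of s] by simp
  also have "\<dots> \<le> (\<Sum>l\<in>L. \<Sum>k\<in>K. (cmod ((adj W \<odot>\<^bsub>I\<^esub> U) l k))\<^sup>2 * (p k)\<^sup>2 / (q l + s * p k))"
  proof (intro sum_mono)
    fix l k assume lk: "l \<in> L" "k \<in> K"
    define a c d where "a = x l k" and "c = (adj W \<odot>\<^bsub>I\<^esub> U) l k" and "d = q l + s * p k"
    have d: "d > 0" using pos lk by (simp add: d_def add_pos_nonneg)
    \<comment> \<open>The square is centred at the maximizer \<open>p k * c / d\<close> and scaled
      by the square of \<open>d\<close>.\<close>
    have "0 \<le> (cmod (of_real d * a - of_real (p k) * c))\<^sup>2" by simp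
    also have "\<dots> = d * (d * (cmod a)\<^sup>2 - 2 * p k * Re (cnj a * c)) + (cmod c)\<^sup>2 * (p k)\<^sup>2"
      unfolding cmod_power2 by (simp add: power2_eq_square algebra_simps)
    finally show "2 * p k * Re (cnj a * c) - d * (cmod a)\<^sup>2 \<le> (cmod c)\<^sup>2 * (p k)\<^sup>2 / d"
      using d by (simp add: field_simps)
  qed
  finally show ?thesis .
qed

lemma petz_form_attained:
  assumes r: "eigdec I K \<rho> p U" and t: "eigdec I L \<sigma> q W" and fin: "finite I" "finite K" "finite L"
    and pos: "\<And>k. k \<in> K \<Longrightarrow> 0 \<le> p k" "\<And>l. l \<in> L \<Longrightarrow> 0 < q l" "0 \<le> s"
  obtains X where "X \<in> ops I"
    "petz_form I \<rho> \<sigma> s X = (\<Sum>l\<in>L. \<Sum>k\<in>K. (cmod ((adj W \<odot>\<^bsub>I\<^esub> U) l k))\<^sup>2 * (p k)\<^sup>2 / (q l + s * p k))"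
proof -
  note R = eigdecD[OF r] and T = eigdecD[OF t]
  let ?c = "adj W \<odot>\<^bsub>I\<^esub> U"
  \<comment> \<open>The maximizer of each completed square, in eigenbasis coordinates.\<close>
  define x where "x l k = ?c l k * of_real (p k / (q l + s * p k))" for l k
  have "row_supp L ?c" "col_supp K ?c" using R(2) T(2) by auto
  then have x: "row_supp L x" "col_supp K x" by (auto simp: x_def row_supp_def col_supp_def)
  have "petz_form I \<rho> \<sigma> s (W \<odot>\<^bsub>L\<^esub> x \<odot>\<^bsub>K\<^esub> adj U) =
    (\<Sum>l\<in>L. \<Sum>k\<in>K. (cmod (?c l k))\<^sup>2 * (p k)\<^sup>2 / (q l + s * p k))"
    unfolding petz_form_eigdec[OF r t fin x]
  proof (intro sum.cong refl)
    fix l k assume lk: "l \<in> L" "k \<in> K"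
    define c d where "c = ?c l k" and "d = q l + s * p k"
    have d: "d > 0" using pos lk by (simp add: d_def add_pos_nonneg)
    have "Re (cnj (c * of_real (p k / d)) * c) = (cmod c)\<^sup>2 * (p k / d)"
      unfolding cmod_power2 by (simp add: power2_eq_square algebra_simps add_divide_distrib)
    moreover have "(cmod (c * of_real (p k / d)))\<^sup>2 = (cmod c)\<^sup>2 * (p k / d)\<^sup>2"
      by (simp only: norm_mult norm_of_real power_mult_distrib power2_abs)
    ultimately have "2 * p k * Re (cnj (c * of_real (p k / d)) * c) - d * (cmod (c * of_real (p k / d)))\<^sup>2
      = (cmod c)\<^sup>2 * (p k)\<^sup>2 / d"
      using d by (simp add: field_simps power2_eq_square)
    then show "2 * p k * Re (cnj (x l k) * ?c l k) - (q l + s * p k) * (cmod (x l k))\<^sup>2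
      = (cmod (?c l k))\<^sup>2 * (p k)\<^sup>2 / (q l + s * p k)"
      by (simp add: x_def c_def d_def)
  qed
  moreover have "W \<odot>\<^bsub>L\<^esub> x \<odot>\<^bsub>K\<^esub> adj U \<in> ops I"
    using R(1) T(1) by (simp add: ops_iff_supp)
  ultimately show ?thesis using that by blast
qed

section \<open>Block-diagonal operators and the partial trace\<close>

definition block :: "'s set \<Rightarrow> ('s \<Rightarrow> 'i \<Rightarrow> 'j \<Rightarrow> complex) \<Rightarrow> 'i \<times> 's \<Rightarrow> 'j \<times> 's \<Rightarrow> complex" where
  "block S Z = (\<lambda>(i, s) (j, t). if s = t \<and> s \<in> S then Z s i j else 0)"

text \<open>Constant blocks give \<open>Z \<otimes> 1\<close>, varying blocks give flagged
  ensembles; one calculus serves both.\<close>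

abbreviation tensor_one :: "'y set \<Rightarrow> ('i \<Rightarrow> 'j \<Rightarrow> complex) \<Rightarrow> 'i \<times> 'y \<Rightarrow> 'j \<times> 'y \<Rightarrow> complex" where
  "tensor_one Y Z \<equiv> block Y (\<lambda>_. Z)"

lemma block_apply: "block S Z (i, s) (j, t) = (if s = t \<and> s \<in> S then Z s i j else 0)"
  by (simp add: block_def)

lemma row_supp_block: "(\<And>s. s \<in> S \<Longrightarrow> row_supp I (Z s)) \<Longrightarrow> row_supp (I \<times> S) (block S Z)"
  by (auto simp: row_supp_def block_def)

lemma col_supp_block: "(\<And>s. s \<in> S \<Longrightarrow> col_supp I (Z s)) \<Longrightarrow> col_supp (I \<times> S) (block S Z)"
  by (auto simp: col_supp_def block_def)

lemma block_ops: "(\<And>s. s \<in> S \<Longrightarrow> Z s \<in> ops I) \<Longrightarrow> block S Z \<in> ops (I \<times> S)"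
  by (simp add: ops_iff_supp row_supp_block col_supp_block)

lemma adj_block: "adj (block S Z) = block S (\<lambda>s. adj (Z s))"
  by (auto simp: adj_def block_def fun_eq_iff)

lemma diag_eq_block: "diag (K \<times> S) d = block S (\<lambda>s. diag K (\<lambda>k. d (k, s)))"
  by (auto simp: diag_def block_def fun_eq_iff)

lemma block_mm_apply:
  assumes "finite S"
  shows "(block S Z \<odot>\<^bsub>X \<times> S\<^esub> A) (x, s) j = (if s \<in> S then \<Sum>z\<in>X. Z s x z * A (z, s) j else 0)"
proof -
  have "(block S Z \<odot>\<^bsub>X \<times> S\<^esub> A) (x, s) j = (\<Sum>z\<in>X. \<Sum>w\<in>S. if w = s then Z s x z * A (z, s) j else 0)"
    unfolding mm_def sum.cartesian_product by (intro sum.cong) (auto simp: block_def)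
  then show ?thesis using assms by simp
qed

lemma block_mm_block:
  fixes A :: "'s \<Rightarrow> 'i \<Rightarrow> 'j \<Rightarrow> complex" and B :: "'s \<Rightarrow> 'j \<Rightarrow> 'k \<Rightarrow> complex"
  assumes "finite S"
  shows "block S A \<odot>\<^bsub>X \<times> S\<^esub> block S B = block S (\<lambda>s. A s \<odot>\<^bsub>X\<^esub> B s)"
proof (intro ext)
  fix i :: "'i \<times> 's" and j :: "'k \<times> 's"
  obtain x s y t where "i = (x, s)" "j = (y, t)" by fastforce
  then show "(block S A \<odot>\<^bsub>X \<times> S\<^esub> block S B) i j = block S (\<lambda>s. A s \<odot>\<^bsub>X\<^esub> B s) i j"
    by (cases "s = t") (auto simp: block_mm_apply[OF assms] block_apply, simp add: mm_def)
qed

text \<open>The duality between tensoring with the identity and the partial trace.\<close>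

lemma op_trace_tensor_one:
  assumes "finite Y"
  shows "op_trace (X \<times> Y) (tensor_one Y A \<odot>\<^bsub>X \<times> Y\<^esub> \<rho>) = op_trace X (A \<odot>\<^bsub>X\<^esub> tr_snd Y \<rho>)"
proof -
  have "op_trace (X \<times> Y) (tensor_one Y A \<odot>\<^bsub>X \<times> Y\<^esub> \<rho>)
    = (\<Sum>x\<in>X. \<Sum>y\<in>Y. (tensor_one Y A \<odot>\<^bsub>X \<times> Y\<^esub> \<rho>) (x, y) (x, y))"
    unfolding op_trace_def sum.cartesian_product by (simp add: case_prod_beta)
  also have "\<dots> = (\<Sum>x\<in>X. \<Sum>y\<in>Y. \<Sum>z\<in>X. A x z * \<rho> (z, y) (x, y))"
    by (simp add: block_mm_apply[OF assms])
  also have "\<dots> = (\<Sum>x\<in>X. \<Sum>z\<in>X. \<Sum>y\<in>Y. A x z * \<rho> (z, y) (x, y))"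
    by (intro sum.cong refl sum.swap)
  finally show ?thesis
    by (simp add: op_trace_def mm_def tr_snd_def sum_distrib_left)
qed

text \<open>Products and adjoints of operators \<open>Z \<otimes> 1\<close> keep this form, and each
  of the three traces contains one of the two operators linearly, so the duality with the partial
  trace applies to all of them.\<close>

lemma petz_form_tensor_one:
  assumes "finite Y"
  shows "petz_form (X \<times> Y) \<rho> \<sigma> s (tensor_one Y Z) = petz_form X (tr_snd Y \<rho>) (tr_snd Y \<sigma>) s Z"
  unfolding petz_form_def adj_block block_mm_block[OF assms] op_trace_tensor_one[OF assms] ..

text \<open>The two sums differ at \<open>s = 0\<close> and at \<open>s \<rightarrow> \<infinity>\<close> by the two sides of the claim, and the
  hypothesis says that their difference is monotone in \<open>s\<close>.\<close>

lemma sum_ln_interpolation: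
  fixes a p q :: "'m \<Rightarrow> real"
  assumes fin: "finite M" and pos: "\<And>m. m \<in> M \<Longrightarrow> 0 \<le> p m" "\<And>m. m \<in> M \<Longrightarrow> 0 < q m"
    and zero: "(\<Sum>m\<in>M. a m * p m) = 0"
    and deriv: "\<And>s. 0 \<le> s \<Longrightarrow> 0 \<le> (\<Sum>m\<in>M. a m * (p m)\<^sup>2 / (q m + s * p m))"
  shows "(\<Sum>m\<in>M. a m * p m * ln (q m)) \<le> (\<Sum>m\<in>M. a m * p m * ln (p m))"
proof -
  define D where "D s = (\<Sum>m\<in>M. a m * p m * ln (q m + s * p m))" for s
  have D: "D 0 \<le> D s" if "0 < s" for s
  proof (rule DERIV_nonneg_imp_nondecreasing[of 0 s D])
    fix t :: real assume t: "0 \<le> t" "t \<le> s"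
    have "(D has_real_derivative (\<Sum>m\<in>M. a m * (p m)\<^sup>2 / (q m + t * p m))) (at t)"
      unfolding D_def
    proof (rule DERIV_sum)
      fix m assume "m \<in> M"
      then have "q m + t * p m > 0" using pos t by (simp add: add_pos_nonneg)
      then show "((\<lambda>s. a m * p m * ln (q m + s * p m)) has_real_derivative a m * (p m)\<^sup>2 / (q m + t * p m)) (at t)"
        by (auto intro!: derivative_eq_intros simp: power2_eq_square)
    qed
    then show "\<exists>y. (D has_real_derivative y) (at t) \<and> 0 \<le> y" using deriv t by blast
  qed (use that in simp)
  \<comment> \<open>Each logarithm with nonzero weight grows like \<open>ln s\<close>; subtracting
    \<open>ln s\<close> throughout costs \<open>ln s\<close> times the sum of
    \<open>a m * p m\<close>, which vanishes by \<open>zero\<close>.\<close>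
  have "((\<lambda>s. \<Sum>m\<in>M. a m * p m * (ln (q m + s * p m) - ln s)) \<longlongrightarrow> (\<Sum>m\<in>M. a m * p m * ln (p m))) at_top"
  proof (rule tendsto_sum)
    fix m assume m: "m \<in> M"
    show "((\<lambda>s. a m * p m * (ln (q m + s * p m) - ln s)) \<longlongrightarrow> a m * p m * ln (p m)) at_top"
    proof (cases "p m = 0")
      case False
      then have p: "p m > 0" using pos m by force
      have "((\<lambda>s. ln (q m * inverse s + p m)) \<longlongrightarrow> ln (q m * 0 + p m)) at_top"
        using p by (intro tendsto_intros tendsto_inverse_0_at_top filterlim_ident) auto
      moreover have "\<forall>\<^sub>F s in at_top. ln (q m * inverse s + p m) = ln (q m + s * p m) - ln s"
        using eventually_gt_at_top[of 0]
      proof eventually_elim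
        case (elim s)
        have "q m * inverse s + p m = (q m + s * p m) / s" using elim by (simp add: field_simps)
        moreover have "q m + s * p m > 0" using pos m elim p by (simp add: add_pos_pos)
        ultimately show ?case using elim by (simp add: ln_div)
      qed
      ultimately have "((\<lambda>s. ln (q m + s * p m) - ln s) \<longlongrightarrow> ln (p m)) at_top"
        by (simp add: tendsto_cong)
      then show ?thesis by (intro tendsto_intros)
    qed simp
  qed
  moreover have "(\<Sum>m\<in>M. a m * p m * (ln (q m + s * p m) - ln s)) = D s" for s
  proof -
    have "(\<Sum>m\<in>M. a m * p m * (ln (q m + s * p m) - ln s)) = D s - (\<Sum>m\<in>M. a m * p m) * ln s"
      by (simp add: D_def right_diff_distrib sum_subtractf sum_distrib_right)
    then show ?thesis by (simp add: zero)
  qed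
  ultimately have "(D \<longlongrightarrow> (\<Sum>m\<in>M. a m * p m * ln (p m))) at_top" by simp
  then have "D 0 \<le> (\<Sum>m\<in>M. a m * p m * ln (p m))"
    by (rule tendsto_lowerbound) (auto intro!: eventually_mono[OF eventually_gt_at_top[of 0]] D)
  then show ?thesis by (simp add: D_def)
qed

text \<open>The matrix \<open>adj W \<odot> U\<close> is unitary, so its columns have norm
  1.\<close>

lemma overlap_sum_left:
  assumes r: "eigdec I K \<rho> p U" and t: "eigdec I L \<sigma> q W" and fin: "finite I" "finite K" "finite L"
    and k: "k \<in> K"
  shows "(\<Sum>l\<in>L. (cmod ((adj W \<odot>\<^bsub>I\<^esub> U) l k))\<^sup>2) = 1"
proof -
  note R = eigdecD[OF r] and T = eigdecD[OF t]
  let ?c = "adj W \<odot>\<^bsub>I\<^esub> U"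
  have "adj ?c \<odot>\<^bsub>L\<^esub> ?c = one K" using fin by (simp add: T(7) R(1,3))
  then have "(adj ?c \<odot>\<^bsub>L\<^esub> ?c) k k = 1" using k by (simp only: diag_def) simp
  moreover have "(adj ?c \<odot>\<^bsub>L\<^esub> ?c) k k = (\<Sum>l\<in>L. ?c l k * cnj (?c l k))"
    by (subst mm_def) (simp only: adj_def[of ?c] mult.commute)
  ultimately have "complex_of_real (\<Sum>l\<in>L. (cmod (?c l k))\<^sup>2) = 1"
    by (simp only: of_real_sum complex_norm_square)
  then show ?thesis by (simp only: of_real_eq_1_iff)
qed

text \<open>Weighted by the eigenvalues, the overlaps sum to the diagonal entry of \<rho> at the
  column \<open>l\<close> of \<open>W\<close>; this is how Tr rho ln sigma arises without an
  operator logarithm.\<close>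

lemma overlap_sum_right:
  assumes r: "eigdec I K \<rho> p U" and fin: "finite K"
  shows "(\<Sum>k\<in>K. p k * (cmod ((adj W \<odot>\<^bsub>I\<^esub> U) l k))\<^sup>2) = Re (quad I \<rho> (\<lambda>i. W i l))"
proof -
  have "cmod (\<Sum>i\<in>I. cnj (U i k) * W i l) = cmod ((adj W \<odot>\<^bsub>I\<^esub> U) l k)" for k
  proof -
    have "(\<Sum>i\<in>I. cnj (U i k) * W i l) = cnj ((adj W \<odot>\<^bsub>I\<^esub> U) l k)"
      by (simp add: mm_def adj_def mult.commute)
    then show ?thesis by (simp only: complex_mod_cnj)
  qed
  then show ?thesis unfolding quad_eigdec[OF r fin] by (simp del: of_real_mult of_real_power)
qed

text \<open>The second sum on either side is \<open>Tr \<rho> ln \<sigma>\<close>, evaluated in the eigenbasis of \<open>\<sigma>\<close>.\<close>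

theorem relative_entropy_mono:
  fixes K :: "'k set" and L :: "'l set" and K' :: "'k1 set" and L' :: "'l1 set"
  assumes r: "eigdec (X \<times> Y) K \<rho> p U" and t: "eigdec (X \<times> Y) L \<sigma> q W"
    and r': "eigdec X K' (tr_snd Y \<rho>) p' U'" and t': "eigdec X L' (tr_snd Y \<sigma>) q' W'"
    and fin: "finite X" "finite Y" "finite K" "finite L" "finite K'" "finite L'"
    and pos: "\<And>k. k \<in> K \<Longrightarrow> 0 \<le> p k" "\<And>l. l \<in> L \<Longrightarrow> 0 < q l"
      "\<And>k. k \<in> K' \<Longrightarrow> 0 \<le> p' k" "\<And>l. l \<in> L' \<Longrightarrow> 0 < q' l"
  shows "(\<Sum>k\<in>K'. p' k * ln (p' k)) - (\<Sum>l\<in>L'. Re (quad X (tr_snd Y \<rho>) (\<lambda>i. W' i l)) * ln (q' l))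
    \<le> (\<Sum>k\<in>K. p k * ln (p k)) - (\<Sum>l\<in>L. Re (quad (X \<times> Y) \<rho> (\<lambda>i. W i l)) * ln (q l))"
proof -
  have finI: "finite (X \<times> Y)" using fin by simp
  define c where "c l k = (cmod ((adj W \<odot>\<^bsub>X \<times> Y\<^esub> U) l k))\<^sup>2" for l k
  define c' where "c' l k = (cmod ((adj W' \<odot>\<^bsub>X\<^esub> U') l k))\<^sup>2" for l k
  \<comment> \<open>One index set for both pairs of operators, the reduced pair being counted
    negatively: the interpolation then compares the pairs directly, and its hypothesis
    \<open>zero\<close> becomes equality of traces.\<close>
  let ?M = "(L \<times> K) <+> (L' \<times> K')"
  define a :: "_ \<Rightarrow> real" where "a = case_sum (\<lambda>(l, k). c l k) (\<lambda>(l, k). - c' l k)"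
  define P where "P = case_sum (\<lambda>(l :: 'l, k). p k) (\<lambda>(l :: 'l1, k). p' k)"
  define Q where "Q = case_sum (\<lambda>(l, k :: 'k). q l) (\<lambda>(l, k :: 'k1). q' l)"
  have split: "(\<Sum>m\<in>?M. f m) = (\<Sum>l\<in>L. \<Sum>k\<in>K. f (Inl (l, k))) + (\<Sum>l\<in>L'. \<Sum>k\<in>K'. f (Inr (l, k)))"
    for f :: "_ \<Rightarrow> real"
    using fin by (simp add: sum.Plus sum.cartesian_product case_prod_beta)
  have ck: "(\<Sum>l\<in>L. \<Sum>k\<in>K. c l k * g k) = (\<Sum>k\<in>K. g k)" for g
    by (subst sum.swap) (simp add: sum_distrib_right[symmetric] c_def overlap_sum_left[OF r t finI fin(3,4)])
  have ck': "(\<Sum>l\<in>L'. \<Sum>k\<in>K'. c' l k * g k) = (\<Sum>k\<in>K'. g k)" for g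
    by (subst sum.swap) (simp add: sum_distrib_right[symmetric] c'_def overlap_sum_left[OF r' t' fin(1,5,6)])
  have cl: "(\<Sum>l\<in>L. \<Sum>k\<in>K. c l k * p k * h l) = (\<Sum>l\<in>L. Re (quad (X \<times> Y) \<rho> (\<lambda>i. W i l)) * h l)" for h
    unfolding overlap_sum_right[OF r fin(3), symmetric] c_def by (simp add: sum_distrib_left sum_distrib_right mult_ac)
  have cl': "(\<Sum>l\<in>L'. \<Sum>k\<in>K'. c' l k * p' k * h l) = (\<Sum>l\<in>L'. Re (quad X (tr_snd Y \<rho>) (\<lambda>i. W' i l)) * h l)" for h
    unfolding overlap_sum_right[OF r' fin(5), symmetric] c'_def by (simp add: sum_distrib_left sum_distrib_right mult_ac)
  have "op_trace X (tr_snd Y \<rho>) = op_trace (X \<times> Y) \<rho>"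
    by (simp add: op_trace_def tr_snd_def sum.cartesian_product case_prod_beta)
  then have tr: "(\<Sum>k\<in>K'. p' k) = (\<Sum>k\<in>K. p k)"
    unfolding eigdec_trace[OF r finI fin(3)] eigdec_trace[OF r' fin(1,5)] of_real_eq_iff .
  have "(\<Sum>m\<in>?M. a m * P m * ln (Q m)) \<le> (\<Sum>m\<in>?M. a m * P m * ln (P m))"
  proof (rule sum_ln_interpolation)
    show "finite ?M" using fin by simp
    show "0 \<le> P m" "0 < Q m" if "m \<in> ?M" for m
      using that pos by (auto simp: P_def Q_def)
    show "(\<Sum>m\<in>?M. a m * P m) = 0"
      unfolding split by (simp add: a_def P_def sum_negf ck ck' tr)
    fix s :: real assume s: "0 \<le> s"
    obtain Z where Z: "Z \<in> ops X" "petz_form X (tr_snd Y \<rho>) (tr_snd Y \<sigma>) s Z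
        = (\<Sum>l\<in>L'. \<Sum>k\<in>K'. c' l k * (p' k)\<^sup>2 / (q' l + s * p' k))"
      using petz_form_attained[OF r' t' fin(1,5,6) pos(3,4) s] unfolding c'_def by blast
    \<comment> \<open>\<open>Z\<close> maximizes the reduced form, and \<open>Z \<otimes> 1\<close>
      is one competitor for the full form.\<close>
    have "petz_form X (tr_snd Y \<rho>) (tr_snd Y \<sigma>) s Z \<le> (\<Sum>l\<in>L. \<Sum>k\<in>K. c l k * (p k)\<^sup>2 / (q l + s * p k))"
      unfolding petz_form_tensor_one[OF fin(2), symmetric] c_def
      by (rule petz_form_le[OF r t finI fin(3,4) pos(1,2) s]) (assumption | rule block_ops Z(1))+
    then show "0 \<le> (\<Sum>m\<in>?M. a m * (P m)\<^sup>2 / (Q m + s * P m))"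
      unfolding split Z(2) by (simp add: a_def P_def Q_def sum_negf)
  qed
  then show ?thesis
    unfolding split using ck[of "\<lambda>k. p k * ln (p k)"] ck'[of "\<lambda>k. p' k * ln (p' k)"] cl[of "\<lambda>l. ln (q l)"] cl'[of "\<lambda>l. ln (q' l)"]
    by (simp add: a_def P_def Q_def sum_negf mult.assoc)
qed

section \<open>Strong subadditivity\<close>

lemma block_cong: "(\<And>s. s \<in> S \<Longrightarrow> f s = g s) \<Longrightarrow> block S f = block S g"
  by (auto simp: block_def fun_eq_iff)

lemma eigdec_block:
  assumes e: "\<And>s. s \<in> S \<Longrightarrow> eigdec I K (\<rho> s) (p s) (U s)" and fin: "finite K" "finite I" "finite S"
  shows "eigdec (I \<times> S) (K \<times> S) (block S \<rho>) (\<lambda>(k, s). p s k) (block S U)"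
proof -
  note D = eigdecD[OF e]
  show ?thesis
    unfolding eigdec_def adj_block diag_eq_block block_mm_block[OF fin(3)]
    by (auto intro!: row_supp_block col_supp_block block_cong simp: D(1,2,3,4) D(5)[symmetric])
qed

text \<open>Since \<open>U \<odot> adj U\<close> is the identity, a multiple of it is diagonal in
  every basis; this is what lets the perturbation keep the eigenvectors.\<close>

lemma eigdec_shift:
  assumes e: "eigdec I K \<rho> p U" and fin: "finite I" "finite K"
  shows "eigdec I K (\<lambda>i j. \<rho> i j + of_real c * one I i j) (\<lambda>k. p k + c) U"
proof -
  note D = eigdecD[OF e]
  have "\<rho> i j + of_real c * one I i j = (U \<odot>\<^bsub>K\<^esub> diag K (\<lambda>k. of_real (p k + c)) \<odot>\<^bsub>K\<^esub> adj U) i j" for i j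
    unfolding mm_diag_mm[OF fin(2)] D(4)[symmetric]
    by (subst D(5), unfold mm_diag_mm[OF fin(2)])
      (simp add: mm_def[of U] distrib_left distrib_right sum.distrib sum_distrib_left mult_ac)
  then show ?thesis using D(1-4) unfolding eigdec_def by (simp add: fun_eq_iff)
qed

section \<open>Relabelling of basis vectors\<close>

lemma mm_reindex:
  assumes "bij_betw h J I"
  shows "(A \<odot>\<^bsub>I\<^esub> B) i k = (\<Sum>j\<in>J. A i (h j) * B (h j) k)"
  unfolding mm_def by (rule sum.reindex_bij_betw[OF assms, symmetric])

text \<open>Only the rows of \<open>U\<close> are renamed, so the eigenvalues keep their old labels.
  The condition on \<open>h\<close> outside \<open>J\<close> preserves the support
  convention.\<close>

lemma eigdec_reindex:
  assumes e: "eigdec I K \<rho> p U" and h: "bij_betw h J I" "\<And>i. i \<notin> J \<Longrightarrow> h i \<notin> I" and fin: "finite K"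
  shows "eigdec J K (\<lambda>i j. \<rho> (h i) (h j)) p (\<lambda>i. U (h i))"
  unfolding eigdec_def
proof (intro conjI)
  note D = eigdecD[OF e]
  have hJ: "h i \<in> I \<longleftrightarrow> i \<in> J" for i using h by (auto simp: bij_betw_def)
  show "row_supp J (\<lambda>i. U (h i))" "col_supp K (\<lambda>i. U (h i))"
    using D(1,2) h(2) by (auto simp: row_supp_def col_supp_def)
  have "adj (\<lambda>i. U (h i)) \<odot>\<^bsub>J\<^esub> (\<lambda>i. U (h i)) = adj U \<odot>\<^bsub>I\<^esub> U"
    by (intro ext) (simp only: mm_reindex[OF h(1)], simp add: mm_def adj_def)
  then show "adj (\<lambda>i. U (h i)) \<odot>\<^bsub>J\<^esub> (\<lambda>i. U (h i)) = one K" by (simp add: D(3))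
  have "((\<lambda>i. U (h i)) \<odot>\<^bsub>K\<^esub> adj (\<lambda>i. U (h i))) i j = one J i j" for i j
  proof -
    have "((\<lambda>i. U (h i)) \<odot>\<^bsub>K\<^esub> adj (\<lambda>i. U (h i))) i j = (U \<odot>\<^bsub>K\<^esub> adj U) (h i) (h j)"
      by (simp add: mm_def adj_def)
    also have "\<dots> = one J i j"
      using hJ[of i] hJ[of j] bij_betw_imp_inj_on[OF h(1)] unfolding D(4) diag_def by (metis inj_onD)
    finally show ?thesis .
  qed
  then show "(\<lambda>i. U (h i)) \<odot>\<^bsub>K\<^esub> adj (\<lambda>i. U (h i)) = one J" by blast
  have "\<rho> (h i) (h j) = ((\<lambda>i. U (h i)) \<odot>\<^bsub>K\<^esub> diag K (\<lambda>k. of_real (p k)) \<odot>\<^bsub>K\<^esub> adj (\<lambda>i. U (h i))) i j" for i j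
    unfolding mm_diag_mm[OF fin] by (subst D(5), unfold mm_diag_mm[OF fin]) (simp add: adj_def)
  then show "(\<lambda>i j. \<rho> (h i) (h j)) = (\<lambda>i. U (h i)) \<odot>\<^bsub>K\<^esub> diag K (\<lambda>k. of_real (p k)) \<odot>\<^bsub>K\<^esub> adj (\<lambda>i. U (h i))"
    by blast
qed

lemma quad_reindex:
  assumes "bij_betw h J I"
  shows "quad I \<rho> v = quad J (\<lambda>i j. \<rho> (h i) (h j)) (\<lambda>i. v (h i))"
  unfolding quad_def by (simp add: sum.reindex_bij_betw[OF assms, symmetric])

lemma psd_reindex:
  assumes h: "bij_betw h J I"
  shows "psd J (\<lambda>i j. \<rho> (h i) (h j)) \<longleftrightarrow> psd I \<rho>"
proof
  assume "psd J (\<lambda>i j. \<rho> (h i) (h j))"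
  then show "psd I \<rho>" by (simp add: psd_iff_quad quad_reindex[OF h])
next
  assume *: "psd I \<rho>"
  show "psd J (\<lambda>i j. \<rho> (h i) (h j))"
    unfolding psd_iff_quad
  proof
    fix v
    \<comment> \<open>On \<open>J\<close> any vector agrees with one pulled back from
      \<open>I\<close> along the inverse of \<open>h\<close>.\<close>
    have "quad J (\<lambda>i j. \<rho> (h i) (h j)) v = quad J (\<lambda>i j. \<rho> (h i) (h j)) (\<lambda>i. v (the_inv_into J h (h i)))"
      using h unfolding quad_def by (intro sum.cong) (auto simp: bij_betw_def the_inv_into_f_f)
    also have "\<dots> = quad I \<rho> (\<lambda>i. v (the_inv_into J h i))"
      by (rule quad_reindex[OF h, symmetric])
    finally show "0 \<le> quad J (\<lambda>i j. \<rho> (h i) (h j)) v" using * by (simp add: psd_iff_quad)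
  qed
qed

lemma state_reindex:
  assumes "state I \<rho>" and h: "bij_betw h J I" "\<And>i. i \<notin> J \<Longrightarrow> h i \<notin> I"
  shows "state J (\<lambda>i j. \<rho> (h i) (h j))"
proof -
  have "op_trace J (\<lambda>i j. \<rho> (h i) (h j)) = op_trace I \<rho>"
    unfolding op_trace_def by (rule sum.reindex_bij_betw[OF h(1)])
  then show ?thesis
    using assms psd_reindex[OF h(1)] by (auto simp: state_def ops_def)
qed

text \<open>A fixed vector tensored with each basis vector of \<open>Y\<close> in turn tests \<rho>
  through its partial trace. This gives positivity of reduced states, and in strong subadditivity it
  collapses the repeated eigenvalues of 1 \<otimes> \<tau>.\<close>

lemma sum_quad_tensor_one:
  assumes "finite Y"
  shows "(\<Sum>y\<in>Y. quad (X \<times> Y) \<rho> (\<lambda>i. tensor_one Y W i (m, y))) = quad X (tr_snd Y \<rho>) (\<lambda>i. W i m)"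
proof -
  have "quad (X \<times> Y) \<rho> (\<lambda>i. tensor_one Y W i (m, y))
    = (\<Sum>x\<in>X. \<Sum>x'\<in>X. cnj (W x m) * \<rho> (x, y) (x', y) * W x' m)" if y: "y \<in> Y" for y
  proof -
    have "quad (X \<times> Y) \<rho> (\<lambda>i. tensor_one Y W i (m, y))
      = (\<Sum>(x, z)\<in>X \<times> Y. if z = y then \<Sum>(x', z')\<in>X \<times> Y. if z' = y then cnj (W x m) * \<rho> (x, y) (x', y) * W x' m else 0 else 0)"
      unfolding quad_def using y by (intro sum.cong) (auto simp: block_def intro!: sum.cong)
    then show ?thesis
      using assms y by (simp add: sum.cartesian_product[symmetric])
  qed
  then have "(\<Sum>y\<in>Y. quad (X \<times> Y) \<rho> (\<lambda>i. tensor_one Y W i (m, y)))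
    = (\<Sum>y\<in>Y. \<Sum>x\<in>X. \<Sum>x'\<in>X. cnj (W x m) * \<rho> (x, y) (x', y) * W x' m)" by simp
  also have "\<dots> = (\<Sum>x\<in>X. \<Sum>y\<in>Y. \<Sum>x'\<in>X. cnj (W x m) * \<rho> (x, y) (x', y) * W x' m)"
    by (rule sum.swap)
  also have "\<dots> = (\<Sum>x\<in>X. \<Sum>x'\<in>X. \<Sum>y\<in>Y. cnj (W x m) * \<rho> (x, y) (x', y) * W x' m)"
    by (intro sum.cong refl sum.swap)
  finally show ?thesis by (simp add: quad_def tr_snd_def sum_distrib_left sum_distrib_right)
qed

lemma state_tr_snd:
  assumes "state (X \<times> Y) \<rho>" "finite Y"
  shows "state X (tr_snd Y \<rho>)"
proof -
  have "0 \<le> quad X (tr_snd Y \<rho>) v" for v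
    using assms(1) sum_quad_tensor_one[OF assms(2), of X \<rho> "\<lambda>i (_::unit). v i" "()"]
    by (metis (no_types, lifting) psd_iff_quad state_def sum_nonneg)
  moreover have "op_trace X (tr_snd Y \<rho>) = op_trace (X \<times> Y) \<rho>"
    by (simp add: op_trace_def tr_snd_def sum.cartesian_product case_prod_beta)
  ultimately show ?thesis
    using assms by (auto simp: state_def psd_iff_quad ops_def tr_snd_def)
qed

lemma state_eigdec:
  assumes "state I \<rho>" "finite I"
  obtains p U where "eigdec I I \<rho> p U" "\<And>k. k \<in> I \<Longrightarrow> 0 \<le> p k" "(\<Sum>k\<in>I. p k) = 1"
proof -
  obtain p U where "eigdec I I \<rho> p U" "\<forall>k\<in>I. 0 \<le> p k"
    using assms psd_eigdec unfolding state_def by blast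
  moreover from this have "(\<Sum>k\<in>I. p k) = 1"
    using eigdec_trace[OF _ assms(2) assms(2)] assms(1) unfolding state_def by (metis of_real_eq_1_iff)
  ultimately show ?thesis using that by blast
qed

text \<open>The prefactor stays unperturbed, so for \<open>q = 0\<close> the term is identically
  zero whatever the logarithm does; kernels contribute nothing to the limit.\<close>

lemma tendsto_xlnx_shift:
  fixes q c :: real
  assumes "0 \<le> q"
  shows "((\<lambda>e. q * ln (q + c * e)) \<longlongrightarrow> q * ln q) (at_right 0)"
proof (cases "q = 0")
  case False
  have "((\<lambda>e. q * ln (q + c * e)) \<longlongrightarrow> q * ln (q + c * 0)) (at_right 0)"
    using False assms by (intro tendsto_intros) auto
  then show ?thesis by simp
qed simp

lemma state_swap_last:
  assumes "state ((X \<times> Y) \<times> Z) \<rho>"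
  shows "state ((X \<times> Z) \<times> Y) (swap_last \<rho>)"
proof -
  let ?h = "\<lambda>((x, z), y). ((x, y), z)"
  have "state ((X \<times> Z) \<times> Y) (\<lambda>i j. \<rho> (?h i) (?h j))"
    by (rule state_reindex[OF assms]) (auto simp: bij_betw_def inj_on_def image_iff)
  moreover have "(\<lambda>i j. \<rho> (?h i) (?h j)) = swap_last \<rho>"
    by (auto simp: swap_last_def fun_eq_iff)
  ultimately show ?thesis by simp
qed

theorem strong_subadditivity:
  fixes A :: "'a set" and B :: "'b set" and E :: "'e set"
  assumes fin: "finite A" "finite B" "finite E" and \<rho>: "state ((A \<times> B) \<times> E) \<rho>"
  shows "0 \<le> cmi A B E \<rho>"
proof -
  have finI: "finite ((A \<times> B) \<times> E)" "finite (A \<times> E)" "finite (B \<times> E)" "finite ((A \<times> E) \<times> B)"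
    "finite ((B \<times> E) \<times> A)" "finite (E \<times> A)" "finite E" using fin by auto
  \<comment> \<open>\<open>tr_snd\<close> and \<open>tensor_one\<close> act on the last factor:
    \<open>?g\<close> brings \<open>B\<close> to the end for tracing out, \<open>?g'\<close> and
    \<open>?h\<close> bring \<open>A\<close> to the end for 1 \<otimes> \<tau>, and
    \<open>?s\<close> does so for the reduced pair.\<close>
  let ?g = "\<lambda>((a, e), b). ((a, b), e)" and ?g' = "\<lambda>((b, e), a). ((a, b), e)"
  let ?h = "\<lambda>((a, e), b). ((b, e), a)" and ?s = "\<lambda>(a, e). (e, a)"
  have g: "bij_betw ?g ((A \<times> E) \<times> B) ((A \<times> B) \<times> E)" and g': "bij_betw ?g' ((B \<times> E) \<times> A) ((A \<times> B) \<times> E)"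
    and h: "bij_betw ?h ((A \<times> E) \<times> B) ((B \<times> E) \<times> A)" and s: "bij_betw ?s (A \<times> E) (E \<times> A)"
    and s': "bij_betw ?s (E \<times> A) (A \<times> E)"
    by (auto simp: bij_betw_def inj_on_def image_iff)
  define \<rho>1 where "\<rho>1 = swap_last \<rho>"
  have \<rho>1: "\<rho>1 = (\<lambda>i j. \<rho> (?g i) (?g j))" by (auto simp: \<rho>1_def swap_last_def fun_eq_iff)
  define \<rho>2 where "\<rho>2 = (\<lambda>i j. \<rho> (?g' i) (?g' j))"
  have \<rho>12: "\<rho>1 = (\<lambda>i j. \<rho>2 (?h i) (?h j))" by (auto simp: \<rho>1 \<rho>2_def fun_eq_iff)
  define \<mu> where "\<mu> = tr_mid B \<rho>"
  define \<tau> where "\<tau> = tr_first A \<rho>"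
  define \<nu> where "\<nu> = tr_fst (A \<times> B) \<rho>"
  define \<mu>2 where "\<mu>2 = (\<lambda>i j. \<mu> (?s i) (?s j))"
  have \<mu>: "\<mu> = tr_snd B \<rho>1" by (auto simp: \<mu>_def \<rho>1_def tr_mid_def tr_snd_def swap_last_def fun_eq_iff)
  have \<tau>: "\<tau> = tr_snd A \<rho>2" by (auto simp: \<tau>_def \<rho>2_def tr_first_def tr_snd_def fun_eq_iff)
  have \<nu>: "\<nu> = tr_snd A \<mu>2"
    by (auto simp: \<nu>_def \<mu>2_def \<mu>_def tr_mid_def tr_fst_def tr_snd_def fun_eq_iff sum.cartesian_product case_prod_beta)
  have \<nu>': "\<nu> e e' = (\<Sum>b\<in>B. \<tau> (b, e) (b, e'))" for e e'
  proof -
    have "\<nu> e e' = (\<Sum>a\<in>A. \<Sum>b\<in>B. \<rho> ((a, b), e) ((a, b), e'))"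
      by (simp add: \<nu>_def tr_fst_def sum.cartesian_product case_prod_beta)
    also have "\<dots> = (\<Sum>b\<in>B. \<Sum>a\<in>A. \<rho> ((a, b), e) ((a, b), e'))" by (rule sum.swap)
    finally show ?thesis by (simp add: \<tau>_def tr_first_def)
  qed
  have st1: "state ((A \<times> E) \<times> B) \<rho>1" unfolding \<rho>1_def by (rule state_swap_last[OF \<rho>])
  have st2: "state ((B \<times> E) \<times> A) \<rho>2" unfolding \<rho>2_def by (rule state_reindex[OF \<rho> g']) auto
  have st\<mu>: "state (A \<times> E) \<mu>" unfolding \<mu> by (rule state_tr_snd[OF st1 fin(2)])
  have st\<mu>2: "state (E \<times> A) \<mu>2" unfolding \<mu>2_def by (rule state_reindex[OF st\<mu> s']) auto
  have st\<tau>: "state (B \<times> E) \<tau>" unfolding \<tau> by (rule state_tr_snd[OF st2 fin(1)])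
  have st\<nu>: "state E \<nu>" unfolding \<nu> by (rule state_tr_snd[OF st\<mu>2 fin(1)])
  obtain p U where pU: "eigdec ((A \<times> B) \<times> E) ((A \<times> B) \<times> E) \<rho> p U"
    and p: "\<And>k. k \<in> (A \<times> B) \<times> E \<Longrightarrow> 0 \<le> p k" by (rule state_eigdec[OF \<rho> finI(1)]) blast
  obtain p' U' where pU': "eigdec (A \<times> E) (A \<times> E) \<mu> p' U'"
    and p': "\<And>k. k \<in> A \<times> E \<Longrightarrow> 0 \<le> p' k" by (rule state_eigdec[OF st\<mu> finI(2)]) blast
  obtain q W where qW: "eigdec (B \<times> E) (B \<times> E) \<tau> q W"
    and q: "\<And>k. k \<in> B \<times> E \<Longrightarrow> 0 \<le> q k" by (rule state_eigdec[OF st\<tau> finI(3)]) blast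
  obtain q' W' where qW': "eigdec E E \<nu> q' W'"
    and q': "\<And>k. k \<in> E \<Longrightarrow> 0 \<le> q' k" by (rule state_eigdec[OF st\<nu> fin(3)]) blast
  \<comment> \<open>Trace 1 excludes an empty \<open>B\<close>, so the shift
    \<open>card B * c\<close> of the reduced operator is strictly positive too.\<close>
  have "B \<noteq> {}"
  proof
    assume "B = {}"
    then show False using \<rho> by (simp add: state_def op_trace_def)
  qed
  then have cardB: "real (card B) > 0" using fin by (simp add: card_gt_0_iff)
  have pU1: "eigdec ((A \<times> E) \<times> B) ((A \<times> B) \<times> E) \<rho>1 p (\<lambda>i. U (?g i))"
    unfolding \<rho>1 by (rule eigdec_reindex[OF pU g _ finI(1)]) auto
  \<comment> \<open>Tracing out \<open>B\<close> turns \<open>c\<close> times the identity on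
    \<open>B \<times> E\<close> into \<open>card B * c\<close> times the identity on
    \<open>E\<close>. The factor in \<open>1 * c\<close> matches the shape of
    \<open>tendsto_xlnx_shift\<close>.\<close>
  have key: "(\<Sum>k\<in>A \<times> E. p' k * ln (p' k)) - (\<Sum>l\<in>E. q' l * ln (q' l + real (card B) * c))
    \<le> (\<Sum>k\<in>(A \<times> B) \<times> E. p k * ln (p k)) - (\<Sum>l\<in>B \<times> E. q l * ln (q l + 1 * c))" if c: "0 < c" for c
  proof -
    define \<tau>c where "\<tau>c = (\<lambda>i j. \<tau> i j + of_real c * one (B \<times> E) i j)"
    define \<nu>c where "\<nu>c = (\<lambda>i j. \<nu> i j + of_real (real (card B) * c) * one E i j)"
    define \<sigma> where "\<sigma> = (\<lambda>i j. tensor_one A \<tau>c (?h i) (?h j))"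
    let ?W = "\<lambda>i. tensor_one A W (?h i)" and ?W' = "\<lambda>i. tensor_one A W' (?s i)"
    have "eigdec ((B \<times> E) \<times> A) ((B \<times> E) \<times> A) (tensor_one A \<tau>c) (\<lambda>(l, a). q l + c) (tensor_one A W)"
      unfolding \<tau>c_def by (intro eigdec_block eigdec_shift qW finI fin)
    then have \<sigma>: "eigdec ((A \<times> E) \<times> B) ((B \<times> E) \<times> A) \<sigma> (\<lambda>(l, a). q l + c) ?W"
      unfolding \<sigma>_def by (rule eigdec_reindex[OF _ h _ finI(5)]) auto
    have "eigdec (E \<times> A) (E \<times> A) (tensor_one A \<nu>c) (\<lambda>(l, a). q' l + real (card B) * c) (tensor_one A W')"
      unfolding \<nu>c_def by (intro eigdec_block eigdec_shift qW' finI fin)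
    then have "eigdec (A \<times> E) (E \<times> A) (\<lambda>i j. tensor_one A \<nu>c (?s i) (?s j)) (\<lambda>(l, a). q' l + real (card B) * c) ?W'"
      by (rule eigdec_reindex[OF _ s _ finI(6)]) auto
    moreover have "\<tau>c (b, e) (b, e') = \<tau> (b, e) (b, e') + (if e = e' \<and> e \<in> E then of_real c else 0)"
      if "b \<in> B" for b e e' using that by (auto simp: \<tau>c_def diag_def)
    then have "tr_snd B \<sigma> (a, e) (a', e') = tensor_one A \<nu>c (e, a) (e', a')" for a e a' e'
      using fin by (cases "a = a' \<and> a \<in> A"; cases "e = e' \<and> e \<in> E")
        (auto simp: tr_snd_def \<sigma>_def block_apply \<nu>c_def \<nu>' diag_def sum.distrib intro!: sum.neutral)
    then have "tr_snd B \<sigma> = (\<lambda>i j. tensor_one A \<nu>c (?s i) (?s j))"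
      by (auto simp: fun_eq_iff)
    ultimately have \<sigma>': "eigdec (A \<times> E) (E \<times> A) (tr_snd B \<sigma>) (\<lambda>(l, a). q' l + real (card B) * c) ?W'"
      by simp
    \<comment> \<open>Each eigenvalue is repeated for every \<open>a\<close>; summing the diagonal
      entries over \<open>a\<close> leaves those of \<nu> in its own eigenbasis, which are its
      eigenvalues.\<close>
    have 1: "(\<Sum>(l, a)\<in>E \<times> A. Re (quad (A \<times> E) \<mu> (\<lambda>i. ?W' i (l, a))) * f l) = (\<Sum>l\<in>E. q' l * f l)" for f
    proof -
      have "quad (A \<times> E) \<mu> (\<lambda>i. ?W' i m) = quad (E \<times> A) \<mu>2 (\<lambda>i. tensor_one A W' i m)" for m
        by (subst quad_reindex[OF s']) (auto simp: \<mu>2_def quad_def intro!: sum.cong)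
      then have "(\<Sum>(l, a)\<in>E \<times> A. Re (quad (A \<times> E) \<mu> (\<lambda>i. ?W' i (l, a))) * f l)
        = (\<Sum>l\<in>E. Re (\<Sum>a\<in>A. quad (E \<times> A) \<mu>2 (\<lambda>i. tensor_one A W' i (l, a))) * f l)"
        by (simp add: sum.cartesian_product[symmetric] sum_distrib_right)
      then show ?thesis
        unfolding sum_quad_tensor_one[OF fin(1)] \<nu>[symmetric] by (simp add: eigdec_diag_entry[OF qW' fin(3)])
    qed
    have 2: "(\<Sum>(l, a)\<in>(B \<times> E) \<times> A. Re (quad ((A \<times> E) \<times> B) \<rho>1 (\<lambda>i. ?W i (l, a))) * f l) = (\<Sum>l\<in>B \<times> E. q l * f l)" for f
    proof -
      have "quad ((A \<times> E) \<times> B) \<rho>1 (\<lambda>i. ?W i m) = quad ((B \<times> E) \<times> A) \<rho>2 (\<lambda>i. tensor_one A W i m)" for m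
        unfolding \<rho>12 by (rule quad_reindex[OF h, symmetric])
      then have "(\<Sum>(l, a)\<in>(B \<times> E) \<times> A. Re (quad ((A \<times> E) \<times> B) \<rho>1 (\<lambda>i. ?W i (l, a))) * f l)
        = (\<Sum>l\<in>B \<times> E. Re (\<Sum>a\<in>A. quad ((B \<times> E) \<times> A) \<rho>2 (\<lambda>i. tensor_one A W i (l, a))) * f l)"
        unfolding sum.cartesian_product[of _ A "B \<times> E", symmetric] by (simp add: sum_distrib_right)
      then show ?thesis
        unfolding sum_quad_tensor_one[OF fin(1)] \<tau>[symmetric] by (simp add: eigdec_diag_entry[OF qW finI(3)])
    qed
    have "(\<Sum>k\<in>A \<times> E. p' k * ln (p' k)) - (\<Sum>l\<in>E \<times> A. Re (quad (A \<times> E) (tr_snd B \<rho>1) (\<lambda>i. ?W' i l)) * ln ((\<lambda>(l, a). q' l + real (card B) * c) l))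
      \<le> (\<Sum>k\<in>(A \<times> B) \<times> E. p k * ln (p k)) - (\<Sum>l\<in>(B \<times> E) \<times> A. Re (quad ((A \<times> E) \<times> B) \<rho>1 (\<lambda>i. ?W i l)) * ln ((\<lambda>(l, a). q l + c) l))"
      by (rule relative_entropy_mono[OF pU1 \<sigma> pU'[unfolded \<mu>] \<sigma>' finI(2) fin(2) finI(1) finI(5) finI(2) finI(6)])
        (use p p' q q' c cardB in \<open>auto simp: add_nonneg_pos\<close>)
    then show ?thesis
      unfolding \<mu>[symmetric] using 1[of "\<lambda>l. ln (q' l + real (card B) * c)"] 2[of "\<lambda>l. ln (q l + c)"]
      by (simp add: case_prod_beta)
  qed
  have "(\<Sum>k\<in>A \<times> E. p' k * ln (p' k)) - (\<Sum>l\<in>E. q' l * ln (q' l))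
    \<le> (\<Sum>k\<in>(A \<times> B) \<times> E. p k * ln (p k)) - (\<Sum>l\<in>B \<times> E. q l * ln (q l))"
  proof (rule tendsto_le)
    show "((\<lambda>c. (\<Sum>k\<in>A \<times> E. p' k * ln (p' k)) - (\<Sum>l\<in>E. q' l * ln (q' l + real (card B) * c)))
      \<longlongrightarrow> (\<Sum>k\<in>A \<times> E. p' k * ln (p' k)) - (\<Sum>l\<in>E. q' l * ln (q' l))) (at_right 0)"
      by (intro tendsto_diff tendsto_const tendsto_sum tendsto_xlnx_shift q')
    show "((\<lambda>c. (\<Sum>k\<in>(A \<times> B) \<times> E. p k * ln (p k)) - (\<Sum>l\<in>B \<times> E. q l * ln (q l + 1 * c)))
      \<longlongrightarrow> (\<Sum>k\<in>(A \<times> B) \<times> E. p k * ln (p k)) - (\<Sum>l\<in>B \<times> E. q l * ln (q l))) (at_right 0)"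
      by (intro tendsto_diff tendsto_const tendsto_sum tendsto_xlnx_shift q)
    show "\<forall>\<^sub>F c in at_right 0. (\<Sum>k\<in>A \<times> E. p' k * ln (p' k)) - (\<Sum>l\<in>E. q' l * ln (q' l + real (card B) * c))
      \<le> (\<Sum>k\<in>(A \<times> B) \<times> E. p k * ln (p k)) - (\<Sum>l\<in>B \<times> E. q l * ln (q l + 1 * c))"
      by (rule eventually_mono[OF eventually_at_right_less]) (rule key)
  qed simp
  moreover have "cmi A B E \<rho> = ((\<Sum>k\<in>(A \<times> B) \<times> E. p k * ln (p k)) - (\<Sum>l\<in>B \<times> E. q l * ln (q l))
      - ((\<Sum>k\<in>A \<times> E. p' k * ln (p' k)) - (\<Sum>l\<in>E. q' l * ln (q' l)))) / ln 2"
    unfolding cmi_def \<mu>_def[symmetric] \<tau>_def[symmetric] \<nu>_def[symmetric]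
      entropy_eigdec[OF pU finI(1) finI(1)] entropy_eigdec[OF pU' finI(2) finI(2)]
      entropy_eigdec[OF qW finI(3) finI(3)] entropy_eigdec[OF qW' fin(3) fin(3)]
    by (simp add: log_def sum_divide_distrib[symmetric] diff_divide_distrib)
  ultimately show ?thesis by simp
qed

section \<open>Flagged mixtures of product states\<close>

lemma eigdec_psd:
  assumes e: "eigdec I K \<rho> p U" and fin: "finite K" and p: "\<And>k. k \<in> K \<Longrightarrow> 0 \<le> p k"
  shows "psd I \<rho>" "\<rho> \<in> ops I"
proof -
  have "0 \<le> quad I \<rho> v" for v
    unfolding quad_eigdec[OF e fin] of_real_sum[symmetric]
    by (simp add: less_eq_complex_def sum_nonneg p del: of_real_sum)
  then show "psd I \<rho>" by (simp add: psd_iff_quad)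
  show "\<rho> \<in> ops I"
    unfolding ops_iff_supp by (subst (1 2) eigdecD(5)[OF e]) (simp add: eigdecD(1)[OF e])
qed

lemma eigdec_scale:
  assumes e: "eigdec I K \<rho> p U" and fin: "finite K"
  shows "eigdec I K (\<lambda>i j. of_real c * \<rho> i j) (\<lambda>k. c * p k) U"
proof -
  have "of_real c * \<rho> i j = (U \<odot>\<^bsub>K\<^esub> diag K (\<lambda>k. of_real (c * p k)) \<odot>\<^bsub>K\<^esub> adj U) i j" for i j
    unfolding mm_diag_mm[OF fin]
    by (subst eigdecD(5)[OF e], unfold mm_diag_mm[OF fin]) (simp add: sum_distrib_left mult_ac)
  then show ?thesis using eigdecD(1-4)[OF e] unfolding eigdec_def by (simp add: fun_eq_iff)
qed

definition tensor :: "('a \<Rightarrow> 'k \<Rightarrow> complex) \<Rightarrow> ('b \<Rightarrow> 'l \<Rightarrow> complex) \<Rightarrow> 'a \<times> 'b \<Rightarrow> 'k \<times> 'l \<Rightarrow> complex" where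
  "tensor A B = (\<lambda>(a, b) (k, l). A a k * B b l)"

lemma tensor_mm: "tensor A B \<odot>\<^bsub>I \<times> J\<^esub> tensor C D = tensor (A \<odot>\<^bsub>I\<^esub> C) (B \<odot>\<^bsub>J\<^esub> D)"
  by (auto simp: tensor_def mm_def fun_eq_iff sum_product sum.cartesian_product mult_ac intro!: sum.cong)

lemma adj_tensor: "adj (tensor A B) = tensor (adj A) (adj B)"
  by (auto simp: tensor_def adj_def fun_eq_iff)

lemma eigdec_tensor:
  assumes e: "eigdec I K \<rho> p U" and f: "eigdec J L \<sigma> q W"
  shows "eigdec (I \<times> J) (K \<times> L) (tensor \<rho> \<sigma>) (\<lambda>(k, l). p k * q l) (tensor U W)"
proof -
  note D = eigdecD[OF e] and F = eigdecD[OF f]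
  have one: "one (I \<times> J) = tensor (one I) (one J)" for I :: "'x set" and J :: "'y set"
    by (auto simp: tensor_def diag_def fun_eq_iff)
  have diag: "diag (K \<times> L) (\<lambda>k. of_real ((\<lambda>(k, l). p k * q l) k)) = tensor (diag K (\<lambda>k. of_real (p k))) (diag L (\<lambda>l. of_real (q l)))"
    by (auto simp: tensor_def diag_def fun_eq_iff)
  have "row_supp (I \<times> J) (tensor U W)" "col_supp (K \<times> L) (tensor U W)"
    using D(1,2) F(1,2) by (auto simp: row_supp_def col_supp_def tensor_def)
  then show ?thesis
    unfolding eigdec_def diag one adj_tensor tensor_mm D(3,4) F(3,4) D(5)[symmetric] F(5)[symmetric] by simp
qed

lemma tr_snd_block: "tr_snd S (block S \<tau>) = (\<lambda>i j. \<Sum>s\<in>S. \<tau> s i j)"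
  by (auto simp: tr_snd_def block_def fun_eq_iff intro!: sum.cong)

lemma psd_block:
  assumes "\<And>s. s \<in> S \<Longrightarrow> psd I (\<tau> s)" "finite S"
  shows "psd (I \<times> S) (block S \<tau>)"
proof -
  have "quad (I \<times> S) (block S \<tau>) v = (\<Sum>s\<in>S. quad I (\<tau> s) (\<lambda>i. v (i, s)))" for v
  proof -
    have "(\<Sum>j\<in>I \<times> S. cnj (v (i, s)) * block S \<tau> (i, s) j * v j)
      = (\<Sum>j\<in>I. cnj (v (i, s)) * \<tau> s i j * v (j, s))" if s: "s \<in> S" for i s
    proof -
      have "(\<Sum>j\<in>I \<times> S. cnj (v (i, s)) * block S \<tau> (i, s) j * v j)
        = (\<Sum>(j, t)\<in>I \<times> S. if t = s then cnj (v (i, s)) * \<tau> s i j * v (j, s) else 0)"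
        by (intro sum.cong) (auto simp: block_def s)
      then show ?thesis using assms(2) s by (simp add: sum.cartesian_product[symmetric])
    qed
    then have "quad (I \<times> S) (block S \<tau>) v = (\<Sum>(i, s)\<in>I \<times> S. \<Sum>j\<in>I. cnj (v (i, s)) * \<tau> s i j * v (j, s))"
      unfolding quad_def by (intro sum.cong) auto
    then show ?thesis
      unfolding quad_def sum.cartesian_product[symmetric] by (simp only: sum.swap[of _ S I])
  qed
  then show ?thesis using assms by (simp add: psd_iff_quad sum_nonneg)
qed

lemma op_trace_tr_snd: "op_trace X (tr_snd Y \<rho>) = op_trace (X \<times> Y) \<rho>"
  by (simp add: op_trace_def tr_snd_def sum.cartesian_product case_prod_beta)

text \<open>Forgetting the flag \<open>s\<close> of the ensemble restores \<rho>, from which trace 1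
  is inherited; this supplies the witnesses for the infima over extensions.\<close>

lemma extension_block:
  assumes "state I \<rho>" "finite S" "\<And>s. s \<in> S \<Longrightarrow> psd I (\<tau> s)" "\<And>s. s \<in> S \<Longrightarrow> \<tau> s \<in> ops I"
    and "(\<lambda>i j. \<Sum>s\<in>S. \<tau> s i j) = \<rho>"
  shows "extension I S \<rho> (block S \<tau>)"
proof -
  have "tr_snd S (block S \<tau>) = \<rho>" using assms(5) by (simp add: tr_snd_block)
  moreover from this have "op_trace (I \<times> S) (block S \<tau>) = 1"
    using assms(1) op_trace_tr_snd[of I S "block S \<tau>"] by (simp add: state_def)
  ultimately show ?thesis
    using assms by (simp add: extension_def state_def psd_block block_ops)
qed

text \<open>The product rule for x log x, valid also at 0 because both sides vanish once a factor
  does.\<close>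

lemma xlog_mult:
  fixes x y :: real
  assumes "0 \<le> x" "0 \<le> y"
  shows "(x * y) * log 2 (x * y) = y * (x * log 2 x) + x * (y * log 2 y)"
  using assms by (cases "x = 0 \<or> y = 0") (auto simp: log_mult algebra_simps)

text \<open>Conditioned on the flag the two systems are independent. In each of the first three
  entropies a flag of weight w contributes w log w plus w times the sum over conditional
  eigenvalues, and in the last one w log w alone, up to the common sign. The parts w log w cancel as
  1 + 1 - 1 - 1, the rest because the sum of x log x is additive for product distributions.\<close>

lemma cmi_block_product:
  fixes X :: "'x set" and Y :: "'y set" and S :: "'s set"
  assumes fin: "finite X" "finite Y" "finite S"
    and w: "\<And>s. s \<in> S \<Longrightarrow> 0 \<le> w s" and \<alpha>: "\<And>s. s \<in> S \<Longrightarrow> state X (\<alpha> s)" and \<beta>: "\<And>s. s \<in> S \<Longrightarrow> state Y (\<beta> s)"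
  shows "cmi X Y S (block S (\<lambda>s i j. of_real (w s) * tensor (\<alpha> s) (\<beta> s) i j)) = 0"
proof -
  let ?\<sigma> = "block S (\<lambda>s i j. of_real (w s) * tensor (\<alpha> s) (\<beta> s) i j)"
  \<comment> \<open>Eigenvalues and eigenvectors are bundled in a pair so that a single choice over
    \<open>S\<close> fixes both.\<close>
  have "\<forall>s\<in>S. \<exists>aU. eigdec X X (\<alpha> s) (fst aU) (snd aU) \<and> (\<forall>k\<in>X. 0 \<le> fst aU k) \<and> (\<Sum>k\<in>X. fst aU k) = 1"
    using \<alpha> state_eigdec[OF _ fin(1)] by (metis fst_conv snd_conv)
  then obtain aU where aU: "\<forall>s\<in>S. eigdec X X (\<alpha> s) (fst (aU s)) (snd (aU s)) \<and> (\<forall>k\<in>X. 0 \<le> fst (aU s) k) \<and> (\<Sum>k\<in>X. fst (aU s) k) = 1"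
    by (rule bchoice[THEN exE])
  have "\<forall>s\<in>S. \<exists>bV. eigdec Y Y (\<beta> s) (fst bV) (snd bV) \<and> (\<forall>k\<in>Y. 0 \<le> fst bV k) \<and> (\<Sum>k\<in>Y. fst bV k) = 1"
    using \<beta> state_eigdec[OF _ fin(2)] by (metis fst_conv snd_conv)
  then obtain bV where bV: "\<forall>s\<in>S. eigdec Y Y (\<beta> s) (fst (bV s)) (snd (bV s)) \<and> (\<forall>k\<in>Y. 0 \<le> fst (bV s) k) \<and> (\<Sum>k\<in>Y. fst (bV s) k) = 1"
    by (rule bchoice[THEN exE])
  define a U b V where "a s = fst (aU s)" and "U s = snd (aU s)" and "b s = fst (bV s)" and "V s = snd (bV s)" for s
  have a: "eigdec X X (\<alpha> s) (a s) (U s)" "\<And>k. k \<in> X \<Longrightarrow> 0 \<le> a s k" "(\<Sum>k\<in>X. a s k) = 1"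
    and b: "eigdec Y Y (\<beta> s) (b s) (V s)" "\<And>k. k \<in> Y \<Longrightarrow> 0 \<le> b s k" "(\<Sum>k\<in>Y. b s k) = 1" if "s \<in> S" for s
    using that aU bV by (auto simp: a_def b_def U_def V_def)
  let ?f = "\<lambda>x::real. x * log 2 x"
  have trb: "(\<Sum>y\<in>Y. \<beta> s y y) = 1" and tra: "(\<Sum>x\<in>X. \<alpha> s x x) = 1" if "s \<in> S" for s
    using \<alpha>[OF that] \<beta>[OF that] by (auto simp: state_def op_trace_def)
  have "tr_mid Y ?\<sigma> (x, s) (x', t) = block S (\<lambda>s i j. of_real (w s) * \<alpha> s i j) (x, s) (x', t)" for x s x' t
    using trb by (cases "s = t \<and> s \<in> S") (auto intro!: sum.neutral simp: tr_mid_def block_def tensor_def mult.assoc[symmetric] sum_distrib_left[symmetric])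
  then have mid: "tr_mid Y ?\<sigma> = block S (\<lambda>s i j. of_real (w s) * \<alpha> s i j)"
    by (auto simp: fun_eq_iff)
  have "tr_first X ?\<sigma> (y, s) (y', t) = block S (\<lambda>s i j. of_real (w s) * \<beta> s i j) (y, s) (y', t)" for y s y' t
    using tra by (cases "s = t \<and> s \<in> S") (auto intro!: sum.neutral simp: tr_first_def block_def tensor_def mult.assoc[symmetric] sum_distrib_left[symmetric] sum_distrib_right[symmetric])
  then have first: "tr_first X ?\<sigma> = block S (\<lambda>s i j. of_real (w s) * \<beta> s i j)"
    by (auto simp: fun_eq_iff)
  have "(\<Sum>i\<in>X \<times> Y. tensor (\<alpha> s) (\<beta> s) i i) = 1" if "s \<in> S" for s
  proof -
    have "(\<Sum>i\<in>X \<times> Y. tensor (\<alpha> s) (\<beta> s) i i) = (\<Sum>x\<in>X. \<alpha> s x x) * (\<Sum>y\<in>Y. \<beta> s y y)"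
      by (simp add: tensor_def sum_product sum.cartesian_product case_prod_beta)
    then show ?thesis using tra[OF that] trb[OF that] by simp
  qed
  then have "tr_fst (X \<times> Y) ?\<sigma> s t = diag S (\<lambda>s. of_real (w s)) s t" for s t
    by (cases "s = t \<and> s \<in> S") (auto intro!: sum.neutral simp: tr_fst_def block_apply diag_def sum_distrib_left[symmetric])
  then have last: "tr_fst (X \<times> Y) ?\<sigma> = diag S (\<lambda>s. of_real (w s))" by blast
  have e0: "eigdec S S (diag S (\<lambda>s. of_real (w s))) w (one S)"
    using fin by (simp add: eigdec_def)
  have e1: "eigdec (X \<times> S) (X \<times> S) (tr_mid Y ?\<sigma>) (\<lambda>(k, s). w s * a s k) (block S U)"
    unfolding mid by (intro eigdec_block eigdec_scale a fin)
  have e2: "eigdec (Y \<times> S) (Y \<times> S) (tr_first X ?\<sigma>) (\<lambda>(k, s). w s * b s k) (block S V)"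
    unfolding first by (intro eigdec_block eigdec_scale b fin)
  have e3: "eigdec ((X \<times> Y) \<times> S) ((X \<times> Y) \<times> S) ?\<sigma> (\<lambda>(k, s). w s * (\<lambda>(i, j). a s i * b s j) k) (block S (\<lambda>s. tensor (U s) (V s)))"
    by (intro eigdec_block eigdec_scale eigdec_tensor a b fin finite_cartesian_product)
  have swap: "(\<Sum>i\<in>I \<times> S. g i) = (\<Sum>s\<in>S. \<Sum>i\<in>I. g (i, s))" for I :: "'i set" and g :: "'i \<times> 's \<Rightarrow> real"
    by (subst sum.swap) (simp add: sum.cartesian_product case_prod_beta)
  have key: "(\<Sum>i\<in>X. ?f (w s * a s i)) + (\<Sum>j\<in>Y. ?f (w s * b s j))
    - (\<Sum>i\<in>X. \<Sum>j\<in>Y. ?f (w s * (a s i * b s j))) - ?f (w s) = 0" if s: "s \<in> S" for s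
  proof -
    have 1: "(\<Sum>i\<in>X. ?f (w s * a s i)) = ?f (w s) + w s * (\<Sum>i\<in>X. ?f (a s i))"
      using s a(2,3)[OF s] w[OF s] by (simp add: xlog_mult sum.distrib sum_distrib_left[symmetric] sum_distrib_right[symmetric])
    have 2: "(\<Sum>j\<in>Y. ?f (w s * b s j)) = ?f (w s) + w s * (\<Sum>j\<in>Y. ?f (b s j))"
      using s b(2,3)[OF s] w[OF s] by (simp add: xlog_mult sum.distrib sum_distrib_left[symmetric] sum_distrib_right[symmetric])
    have "(\<Sum>j\<in>Y. ?f (w s * (a s i * b s j))) = a s i * ?f (w s) + w s * (?f (a s i) + a s i * (\<Sum>j\<in>Y. ?f (b s j)))"
      if i: "i \<in> X" for i
    proof -
      have "?f (w s * (a s i * b s j)) = b s j * (a s i * ?f (w s) + w s * ?f (a s i)) + (w s * a s i) * ?f (b s j)" if "j \<in> Y" for j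
      proof -
        have "?f (w s * (a s i * b s j)) = (a s i * b s j) * ?f (w s) + w s * ?f (a s i * b s j)"
          using a(2)[OF s i] b(2)[OF s that] w[OF s] by (intro xlog_mult) auto
        also have "?f (a s i * b s j) = b s j * ?f (a s i) + a s i * ?f (b s j)"
          using a(2)[OF s i] b(2)[OF s that] by (intro xlog_mult) auto
        finally show ?thesis by (simp add: algebra_simps)
      qed
      then have "(\<Sum>j\<in>Y. ?f (w s * (a s i * b s j)))
        = (\<Sum>j\<in>Y. b s j * (a s i * ?f (w s) + w s * ?f (a s i)) + (w s * a s i) * ?f (b s j))" by simp
      also have "\<dots> = (\<Sum>j\<in>Y. b s j) * (a s i * ?f (w s) + w s * ?f (a s i)) + (w s * a s i) * (\<Sum>j\<in>Y. ?f (b s j))"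
        by (simp only: sum.distrib sum_distrib_left sum_distrib_right)
      finally show ?thesis using b(3)[OF s] by (simp add: algebra_simps)
    qed
    then have "(\<Sum>i\<in>X. \<Sum>j\<in>Y. ?f (w s * (a s i * b s j)))
      = (\<Sum>i\<in>X. a s i * ?f (w s) + w s * (?f (a s i) + a s i * (\<Sum>j\<in>Y. ?f (b s j))))" by simp
    also have "\<dots> = (\<Sum>i\<in>X. a s i) * ?f (w s) + w s * ((\<Sum>i\<in>X. ?f (a s i)) + (\<Sum>i\<in>X. a s i) * (\<Sum>j\<in>Y. ?f (b s j)))"
      by (simp only: sum.distrib sum_distrib_left[symmetric] sum_distrib_right[symmetric])
    finally show ?thesis using 1 2 a(3)[OF s] by (simp add: algebra_simps)
  qed
  have "cmi X Y S ?\<sigma> = - (\<Sum>s\<in>S. (\<Sum>i\<in>X. ?f (w s * a s i)) + (\<Sum>j\<in>Y. ?f (w s * b s j))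
    - (\<Sum>i\<in>X. \<Sum>j\<in>Y. ?f (w s * (a s i * b s j))) - ?f (w s))"
    unfolding cmi_def last entropy_eigdec[OF e0 fin(3) fin(3)]
      entropy_eigdec[OF e1 finite_cartesian_product[OF fin(1,3)] finite_cartesian_product[OF fin(1,3)]]
      entropy_eigdec[OF e2 finite_cartesian_product[OF fin(2,3)] finite_cartesian_product[OF fin(2,3)]]
      entropy_eigdec[OF e3 finite_cartesian_product[OF finite_cartesian_product[OF fin(1,2)] fin(3)] finite_cartesian_product[OF finite_cartesian_product[OF fin(1,2)] fin(3)]]
      swap
    by (simp add: sum.distrib sum_subtractf sum.cartesian_product case_prod_beta)
  then show ?thesis by (simp add: key)
qed

text \<open>Retains of a separable decomposition what the witnesses use: positive summands whose
  flagged mixture has vanishing conditional mutual information. Positivity of \<open>n\<close>,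
  forced by weights with sum 1, gives the steering measurement an outcome 0.\<close>

lemma sep_states_flag:
  assumes fin: "finite X" "finite Y" and \<sigma>: "\<sigma> \<in> sep_states X Y"
  obtains n :: nat and \<tau> where "0 < n" "\<And>k. k < n \<Longrightarrow> psd (X \<times> Y) (\<tau> k)" "\<And>k. k < n \<Longrightarrow> \<tau> k \<in> ops (X \<times> Y)"
    "(\<lambda>i j. \<Sum>k<n. \<tau> k i j) = \<sigma>" "cmi X Y {..<n} (block {..<n} \<tau>) = 0"
proof -
  obtain n :: nat and w \<alpha> \<beta> where *: "\<And>k. k < n \<Longrightarrow> 0 \<le> w k" "\<And>k. k < n \<Longrightarrow> state X (\<alpha> k)"
    "\<And>k. k < n \<Longrightarrow> state Y (\<beta> k)" "(\<Sum>k<n. w k) = 1"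
    "\<sigma> = (\<lambda>(x, y) (x', y'). \<Sum>k<n. of_real (w k) * \<alpha> k x x' * \<beta> k y y')"
    using \<sigma> unfolding sep_states_def by blast
  let ?\<tau> = "\<lambda>k i j. of_real (w k) * tensor (\<alpha> k) (\<beta> k) i j"
  have "0 < n" using *(4) by (cases n) auto
  moreover have "psd (X \<times> Y) (?\<tau> k) \<and> ?\<tau> k \<in> ops (X \<times> Y)" if k: "k < n" for k
  proof -
    obtain a U where a: "eigdec X X (\<alpha> k) a U" "\<And>i. i \<in> X \<Longrightarrow> 0 \<le> a i"
      by (rule state_eigdec[OF *(2)[OF k] fin(1)]) blast
    obtain b V where b: "eigdec Y Y (\<beta> k) b V" "\<And>i. i \<in> Y \<Longrightarrow> 0 \<le> b i"
      by (rule state_eigdec[OF *(3)[OF k] fin(2)]) blast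
    have "eigdec (X \<times> Y) (X \<times> Y) (?\<tau> k) (\<lambda>i. w k * (\<lambda>(i, j). a i * b j) i) (tensor U V)"
      by (intro eigdec_scale eigdec_tensor a b finite_cartesian_product fin)
    then show ?thesis
      using eigdec_psd[of "X \<times> Y" "X \<times> Y" "?\<tau> k"] *(1)[OF k] a(2) b(2) fin by (auto simp: case_prod_beta)
  qed
  moreover have "(\<lambda>i j. \<Sum>k<n. ?\<tau> k i j) = \<sigma>"
    by (auto simp: *(5) tensor_def fun_eq_iff mult.assoc)
  moreover have "cmi X Y {..<n} (block {..<n} ?\<tau>) = 0"
    by (rule cmi_block_product) (use * fin in auto)
  ultimately show ?thesis using that[of n ?\<tau>] by blast
qed

section \<open>Quantum operations and isometries\<close>

lemma psd_kernel:
  assumes "psd I \<tau>" "\<tau> \<in> ops I" "finite I" and v: "quad I \<tau> v = 0"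
  shows "(\<Sum>j\<in>I. \<tau> i j * v j) = 0"
proof -
  obtain p U where e: "eigdec I I \<tau> p U" and p: "\<And>k. k \<in> I \<Longrightarrow> 0 \<le> p k"
    using psd_eigdec[OF assms(3,1,2)] by blast
  let ?w = "\<lambda>k. \<Sum>j\<in>I. cnj (U j k) * v j"
  have "complex_of_real (\<Sum>k\<in>I. p k * (cmod (?w k))\<^sup>2) = 0"
    using quad_eigdec[OF e assms(3), of v] v by simp
  then have "(\<Sum>k\<in>I. p k * (cmod (?w k))\<^sup>2) = 0"
    by (simp only: of_real_eq_0_iff)
  \<comment> \<open>Nonnegative terms with sum zero vanish one by one, so \<open>p k\<close> or the
    overlap is zero, and with it the coefficient of the eigenvector in the image of
    \<open>v\<close>.\<close>
  then have z: "of_real (p k) * ?w k = 0" if "k \<in> I" for k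
    using that p assms(3) by (subst (asm) sum_nonneg_eq_0_iff) auto
  have "(\<Sum>j\<in>I. \<tau> i j * v j) = (\<Sum>j\<in>I. \<Sum>k\<in>I. U i k * of_real (p k) * (cnj (U j k) * v j))"
    by (subst eigdecD(5)[OF e], unfold mm_diag_mm[OF assms(3)]) (simp add: adj_def sum_distrib_left sum_distrib_right mult_ac)
  also have "\<dots> = (\<Sum>k\<in>I. U i k * (of_real (p k) * ?w k))"
    by (subst sum.swap) (simp add: sum_distrib_left mult_ac)
  finally show ?thesis using z by simp
qed

lemma mm_sum_right:
  "(\<lambda>i j. \<Sum>s\<in>S. (Z \<odot>\<^bsub>I\<^esub> \<tau> s) i j) = Z \<odot>\<^bsub>I\<^esub> (\<lambda>i j. \<Sum>s\<in>S. \<tau> s i j)"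
  unfolding mm_def sum_distrib_left by (intro ext sum.swap)

lemma mm_sum_left:
  "(\<lambda>i j. \<Sum>s\<in>S. (\<tau> s \<odot>\<^bsub>I\<^esub> Z) i j) = (\<lambda>i j. \<Sum>s\<in>S. \<tau> s i j) \<odot>\<^bsub>I\<^esub> Z"
  unfolding mm_def sum_distrib_right by (intro ext sum.swap)

text \<open>For a column v of \<open>Q\<close> the numbers <v, \<tau> s v> are nonnegative and sum
  to zero, so v lies in the kernel of every summand.\<close>

lemma psd_sum_annihilate:
  assumes fin: "finite I" "finite S" and psd: "\<And>s. s \<in> S \<Longrightarrow> psd I (\<tau> s)" "\<And>s. s \<in> S \<Longrightarrow> \<tau> s \<in> ops I"
    and zero: "(\<lambda>i j. \<Sum>s\<in>S. \<tau> s i j) \<odot>\<^bsub>I\<^esub> Q = (\<lambda>_ _. 0)" and s: "s \<in> S"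
  shows "\<tau> s \<odot>\<^bsub>I\<^esub> Q = (\<lambda>_ _. 0)"
proof -
  have "(\<tau> s \<odot>\<^bsub>I\<^esub> Q) i j = 0" for i j
  proof -
    let ?v = "\<lambda>i. Q i j"
    have "(\<Sum>s\<in>S. quad I (\<tau> s) ?v) = (\<Sum>i\<in>I. cnj (?v i) * ((\<lambda>i j. \<Sum>s\<in>S. \<tau> s i j) \<odot>\<^bsub>I\<^esub> Q) i j)"
      unfolding quad_def mm_sum_left[symmetric]
      by (subst sum.swap) (simp add: mm_def sum_distrib_left mult.assoc)
    also have "\<dots> = 0" by (simp add: zero)
    finally have "(\<Sum>s\<in>S. quad I (\<tau> s) ?v) = 0" .
    then have "quad I (\<tau> s) ?v = 0"
      using s fin psd(1) by (subst (asm) sum_nonneg_eq_0_iff) (auto simp: psd_iff_quad)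
    then show ?thesis
      unfolding mm_def using psd_kernel[OF psd(1)[OF s] psd(2)[OF s] fin(1)] by blast
  qed
  then show ?thesis by blast
qed

text \<open>The range of a positive summand lies in the range of the sum, so an operator fixing the
  latter fixes the former; annihilation by the sum is applied to the identity minus
  \<open>P\<close>. It serves both the support projection of a reduced state and the range
  projection of an isometry.\<close>

lemma psd_sum_absorb:
  assumes fin: "finite I" "finite S" and psd: "\<And>s. s \<in> S \<Longrightarrow> psd I (\<tau> s)" "\<And>s. s \<in> S \<Longrightarrow> \<tau> s \<in> ops I"
    and P: "adj P = P" "P \<odot>\<^bsub>I\<^esub> (\<lambda>i j. \<Sum>s\<in>S. \<tau> s i j) = (\<lambda>i j. \<Sum>s\<in>S. \<tau> s i j)" and s: "s \<in> S"
  shows "P \<odot>\<^bsub>I\<^esub> \<tau> s = \<tau> s" "\<tau> s \<odot>\<^bsub>I\<^esub> P = \<tau> s"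
proof -
  let ?M = "\<lambda>i j. \<Sum>s\<in>S. \<tau> s i j"
  have herm: "adj (\<tau> s) = \<tau> s" if "s \<in> S" for s
    using psd_ops_hermitian[OF fin(1) psd(1)[OF that] psd(2)[OF that]] by (simp add: hermitian_def)
  have M: "adj ?M = ?M"
    using herm by (auto simp: adj_def fun_eq_iff)
  then have MP: "?M \<odot>\<^bsub>I\<^esub> P = ?M" using P by (metis adj_mm)
  have cs: "col_supp I ?M" "col_supp I (\<tau> s)"
    using psd(2) s by (auto simp: ops_iff_supp col_supp_def)
  define Q where "Q = (\<lambda>i j. one I i j - P i j)"
  have Q: "(A \<odot>\<^bsub>I\<^esub> Q) i j = A i j - (A \<odot>\<^bsub>I\<^esub> P) i j" if "col_supp I A" for A :: "'a \<Rightarrow> 'a \<Rightarrow> complex" and i j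
  proof -
    have "(A \<odot>\<^bsub>I\<^esub> Q) i j = (A \<odot>\<^bsub>I\<^esub> one I) i j - (A \<odot>\<^bsub>I\<^esub> P) i j"
      by (simp add: mm_def Q_def right_diff_distrib sum_subtractf)
    then show ?thesis using that fin by simp
  qed
  have "?M \<odot>\<^bsub>I\<^esub> Q = (\<lambda>_ _. 0)" by (intro ext) (simp only: Q[OF cs(1)] MP diff_self)
  then have "\<tau> s \<odot>\<^bsub>I\<^esub> Q = (\<lambda>_ _. 0)"
    using psd_sum_annihilate[of I S \<tau> Q s] fin psd s by blast
  then show "\<tau> s \<odot>\<^bsub>I\<^esub> P = \<tau> s" using Q[OF cs(2)] by (auto simp: fun_eq_iff)
  then show "P \<odot>\<^bsub>I\<^esub> \<tau> s = \<tau> s" using herm[OF s] P(1) by (metis adj_mm)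
qed

section \<open>Quantum operations on the last tensor factor\<close>

lemma ops_block: "\<rho> \<in> ops (X \<times> E) \<Longrightarrow> (\<lambda>e e'. \<rho> (x, e) (x', e')) \<in> ops E"
  by (auto simp: ops_def)

lemma on_snd_apply: "on_snd T \<rho> (x, f) (x', f') = T (\<lambda>e e'. \<rho> (x, e) (x', e')) f f'"
  by (simp add: on_snd_def)

text \<open>Complete positivity is stated for reference systems of the form \<open>{..<n}\<close>; it transfers along an
  enumeration of \<open>X\<close>.\<close>

lemma state_on_snd:
  fixes X :: "'x set" and E :: "'e set" and F :: "'f set"
  assumes T: "quantum_operation E F T" and \<rho>: "state (X \<times> E) \<rho>" and fin: "finite X"
  shows "state (X \<times> F) (on_snd T \<rho>)"
proof -
  have lin: "\<And>\<rho>. \<rho> \<in> ops E \<Longrightarrow> T \<rho> \<in> ops F" and scale: "\<And>c \<rho>. \<rho> \<in> ops E \<Longrightarrow> T (\<lambda>i j. c * \<rho> i j) = (\<lambda>i j. c * T \<rho> i j)"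
    and tp: "\<And>\<rho>. \<rho> \<in> ops E \<Longrightarrow> op_trace F (T \<rho>) = op_trace E \<rho>"
    and cp: "\<And>n \<rho>. \<rho> \<in> ops ({..<n::nat} \<times> E) \<Longrightarrow> psd ({..<n} \<times> E) \<rho> \<Longrightarrow> psd ({..<n} \<times> F) (on_snd T \<rho>)"
    using T by (auto simp: quantum_operation_def linear_map_def trace_preserving_def completely_positive_def)
  have ops: "\<rho> \<in> ops (X \<times> E)" and psd: "psd (X \<times> E) \<rho>" and tr: "op_trace (X \<times> E) \<rho> = 1"
    using \<rho> by (auto simp: state_def)
  have T0: "T (\<lambda>_ _. 0) = (\<lambda>_ _. 0)"
    using scale[of "\<lambda>_ _. 0" 0] by (simp add: ops_def)
  have "on_snd T \<rho> \<in> ops (X \<times> F)"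
    unfolding ops_def
  proof (intro CollectI allI impI)
    fix i j :: "'x \<times> 'f"
    assume *: "i \<notin> X \<times> F \<or> j \<notin> X \<times> F"
    obtain x f x' f' where ij: "i = (x, f)" "j = (x', f')" by fastforce
    show "on_snd T \<rho> i j = 0"
    proof (cases "x \<in> X \<and> x' \<in> X")
      case True
      then have "f \<notin> F \<or> f' \<notin> F" using * ij by auto
      then show ?thesis using lin[OF ops_block[OF ops]] by (auto simp: ij on_snd_apply ops_def)
    next
      case False
      then have "(\<lambda>e e'. \<rho> (x, e) (x', e')) = (\<lambda>_ _. 0)" using ops by (auto simp: ops_def)
      then show ?thesis by (simp add: ij on_snd_apply T0)
    qed
  qed
  moreover have "op_trace (X \<times> F) (on_snd T \<rho>) = 1"
  proof -
    have "op_trace (X \<times> F) (on_snd T \<rho>) = (\<Sum>x\<in>X. op_trace F (T (\<lambda>e e'. \<rho> (x, e) (x, e'))))"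
      by (simp add: op_trace_def sum.cartesian_product on_snd_def case_prod_beta)
    also have "\<dots> = op_trace (X \<times> E) \<rho>"
      unfolding tp[OF ops_block[OF ops]] by (simp add: op_trace_def sum.cartesian_product case_prod_beta)
    finally show ?thesis using tr by simp
  qed
  moreover have "psd (X \<times> F) (on_snd T \<rho>)"
  proof -
    define g where "g = from_nat_into X"
    let ?n = "card X"
    have g: "bij_betw g {..<?n} X"
      unfolding g_def using bij_betw_from_nat_into_finite[OF fin] .
    have bij: "bij_betw (\<lambda>(k, y). (g k, y)) ({..<?n} \<times> Y) (X \<times> Y)" for Y :: "'y set"
    proof -
      have "(\<lambda>(k, y). (g k, y)) = map_prod g (\<lambda>y. y)" by auto
      moreover have "inj_on (map_prod g (\<lambda>y. y)) ({..<?n} \<times> Y)"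
        using g by (intro map_prod_inj_on) (auto simp: bij_betw_def)
      moreover have "map_prod g (\<lambda>y. y) ` ({..<?n} \<times> Y) = X \<times> Y"
        using g by (intro map_prod_surj_on) (auto simp: bij_betw_def)
      ultimately show ?thesis unfolding bij_betw_def by metis
    qed
    \<comment> \<open>Cut off by hand: \<open>g\<close> is controlled on \<open>{..<?n}\<close>
      only, whereas \<open>cp\<close> asks for an operator that vanishes outside.\<close>
    define \<rho>' where "\<rho>' = (\<lambda>i j. if fst i < ?n \<and> fst j < ?n then \<rho> (g (fst i), snd i) (g (fst j), snd j) else 0)"
    have psd_cong: "psd I \<sigma> \<longleftrightarrow> psd I \<sigma>'" if "\<And>i j. i \<in> I \<Longrightarrow> j \<in> I \<Longrightarrow> \<sigma> i j = \<sigma>' i j" for I :: "'i set" and \<sigma> \<sigma>'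
      using that unfolding psd_def by (simp cong: sum.cong)
    have "psd ({..<?n} \<times> E) (\<lambda>i j. \<rho> (case i of (k, y) \<Rightarrow> (g k, y)) (case j of (k, y) \<Rightarrow> (g k, y)))"
      using psd psd_reindex[OF bij] by blast
    then have "psd ({..<?n} \<times> E) \<rho>'"
      by (rule iffD1[OF psd_cong, rotated]) (auto simp: \<rho>'_def)
    moreover have "\<rho>' \<in> ops ({..<?n} \<times> E)"
      using ops by (auto simp: ops_def \<rho>'_def)
    ultimately have "psd ({..<?n} \<times> F) (on_snd T \<rho>')" by (intro cp)
    then have "psd ({..<?n} \<times> F) (\<lambda>i j. on_snd T \<rho> (case i of (k, y) \<Rightarrow> (g k, y)) (case j of (k, y) \<Rightarrow> (g k, y)))"
      by (rule iffD1[OF psd_cong, rotated]) (auto simp: \<rho>'_def on_snd_apply)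
    then show ?thesis using psd_reindex[OF bij] by blast
  qed
  ultimately show ?thesis by (simp add: state_def)
qed

section \<open>Isometries on the last tensor factor\<close>

lemma state_isometry_congruence:
  assumes V: "row_supp J V" "col_supp I V" "adj V \<odot>\<^bsub>J\<^esub> V = one I" and \<rho>: "state I \<rho>" and fin: "finite I"
  shows "state J (V \<odot>\<^bsub>I\<^esub> \<rho> \<odot>\<^bsub>I\<^esub> adj V)"
proof -
  have "op_trace J (V \<odot>\<^bsub>I\<^esub> \<rho> \<odot>\<^bsub>I\<^esub> adj V) = op_trace I ((\<rho> \<odot>\<^bsub>I\<^esub> adj V) \<odot>\<^bsub>J\<^esub> V)"
    by (rule op_trace_mm_commute)
  also have "\<dots> = 1" using \<rho> fin by (simp add: V(3) state_def ops_iff_supp)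
  finally show ?thesis
    using V(1) \<rho> psd_congruence[of I \<rho> J "adj V"] by (simp add: state_def ops_iff_supp)
qed

text \<open>Mirror image of \<open>tensor_one\<close>, with the identity on the first factor,
  restricted to \<open>Z\<close> so that the support conditions hold.\<close>

definition id_tensor :: "'z set \<Rightarrow> ('g \<Rightarrow> 'e \<Rightarrow> complex) \<Rightarrow> 'z \<times> 'g \<Rightarrow> 'z \<times> 'e \<Rightarrow> complex" where
  "id_tensor Z W = (\<lambda>(z, g) (z', e). if z = z' \<and> z \<in> Z then W g e else 0)"

lemma id_tensor_apply: "id_tensor Z W (z, g) (z', e) = (if z = z' \<and> z \<in> Z then W g e else 0)"
  by (simp add: id_tensor_def)

lemma id_tensor_mm_apply:
  assumes "finite Z"
  shows "(id_tensor Z W \<odot>\<^bsub>Z \<times> E\<^esub> R) (z, g) j = (if z \<in> Z then \<Sum>e\<in>E. W g e * R (z, e) j else 0)"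
proof -
  have "(id_tensor Z W \<odot>\<^bsub>Z \<times> E\<^esub> R) (z, g) j = (\<Sum>y\<in>Z. \<Sum>e\<in>E. if y = z then W g e * R (z, e) j else 0)"
    unfolding mm_def sum.cartesian_product by (intro sum.cong) (auto simp: id_tensor_def)
  also have "\<dots> = (\<Sum>y\<in>Z. if y = z then \<Sum>e\<in>E. W g e * R (z, e) j else 0)"
    by (intro sum.cong) auto
  finally show ?thesis using assms by simp
qed

lemma id_tensor_isometry:
  assumes W: "isometry E G W" and fin: "finite Z"
  shows "row_supp (Z \<times> G) (id_tensor Z W)" "col_supp (Z \<times> E) (id_tensor Z W)"
    "adj (id_tensor Z W) \<odot>\<^bsub>Z \<times> G\<^esub> id_tensor Z W = one (Z \<times> E)"
proof -
  have 1: "\<And>g e. g \<notin> G \<or> e \<notin> E \<Longrightarrow> W g e = 0"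
    and 2: "\<And>e e'. e \<in> E \<Longrightarrow> e' \<in> E \<Longrightarrow> (\<Sum>k\<in>G. cnj (W k e) * W k e') = (if e = e' then 1 else 0)"
    using W by (auto simp: isometry_def)
  show "row_supp (Z \<times> G) (id_tensor Z W)" "col_supp (Z \<times> E) (id_tensor Z W)"
    using 1 by (auto simp: row_supp_def col_supp_def id_tensor_def)
  have a: "adj (id_tensor Z W) = id_tensor Z (adj W)"
    by (auto simp: adj_def id_tensor_def fun_eq_iff)
  have "(id_tensor Z (adj W) \<odot>\<^bsub>Z \<times> G\<^esub> id_tensor Z W) (z, e) (z', e') = one (Z \<times> E) (z, e) (z', e')" for z e z' e'
    using 1 2 by (cases "z = z'"; cases "z \<in> Z"; cases "e \<in> E"; cases "e' \<in> E") (auto simp: id_tensor_mm_apply[OF fin] id_tensor_apply diag_def adj_def)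
  then show "adj (id_tensor Z W) \<odot>\<^bsub>Z \<times> G\<^esub> id_tensor Z W = one (Z \<times> E)"
    unfolding a by (auto simp: fun_eq_iff)
qed

text \<open>Turns the blockwise action into a congruence, to which the matrix calculus
  applies.\<close>

lemma on_snd_isometry_map:
  assumes "\<rho> \<in> ops (Z \<times> E)" "finite Z"
  shows "on_snd (isometry_map E W) \<rho> = id_tensor Z W \<odot>\<^bsub>Z \<times> E\<^esub> \<rho> \<odot>\<^bsub>Z \<times> E\<^esub> adj (id_tensor Z W)"
proof -
  have R: "(\<rho> \<odot>\<^bsub>Z \<times> E\<^esub> adj (id_tensor Z W)) i (z', g') = (\<Sum>e'\<in>E. \<rho> i (z', e') * cnj (W g' e'))" for i z' g'
  proof -
    have "(\<rho> \<odot>\<^bsub>Z \<times> E\<^esub> adj (id_tensor Z W)) i (z', g') = (\<Sum>y\<in>Z. \<Sum>e\<in>E. if y = z' then \<rho> i (z', e) * cnj (W g' e) else 0)"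
      unfolding mm_def sum.cartesian_product by (intro sum.cong) (auto simp: id_tensor_def adj_def)
    also have "\<dots> = (\<Sum>y\<in>Z. if y = z' then \<Sum>e\<in>E. \<rho> i (z', e) * cnj (W g' e) else 0)"
      by (intro sum.cong) auto
    also have "\<dots> = (if z' \<in> Z then \<Sum>e\<in>E. \<rho> i (z', e) * cnj (W g' e) else 0)"
      using assms by simp
    finally show ?thesis using assms(1) by (cases i) (auto simp: ops_iff_supp col_supp_def)
  qed
  have "on_snd (isometry_map E W) \<rho> (z, g) (z', g')
    = (id_tensor Z W \<odot>\<^bsub>Z \<times> E\<^esub> \<rho> \<odot>\<^bsub>Z \<times> E\<^esub> adj (id_tensor Z W)) (z, g) (z', g')" for z g z' g'
    using assms by (auto simp: id_tensor_mm_apply R on_snd_apply isometry_map_def sum_distrib_left mult.assoc ops_def intro!: sum.neutral)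
  then show ?thesis by (auto simp: fun_eq_iff)
qed

lemma state_on_snd_isometry:
  assumes "isometry E G W" "state (Z \<times> E) \<rho>" "finite Z" "finite E"
  shows "state (Z \<times> G) (on_snd (isometry_map E W) \<rho>)"
proof -
  have "state (Z \<times> G) (id_tensor Z W \<odot>\<^bsub>Z \<times> E\<^esub> \<rho> \<odot>\<^bsub>Z \<times> E\<^esub> adj (id_tensor Z W))"
    using id_tensor_isometry[OF assms(1,3)] assms by (intro state_isometry_congruence) auto
  then show ?thesis using assms on_snd_isometry_map[of \<rho> Z E W] by (simp add: state_def)
qed

lemma quad_product:
  "quad (X \<times> Y) \<rho> v = (\<Sum>x\<in>X. \<Sum>y\<in>Y. \<Sum>x'\<in>X. \<Sum>y'\<in>Y. cnj (v (x, y)) * \<rho> (x, y) (x', y') * v (x', y'))"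
  by (simp only: quad_def sum.cartesian_product')

text \<open>A measurement with a classical outcome register. Both factors carry their indices in the
  same order, so the effects are the transposes of the \<open>N s\<close>; this absorbs the
  transposition of the steering formula and changes neither positivity nor completeness.\<close>

lemma quantum_operation_measurement:
  fixes E :: "'e set" and N :: "nat \<Rightarrow> 'e op"
  assumes fin: "finite E" "finite S" and N: "\<And>s. s \<in> S \<Longrightarrow> psd E (N s)" "\<And>s. s \<in> S \<Longrightarrow> N s \<in> ops E"
    and sum: "(\<lambda>e e'. \<Sum>s\<in>S. N s e e') = one E"
  shows "quantum_operation E S (\<lambda>\<eta>. diag S (\<lambda>s. \<Sum>e\<in>E. \<Sum>e'\<in>E. N s e e' * \<eta> e e'))"
proof -
  let ?T = "\<lambda>\<eta>. diag S (\<lambda>s. \<Sum>e\<in>E. \<Sum>e'\<in>E. N s e e' * \<eta> e e')"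
  have "linear_map E S ?T"
    by (auto simp: linear_map_def ops_def diag_def fun_eq_iff algebra_simps sum.distrib sum_distrib_left)
  moreover have "trace_preserving E S ?T"
  proof -
    have "op_trace S (?T \<eta>) = op_trace E \<eta>" for \<eta>
    proof -
      have "op_trace S (?T \<eta>) = (\<Sum>s\<in>S. \<Sum>e\<in>E. \<Sum>e'\<in>E. N s e e' * \<eta> e e')"
        by (simp add: op_trace_def diag_def)
      also have "\<dots> = (\<Sum>e\<in>E. \<Sum>e'\<in>E. (\<Sum>s\<in>S. N s e e') * \<eta> e e')"
        by (subst sum.swap, rule sum.cong[OF refl], subst sum.swap) (simp add: sum_distrib_right)
      also have "\<dots> = (\<Sum>e\<in>E. \<Sum>e'\<in>E. if e' = e then \<eta> e e else 0)"
        using fun_cong[OF fun_cong[OF sum]] by (intro sum.cong) (auto simp: diag_def)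
      finally show ?thesis using fin by (simp add: op_trace_def)
    qed
    then show ?thesis by (simp add: trace_preserving_def)
  qed
  moreover have "completely_positive E S ?T"
    unfolding completely_positive_def
  proof (intro allI ballI impI)
    fix n :: nat and \<rho> assume \<rho>: "psd ({..<n} \<times> E) \<rho>"
    have "on_snd ?T \<rho> = block S (\<lambda>s x x'. \<Sum>e\<in>E. \<Sum>e'\<in>E. N s e e' * \<rho> (x, e) (x', e'))"
      by (auto simp: on_snd_def block_def diag_def fun_eq_iff)
    moreover have "psd {..<n} (\<lambda>x x'. \<Sum>e\<in>E. \<Sum>e'\<in>E. N s e e' * \<rho> (x, e) (x', e'))" if s: "s \<in> S" for s
      unfolding psd_iff_quad
    proof
      fix v
      obtain m G where mG: "eigdec E E (N s) m G" and m: "\<And>j. j \<in> E \<Longrightarrow> 0 \<le> m j"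
        using psd_eigdec[OF fin(1) N(1)[OF s] N(2)[OF s]] by blast
      \<comment> \<open>Each rank-one part of the effect turns the form on the reference system into
        that of \<rho> at \<open>v\<close> tensored with the conjugate of an eigenvector; the
        weights \<open>m j\<close> are nonnegative.\<close>
      have Ns: "N s e e' = (\<Sum>j\<in>E. of_real (m j) * (G e j * cnj (G e' j)))" for e e'
        by (subst eigdecD(5)[OF mG], unfold mm_diag_mm[OF fin(1)]) (simp add: adj_def mult_ac)
      let ?t = "\<lambda>x x' e e' j. of_real (m j) * (cnj (v x * cnj (G e j)) * \<rho> (x, e) (x', e') * (v x' * cnj (G e' j)))"
      have "quad {..<n} (\<lambda>x x'. \<Sum>e\<in>E. \<Sum>e'\<in>E. N s e e' * \<rho> (x, e) (x', e')) v
        = (\<Sum>x<n. \<Sum>x'<n. \<Sum>e\<in>E. \<Sum>e'\<in>E. \<Sum>j\<in>E. ?t x x' e e' j)"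
        unfolding quad_def Ns by (simp add: sum_distrib_left sum_distrib_right mult_ac)
      also have "\<dots> = (\<Sum>x<n. \<Sum>x'<n. \<Sum>e\<in>E. \<Sum>j\<in>E. \<Sum>e'\<in>E. ?t x x' e e' j)"
        by (intro sum.cong refl sum.swap)
      also have "\<dots> = (\<Sum>x<n. \<Sum>x'<n. \<Sum>j\<in>E. \<Sum>e\<in>E. \<Sum>e'\<in>E. ?t x x' e e' j)"
        by (intro sum.cong refl sum.swap)
      also have "\<dots> = (\<Sum>x<n. \<Sum>j\<in>E. \<Sum>x'<n. \<Sum>e\<in>E. \<Sum>e'\<in>E. ?t x x' e e' j)"
        by (intro sum.cong refl sum.swap)
      also have "\<dots> = (\<Sum>j\<in>E. \<Sum>x<n. \<Sum>x'<n. \<Sum>e\<in>E. \<Sum>e'\<in>E. ?t x x' e e' j)"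
        by (rule sum.swap)
      also have "\<dots> = (\<Sum>j\<in>E. \<Sum>x<n. \<Sum>e\<in>E. \<Sum>x'<n. \<Sum>e'\<in>E. ?t x x' e e' j)"
        by (intro sum.cong refl sum.swap)
      also have "\<dots> = (\<Sum>j\<in>E. of_real (m j) * quad ({..<n} \<times> E) \<rho> (\<lambda>(x, e). v x * cnj (G e j)))"
        unfolding quad_product by (simp add: sum_distrib_left)
      finally show "0 \<le> quad {..<n} (\<lambda>x x'. \<Sum>e\<in>E. \<Sum>e'\<in>E. N s e e' * \<rho> (x, e) (x', e')) v"
        using \<rho> m by (auto simp: psd_iff_quad less_eq_complex_def intro!: sum_nonneg)
    qed
    ultimately show "psd ({..<n} \<times> S) (on_snd ?T \<rho>)"
      using fin by (simp add: psd_block)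
  qed
  ultimately show ?thesis by (simp add: quantum_operation_def)
qed

section \<open>Steering by measurements on a purifying system\<close>

lemma psd_one: "finite I \<Longrightarrow> psd I (one I)"
proof -
  assume fin: "finite I"
  then have "eigdec I I (one I) (\<lambda>_. 1) (one I)" by (simp add: eigdec_def)
  then show ?thesis using eigdec_psd(1) fin by fastforce
qed

text \<open>Functional calculus with \<open>inverse\<close>, where the convention
  \<open>inverse 0 = 0\<close> inverts on the support only. All conditions become scalar identities,
  and \<open>M \<odot> D\<close> is the projection onto the support of \<open>M\<close>.\<close>

lemma pseudo_inverse:
  assumes e: "eigdec I I M t U" and fin: "finite I"
  obtains D where "D \<in> ops I" "adj D = D" "M \<odot>\<^bsub>I\<^esub> D \<odot>\<^bsub>I\<^esub> M = M" "D \<odot>\<^bsub>I\<^esub> M \<odot>\<^bsub>I\<^esub> D = D"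
    "adj (M \<odot>\<^bsub>I\<^esub> D) = M \<odot>\<^bsub>I\<^esub> D"
proof -
  note E = eigdecD[OF e]
  define S where "S f = U \<odot>\<^bsub>I\<^esub> diag I (\<lambda>i. complex_of_real (f (t i))) \<odot>\<^bsub>I\<^esub> adj U" for f :: "real \<Rightarrow> real"
  have SS: "S f \<odot>\<^bsub>I\<^esub> S g = S (\<lambda>x. f x * g x)" for f g
  proof -
    let ?d = "\<lambda>f. diag I (\<lambda>i. complex_of_real (f (t i)))"
    have "S f \<odot>\<^bsub>I\<^esub> S g = U \<odot>\<^bsub>I\<^esub> (?d f \<odot>\<^bsub>I\<^esub> ?d g) \<odot>\<^bsub>I\<^esub> adj U"
      using fin by (simp add: S_def E(6))
    moreover have "?d f \<odot>\<^bsub>I\<^esub> ?d g = ?d (\<lambda>x. f x * g x)"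
      by (intro ext) (simp only: diag_mm_apply[OF fin], simp add: diag_def)
    ultimately show ?thesis by (simp only: S_def)
  qed
  have adjS: "adj (S f) = S f" for f by (simp add: S_def adj_diag)
  have M: "M = S (\<lambda>x. x)" unfolding S_def by (rule E(5))
  have eqs: "(\<lambda>x. x * (inverse x * x)) = (\<lambda>x::real. x)" "(\<lambda>x. inverse x * (x * inverse x)) = (inverse :: real \<Rightarrow> real)"
  proof -
    have "x * (inverse x * x) = x" for x :: real by (cases "x = 0") auto
    then show "(\<lambda>x. x * (inverse x * x)) = (\<lambda>x::real. x)" by (rule ext)
    have "inverse x * (x * inverse x) = inverse x" for x :: real by (cases "x = 0") auto
    then show "(\<lambda>x. inverse x * (x * inverse x)) = (inverse :: real \<Rightarrow> real)" by (rule ext)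
  qed
  define D where "D = S inverse"
  have "D \<in> ops I" using E(1) by (simp add: D_def S_def ops_iff_supp)
  moreover have "adj D = D" by (simp only: D_def adjS)
  moreover have "M \<odot>\<^bsub>I\<^esub> D \<odot>\<^bsub>I\<^esub> M = M" by (simp only: M D_def SS eqs)
  moreover have "D \<odot>\<^bsub>I\<^esub> M \<odot>\<^bsub>I\<^esub> D = D" by (simp only: M D_def SS eqs)
  moreover have "adj (M \<odot>\<^bsub>I\<^esub> D) = M \<odot>\<^bsub>I\<^esub> D" by (simp only: M D_def SS adjS)
  ultimately show ?thesis using that by blast
qed

text \<open>The Hughston--Jozsa--Wootters theorem: with \<open>M\<close> the reduced state of \<open>\<psi>\<close> on \<open>Y\<close> and
  \<open>D\<close> its pseudo-inverse, the measurement operators are \<open>\<psi>\<^sup>* D (\<tau> k) D \<psi>\<close>, completed by the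
  projection onto the complement of their sum.\<close>

lemma steering:
  fixes Y :: "'y set" and E :: "'e set" and \<tau> :: "nat \<Rightarrow> 'y op"
  assumes fin: "finite Y" "finite E" and n: "0 < n"
    and \<psi>: "\<And>i. i \<notin> Y \<times> E \<Longrightarrow> \<psi> i = 0"
    and \<tau>: "\<And>k. k < n \<Longrightarrow> psd Y (\<tau> k)" "\<And>k. k < n \<Longrightarrow> \<tau> k \<in> ops Y"
    and sum: "(\<lambda>i j. \<Sum>k<n. \<tau> k i j) = tr_snd E (pure \<psi>)"
  obtains T where "quantum_operation E {..<n} T" "on_snd T (pure \<psi>) = block {..<n} \<tau>"
proof -
  \<comment> \<open>The amplitudes as a matrix with rows in \<open>Y\<close> and columns in
    \<open>E\<close>; the reduced operator is \<open>\<Psi>\<close> times its adjoint.\<close>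
  define \<Psi> where "\<Psi> y e = \<psi> (y, e)" for y e
  have supp: "row_supp Y \<Psi>" "col_supp E \<Psi>"
    using \<psi> by (auto simp: \<Psi>_def row_supp_def col_supp_def)
  define M where "M = tr_snd E (pure \<psi>)"
  have M: "M = \<Psi> \<odot>\<^bsub>E\<^esub> adj \<Psi>"
    by (auto simp: M_def tr_snd_def pure_def mm_def adj_def \<Psi>_def)
  have "psd Y M"
    using psd_congruence[OF psd_one[OF fin(2)], of Y "adj \<Psi>"] supp fin by (simp add: M)
  moreover have "M \<in> ops Y" using supp by (simp add: M ops_iff_supp)
  ultimately obtain t U where "eigdec Y Y M t U" using psd_eigdec[OF fin(1)] by blast
  from pseudo_inverse[OF this fin(1)] obtain D where D: "D \<in> ops Y" "adj D = D" "M \<odot>\<^bsub>Y\<^esub> D \<odot>\<^bsub>Y\<^esub> M = M"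
    "D \<odot>\<^bsub>Y\<^esub> M \<odot>\<^bsub>Y\<^esub> D = D" "adj (M \<odot>\<^bsub>Y\<^esub> D) = M \<odot>\<^bsub>Y\<^esub> D" .
  have sum': "(\<lambda>i j. \<Sum>k<n. \<tau> k i j) = M" using sum by (simp add: M_def)
  \<comment> \<open>As the support projection of \<open>M\<close>, \<open>M \<odot> D\<close> is
    absorbed by every positive summand of \<open>M\<close>.\<close>
  have absorb: "(M \<odot>\<^bsub>Y\<^esub> D) \<odot>\<^bsub>Y\<^esub> \<tau> k = \<tau> k" "\<tau> k \<odot>\<^bsub>Y\<^esub> (M \<odot>\<^bsub>Y\<^esub> D) = \<tau> k" if "k < n" for k
    using psd_sum_absorb[of Y "{..<n}" \<tau> "M \<odot>\<^bsub>Y\<^esub> D" k] fin \<tau> D(3,5) sum' that by auto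
  have DM: "D \<odot>\<^bsub>Y\<^esub> M = M \<odot>\<^bsub>Y\<^esub> D"
  proof -
    have "adj M = M" by (simp add: M)
    then show ?thesis using D(2,5) by simp
  qed
  define V where "V = D \<odot>\<^bsub>Y\<^esub> \<Psi>"
  \<comment> \<open>\<open>Q\<close> is the sum of the
    \<open>adj V \<odot> \<tau> k \<odot> V\<close> and the projection onto the range of
    \<open>adj \<Psi>\<close>.\<close>
  define Q where "Q = adj \<Psi> \<odot>\<^bsub>Y\<^esub> D \<odot>\<^bsub>Y\<^esub> \<Psi>"
  have Qsupp: "row_supp E Q" "col_supp E Q" using supp by (simp_all add: Q_def)
  have Qadj: "adj Q = Q" by (simp add: Q_def D(2))
  have QQ: "Q \<odot>\<^bsub>E\<^esub> Q = Q"
  proof -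
    have "Q \<odot>\<^bsub>E\<^esub> Q = adj \<Psi> \<odot>\<^bsub>Y\<^esub> (D \<odot>\<^bsub>Y\<^esub> (\<Psi> \<odot>\<^bsub>E\<^esub> adj \<Psi>) \<odot>\<^bsub>Y\<^esub> D) \<odot>\<^bsub>Y\<^esub> \<Psi>"
      by (simp add: Q_def)
    also have "\<dots> = Q" unfolding M[symmetric] D(4) Q_def ..
    finally show ?thesis .
  qed
  define R where "R = (\<lambda>e e'. one E e e' - Q e e')"
  have RA: "(R \<odot>\<^bsub>E\<^esub> A) i j = (one E \<odot>\<^bsub>E\<^esub> A) i j - (Q \<odot>\<^bsub>E\<^esub> A) i j" for A :: "'e \<Rightarrow> 'c \<Rightarrow> complex" and i j
    by (simp add: R_def mm_def left_diff_distrib sum_subtractf)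
  have AR: "(A \<odot>\<^bsub>E\<^esub> R) i j = (A \<odot>\<^bsub>E\<^esub> one E) i j - (A \<odot>\<^bsub>E\<^esub> Q) i j" for A :: "'c \<Rightarrow> 'e \<Rightarrow> complex" and i j
    by (simp add: R_def mm_def right_diff_distrib sum_subtractf)
  have Rsupp: "row_supp E R" "col_supp E R"
    using Qsupp by (auto simp: R_def row_supp_def col_supp_def diag_def)
  have QR: "(Q \<odot>\<^bsub>E\<^esub> R) i j = 0" for i j
    using fin Qsupp by (simp add: AR QQ)
  have RR: "R \<odot>\<^bsub>E\<^esub> R = R"
    using fin Rsupp by (intro ext) (simp add: RA QR)
  have Radj: "adj R = R"
    using Qadj by (auto simp: R_def adj_def diag_def fun_eq_iff)
  have Rpsd: "psd E R"
    using psd_congruence[OF psd_one[OF fin(2)], of E R] fin Rsupp by (simp add: Radj RR)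
  have \<Psi>R: "\<Psi> \<odot>\<^bsub>E\<^esub> R \<odot>\<^bsub>E\<^esub> adj \<Psi> = (\<lambda>_ _. 0)"
  proof -
    have "\<Psi> \<odot>\<^bsub>E\<^esub> Q = (\<Psi> \<odot>\<^bsub>E\<^esub> adj \<Psi>) \<odot>\<^bsub>Y\<^esub> D \<odot>\<^bsub>Y\<^esub> \<Psi>" by (simp add: Q_def)
    then have "(\<Psi> \<odot>\<^bsub>E\<^esub> Q) \<odot>\<^bsub>E\<^esub> adj \<Psi> = M \<odot>\<^bsub>Y\<^esub> D \<odot>\<^bsub>Y\<^esub> M"
      by (simp add: M)
    then have "\<Psi> \<odot>\<^bsub>E\<^esub> Q \<odot>\<^bsub>E\<^esub> adj \<Psi> = M" by (simp add: D(3))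
    moreover have "\<Psi> \<odot>\<^bsub>E\<^esub> R \<odot>\<^bsub>E\<^esub> adj \<Psi> = (\<lambda>i j. (\<Psi> \<odot>\<^bsub>E\<^esub> adj \<Psi>) i j - (\<Psi> \<odot>\<^bsub>E\<^esub> Q \<odot>\<^bsub>E\<^esub> adj \<Psi>) i j)"
    proof (intro ext)
      fix i j
      have "(\<Psi> \<odot>\<^bsub>E\<^esub> R \<odot>\<^bsub>E\<^esub> adj \<Psi>) i j = (\<Sum>e\<in>E. \<Psi> i e * (adj \<Psi> e j - (Q \<odot>\<^bsub>E\<^esub> adj \<Psi>) e j))"
        using fin supp by (subst mm_def) (simp add: RA)
      then show "(\<Psi> \<odot>\<^bsub>E\<^esub> R \<odot>\<^bsub>E\<^esub> adj \<Psi>) i j = (\<Psi> \<odot>\<^bsub>E\<^esub> adj \<Psi>) i j - (\<Psi> \<odot>\<^bsub>E\<^esub> Q \<odot>\<^bsub>E\<^esub> adj \<Psi>) i j"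
        by (simp add: mm_def[of \<Psi>] right_diff_distrib sum_subtractf)
    qed
    ultimately show ?thesis by (simp add: M)
  qed
  \<comment> \<open>The remainder \<open>R\<close> goes to outcome 0, where it is invisible because
    \<open>\<Psi> \<odot> R \<odot> adj \<Psi>\<close> vanishes.\<close>
  define N where "N k = (\<lambda>e e'. (adj V \<odot>\<^bsub>Y\<^esub> \<tau> k \<odot>\<^bsub>Y\<^esub> V) e e' + (if k = 0 then R e e' else 0))" for k
  have Vsupp: "col_supp E V" using supp by (simp add: V_def)
  have N1: "psd E (N k)" if "k < n" for k
  proof -
    have "quad E (N k) v = quad E (adj V \<odot>\<^bsub>Y\<^esub> \<tau> k \<odot>\<^bsub>Y\<^esub> V) v + (if k = 0 then quad E R v else 0)" for v
      by (simp add: quad_def N_def distrib_left distrib_right sum.distrib)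
    moreover have "psd E (adj V \<odot>\<^bsub>Y\<^esub> \<tau> k \<odot>\<^bsub>Y\<^esub> V)" by (rule psd_congruence[OF \<tau>(1)[OF that]])
    ultimately show ?thesis using Rpsd by (simp add: psd_iff_quad)
  qed
  have N2: "N k \<in> ops E" for k
  proof -
    have "row_supp E (adj V \<odot>\<^bsub>Y\<^esub> \<tau> k \<odot>\<^bsub>Y\<^esub> V)" "col_supp E (adj V \<odot>\<^bsub>Y\<^esub> \<tau> k \<odot>\<^bsub>Y\<^esub> V)"
      using Vsupp by simp_all
    then show ?thesis using Rsupp by (auto simp: ops_iff_supp N_def row_supp_def col_supp_def)
  qed
  have "adj V \<odot>\<^bsub>Y\<^esub> M \<odot>\<^bsub>Y\<^esub> V = adj \<Psi> \<odot>\<^bsub>Y\<^esub> (D \<odot>\<^bsub>Y\<^esub> M \<odot>\<^bsub>Y\<^esub> D) \<odot>\<^bsub>Y\<^esub> \<Psi>"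
    by (simp add: V_def D(2))
  then have "(\<lambda>i j. \<Sum>k<n. (adj V \<odot>\<^bsub>Y\<^esub> \<tau> k \<odot>\<^bsub>Y\<^esub> V) i j) = Q"
    unfolding D(4) Q_def[symmetric] mm_sum_right mm_sum_left sum' .
  then have "(\<Sum>k<n. (adj V \<odot>\<^bsub>Y\<^esub> \<tau> k \<odot>\<^bsub>Y\<^esub> V) e e') = Q e e'" for e e'
    by (simp add: fun_eq_iff)
  then have N3: "(\<lambda>e e'. \<Sum>k<n. N k e e') = one E"
    using n by (simp add: N_def sum.distrib R_def)
  let ?T = "\<lambda>\<eta>. diag {..<n} (\<lambda>k. \<Sum>e\<in>E. \<Sum>e'\<in>E. N k e e' * \<eta> e e')"
  have "quantum_operation E {..<n} ?T"
    by (rule quantum_operation_measurement) (use fin N1 N2 N3 in auto)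
  moreover have "on_snd ?T (pure \<psi>) = block {..<n} \<tau>"
  proof -
    have "(\<Sum>e\<in>E. \<Sum>e'\<in>E. N k e e' * (\<psi> (y, e) * cnj (\<psi> (y', e')))) = \<tau> k y y'" if k: "k < n" for k y y'
    proof -
      have "\<Psi> \<odot>\<^bsub>E\<^esub> adj V = M \<odot>\<^bsub>Y\<^esub> D" by (simp add: V_def D(2) M)
      moreover have "V \<odot>\<^bsub>E\<^esub> adj \<Psi> = M \<odot>\<^bsub>Y\<^esub> D" by (simp add: V_def M[symmetric] DM)
      moreover have "\<Psi> \<odot>\<^bsub>E\<^esub> (adj V \<odot>\<^bsub>Y\<^esub> \<tau> k \<odot>\<^bsub>Y\<^esub> V) \<odot>\<^bsub>E\<^esub> adj \<Psi> = (\<Psi> \<odot>\<^bsub>E\<^esub> adj V) \<odot>\<^bsub>Y\<^esub> \<tau> k \<odot>\<^bsub>Y\<^esub> (V \<odot>\<^bsub>E\<^esub> adj \<Psi>)"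
        by simp
      ultimately have 1: "\<Psi> \<odot>\<^bsub>E\<^esub> (adj V \<odot>\<^bsub>Y\<^esub> \<tau> k \<odot>\<^bsub>Y\<^esub> V) \<odot>\<^bsub>E\<^esub> adj \<Psi> = \<tau> k"
        using absorb[OF k] by (simp only:)
      \<comment> \<open>By the index convention of the measurement, the unnormalized state left on
        \<open>Y\<close> is a product of matrices in which nothing is transposed.\<close>
      have expand: "(\<Sum>e\<in>E. \<Sum>e'\<in>E. A e e' * (\<psi> (y, e) * cnj (\<psi> (y', e')))) = (\<Psi> \<odot>\<^bsub>E\<^esub> A \<odot>\<^bsub>E\<^esub> adj \<Psi>) y y'" for A
        by (simp add: mm_def adj_def \<Psi>_def sum_distrib_left mult_ac)
      have "(\<Sum>e\<in>E. \<Sum>e'\<in>E. N k e e' * (\<psi> (y, e) * cnj (\<psi> (y', e'))))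
        = (\<Sum>e\<in>E. \<Sum>e'\<in>E. (adj V \<odot>\<^bsub>Y\<^esub> \<tau> k \<odot>\<^bsub>Y\<^esub> V) e e' * (\<psi> (y, e) * cnj (\<psi> (y', e'))))
        + (if k = 0 then \<Sum>e\<in>E. \<Sum>e'\<in>E. R e e' * (\<psi> (y, e) * cnj (\<psi> (y', e'))) else 0)"
        by (simp add: N_def distrib_right sum.distrib)
      then show ?thesis unfolding expand 1 \<Psi>R by simp
    qed
    then show ?thesis
      by (auto simp: on_snd_def block_def diag_def pure_def fun_eq_iff)
  qed
  ultimately show ?thesis using that by blast
qed

lemma extension_state: "extension I S \<rho> \<omega> \<Longrightarrow> state (I \<times> S) \<omega>"
  by (simp add: extension_def)

section \<open>The five functions\<close>

lemma state_regroup: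
  assumes "state (((A \<times> B) \<times> E) \<times> (G \<times> H)) \<rho>"
  shows "state (((A \<times> G) \<times> (B \<times> H)) \<times> E) (regroup \<rho>)"
proof -
  let ?h = "\<lambda>(((a, g), (b, h)), e). (((a, b), e), (g, h))"
  have "state (((A \<times> G) \<times> (B \<times> H)) \<times> E) (\<lambda>i j. \<rho> (?h i) (?h j))"
    by (rule state_reindex[OF assms]) (auto simp: bij_betw_def inj_on_def image_iff)
  moreover have "(\<lambda>i j. \<rho> (?h i) (?h j)) = regroup \<rho>"
    by (auto simp: regroup_def fun_eq_iff)
  ultimately show ?thesis by simp
qed

lemma state_pure:
  assumes "purification I F \<rho> \<phi>" "state I \<rho>"
  shows "state (I \<times> F) (pure \<phi>)"
proof -
  have "quad (I \<times> F) (pure \<phi>) v = (\<Sum>i\<in>I \<times> F. cnj (v i) * \<phi> i) * cnj (\<Sum>i\<in>I \<times> F. cnj (v i) * \<phi> i)" for v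
    by (simp add: quad_def pure_def sum_product mult_ac)
  also have "\<dots> v = of_real ((cmod (\<Sum>i\<in>I \<times> F. cnj (v i) * \<phi> i))\<^sup>2)" for v
    by (simp only: complex_norm_square)
  finally have "psd (I \<times> F) (pure \<phi>)"
    by (simp add: psd_iff_quad less_eq_complex_def del: of_real_power)
  moreover have "op_trace (I \<times> F) (pure \<phi>) = 1"
    using assms op_trace_tr_snd[of I F "pure \<phi>"] by (simp add: purification_def state_def)
  ultimately show ?thesis
    using assms by (auto simp: state_def ops_def pure_def purification_def)
qed

text \<open>A one-dimensional auxiliary system; it keeps the inner infimum of
  \<open>J_down_star\<close> from ranging over the empty set.\<close>

lemma extension_exists:
  assumes "state I \<rho>"
  shows "extension I {..<1::nat} \<rho> (block {..<1} (\<lambda>_. \<rho>))"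
  by (rule extension_block) (use assms in \<open>auto simp: state_def\<close>)

text \<open>The measurement with a single outcome; it inhabits the inner set of
  \<open>J_down\<close>.\<close>

lemma quantum_operation_exists:
  assumes "finite E"
  obtains T where "quantum_operation E {..<1::nat} T"
  using quantum_operation_measurement[of E "{..<1::nat}" "\<lambda>_. one E"] assms psd_one[OF assms]
  by (auto simp: ops_iff_supp)

lemma Inf_eq_zero: "(0::real) \<in> S \<Longrightarrow> (\<And>x. x \<in> S \<Longrightarrow> 0 \<le> x) \<Longrightarrow> Inf S = 0"
  by (rule cInf_eq_minimum)

text \<open>For V = 1 \<otimes> W the range projection \<open>V \<odot> adj V\<close> fixes the sum
  of the \<open>\<tau> k\<close> and hence each of them, so
  \<open>adj V \<odot> \<tau> k \<odot> V\<close> is mapped back to \<open>\<tau> k\<close> exactly.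
  \<open>swap_last\<close> puts \<open>E\<close> at the end, where the isometry acts.\<close>

lemma isometry_flag_extension:
  fixes Z :: "'z set" and E :: "'e set" and \<tau> :: "nat \<Rightarrow> ('z \<times> 'g) op"
  assumes W: "isometry E G W" and \<rho>: "state (Z \<times> E) \<rho>" and fin: "finite Z" "finite E" "finite G"
    and \<tau>: "\<And>k. k < n \<Longrightarrow> psd (Z \<times> G) (\<tau> k)" "\<And>k. k < n \<Longrightarrow> \<tau> k \<in> ops (Z \<times> G)"
    and sum: "(\<lambda>i j. \<Sum>k<n. \<tau> k i j) = on_snd (isometry_map E W) \<rho>"
  obtains \<omega> where "extension (Z \<times> E) {..<n} \<rho> \<omega>"
    "on_snd (isometry_map E W) (swap_last \<omega>) = swap_last (block {..<n} \<tau>)"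
proof -
  let ?I = "Z \<times> E" and ?J = "Z \<times> G"
  define V where "V = id_tensor Z W"
  have V: "row_supp ?J V" "col_supp ?I V" "adj V \<odot>\<^bsub>?J\<^esub> V = one ?I"
    unfolding V_def by (rule id_tensor_isometry[OF W fin(1)])+
  have finI: "finite ?I" "finite ?J" using fin by auto
  have \<rho>ops: "\<rho> \<in> ops ?I" using \<rho> by (simp add: state_def)
  have VV: "adj V \<odot>\<^bsub>?J\<^esub> V \<odot>\<^bsub>?I\<^esub> A = A" if "row_supp ?I A" for A :: "'z \<times> 'e \<Rightarrow> 'c \<Rightarrow> complex"
    using V(3) finI that by (metis mm_assoc one_mm)
  have M: "(\<lambda>i j. \<Sum>k<n. \<tau> k i j) = V \<odot>\<^bsub>?I\<^esub> \<rho> \<odot>\<^bsub>?I\<^esub> adj V"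
    unfolding sum V_def by (rule on_snd_isometry_map[OF \<rho>ops fin(1)])
  let ?P = "V \<odot>\<^bsub>?I\<^esub> adj V"
  have "?P \<odot>\<^bsub>?J\<^esub> (\<lambda>i j. \<Sum>k<n. \<tau> k i j) = (\<lambda>i j. \<Sum>k<n. \<tau> k i j)"
    unfolding M using \<rho>ops by (simp add: VV ops_iff_supp)
  then have absorb: "?P \<odot>\<^bsub>?J\<^esub> \<tau> k = \<tau> k" "\<tau> k \<odot>\<^bsub>?J\<^esub> ?P = \<tau> k" if "k < n" for k
    using psd_sum_absorb[of ?J "{..<n}" \<tau> ?P k] finI \<tau> that by auto
  define \<kappa> where "\<kappa> k = adj V \<odot>\<^bsub>?J\<^esub> \<tau> k \<odot>\<^bsub>?J\<^esub> V" for k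
  have \<kappa>ops: "\<kappa> k \<in> ops ?I" for k using V(2) by (simp add: \<kappa>_def ops_iff_supp)
  have "(\<lambda>i j. \<Sum>k<n. \<kappa> k i j) = \<rho>"
    unfolding \<kappa>_def mm_sum_right mm_sum_left M using \<rho>ops finI by (simp add: VV V(3) ops_iff_supp)
  then have "extension ?I {..<n} \<rho> (block {..<n} \<kappa>)"
    using \<rho> \<kappa>ops \<tau>(1) by (intro extension_block) (auto simp: \<kappa>_def intro: psd_congruence)
  moreover have "on_snd (isometry_map E W) (swap_last (block {..<n} \<kappa>)) = swap_last (block {..<n} \<tau>)"
  proof -
    have "on_snd (isometry_map E W) (\<kappa> k) = \<tau> k" if "k < n" for k
    proof -
      have "on_snd (isometry_map E W) (\<kappa> k) = V \<odot>\<^bsub>?I\<^esub> \<kappa> k \<odot>\<^bsub>?I\<^esub> adj V"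
        unfolding V_def by (rule on_snd_isometry_map[OF \<kappa>ops fin(1)])
      also have "\<dots> = ?P \<odot>\<^bsub>?J\<^esub> (\<tau> k \<odot>\<^bsub>?J\<^esub> ?P)" by (simp add: \<kappa>_def)
      finally show ?thesis using absorb[OF that] by (simp only:)
    qed
    then have "isometry_map E W (\<lambda>e e'. \<kappa> k (z, e) (z', e')) g g' = \<tau> k (z, g) (z', g')" if "k < n" for k z z' g g'
      using that by (metis on_snd_apply)
    then show ?thesis
      by (auto simp: fun_eq_iff on_snd_apply swap_last_def block_def isometry_map_def intro!: sum.neutral)
  qed
  ultimately show ?thesis using that by blast
qed

theorem mainTheorem7:
  fixes A :: "'a set" and B :: "'b set" and E :: "'e set"
  assumes "finite A" and "finite B" and "finite E"
  shows "(\<forall>\<rho>\<in>S_I_star A B E. I_down_star A B E \<rho> = 0) \<and>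
         (\<forall>\<rho>\<in>S_I A B E. I_down A B E \<rho> = 0) \<and>
         (\<forall>\<rho>\<in>S_sep A B E. I_sq A B E \<rho> = 0) \<and>
         (\<forall>\<rho>\<in>S_J_star A B E. J_down_star A B E \<rho> = 0) \<and>
         (\<forall>\<rho>\<in>S_J A B E. J_down A B E \<rho> = 0)"
proof (intro conjI ballI)
  note fin = assms
  fix \<rho> assume "\<rho> \<in> S_I_star A B E"
  then obtain n :: nat and \<omega> where \<omega>: "extension ((A \<times> B) \<times> E) {..<n} \<rho> \<omega>" "cmi A B {..<n} (tr_snd E (swap_last \<omega>)) = 0"
    by (auto simp: S_I_star_def markov_states_def)
  show "I_down_star A B E \<rho> = 0"
    unfolding I_down_star_def
  proof (rule Inf_eq_zero)
    show "0 \<in> {cmi A B {..<n} (tr_snd E (swap_last \<omega>)) | (n::nat) \<omega>. extension ((A \<times> B) \<times> E) {..<n} \<rho> \<omega>}"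
      using \<omega> by force
  next
    fix x assume "x \<in> {cmi A B {..<n} (tr_snd E (swap_last \<omega>)) | (n::nat) \<omega>. extension ((A \<times> B) \<times> E) {..<n} \<rho> \<omega>}"
    then obtain n :: nat and \<omega> where x: "x = cmi A B {..<n} (tr_snd E (swap_last \<omega>))" and "extension ((A \<times> B) \<times> E) {..<n} \<rho> \<omega>"
      by blast
    then have "state ((A \<times> B) \<times> {..<n}) (tr_snd E (swap_last \<omega>))"
      using fin by (intro state_tr_snd state_swap_last extension_state)
    then show "0 \<le> x" unfolding x using fin by (intro strong_subadditivity) auto
  qed
next
  note fin = assms
  have finAB: "finite (A \<times> B)" using fin by simp
  fix \<rho> assume \<rho>: "\<rho> \<in> S_I A B E"
  then have st: "state ((A \<times> B) \<times> E) \<rho>" by (simp add: S_I_def S_all_def)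
  obtain n :: nat and T where T: "quantum_operation E {..<n} T" "cmi A B {..<n} (on_snd T \<rho>) = 0"
    using \<rho> by (auto simp: S_I_def markov_states_def)
  show "I_down A B E \<rho> = 0"
    unfolding I_down_def
  proof (rule Inf_eq_zero)
    show "0 \<in> {cmi A B {..<n} (on_snd T \<rho>) | (n::nat) T. quantum_operation E {..<n} T}"
      using T by force
  next
    fix x assume "x \<in> {cmi A B {..<n} (on_snd T \<rho>) | (n::nat) T. quantum_operation E {..<n} T}"
    then obtain n :: nat and T where x: "x = cmi A B {..<n} (on_snd T \<rho>)" and "quantum_operation E {..<n} T"
      by blast
    then have "state ((A \<times> B) \<times> {..<n}) (on_snd T \<rho>)"
      using st finAB by (intro state_on_snd)
    then show "0 \<le> x" unfolding x using fin by (intro strong_subadditivity) auto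
  qed
next
  note fin = assms
  fix \<rho> assume \<rho>: "\<rho> \<in> S_sep A B E"
  then have st: "state (A \<times> B) (tr_snd E \<rho>)"
    using fin by (auto simp: S_sep_def S_all_def intro: state_tr_snd)
  have "tr_snd E \<rho> \<in> sep_states A B" using \<rho> by (simp add: S_sep_def)
  then obtain n :: nat and \<tau> where \<tau>: "\<And>k. k < n \<Longrightarrow> psd (A \<times> B) (\<tau> k)" "\<And>k. k < n \<Longrightarrow> \<tau> k \<in> ops (A \<times> B)"
    "(\<lambda>i j. \<Sum>k<n. \<tau> k i j) = tr_snd E \<rho>" "cmi A B {..<n} (block {..<n} \<tau>) = 0"
    by (rule sep_states_flag[OF fin(1,2)]) blast
  have "Inf {cmi A B {..<n} \<omega> | (n::nat) \<omega>. extension (A \<times> B) {..<n} (tr_snd E \<rho>) \<omega>} = 0"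
  proof (rule Inf_eq_zero)
    have "extension (A \<times> B) {..<n} (tr_snd E \<rho>) (block {..<n} \<tau>)"
      using \<tau> st by (intro extension_block) auto
    then show "0 \<in> {cmi A B {..<n} \<omega> | (n::nat) \<omega>. extension (A \<times> B) {..<n} (tr_snd E \<rho>) \<omega>}"
      using \<tau>(4) by force
  next
    fix x assume "x \<in> {cmi A B {..<n} \<omega> | (n::nat) \<omega>. extension (A \<times> B) {..<n} (tr_snd E \<rho>) \<omega>}"
    then show "0 \<le> x" using fin by (auto intro!: strong_subadditivity extension_state)
  qed
  then show "I_sq A B E \<rho> = 0" by (simp add: I_sq_def E_sq_def)
next
  note fin = assms
  have finAB: "finite (A \<times> B)" using fin by simp
  fix \<rho> assume \<rho>: "\<rho> \<in> S_J_star A B E"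
  then have st: "state ((A \<times> B) \<times> E) \<rho>" by (simp add: S_J_star_def S_all_def)
  let ?C = "\<lambda>m n W. {cmi (A \<times> {..<m}) (B \<times> {..<n}) {..<k} (regroup (on_snd (isometry_map E W) (swap_last \<omega>))) | (k::nat) \<omega>.
                 extension ((A \<times> B) \<times> E) {..<k} \<rho> \<omega>}"
  have nonneg: "0 \<le> x" if mem: "x \<in> ?C m n W" and iso: "isometry E ({..<m} \<times> {..<n}) W" for x and m n :: nat and W
  proof -
    obtain k :: nat and \<omega> where x: "x = cmi (A \<times> {..<m}) (B \<times> {..<n}) {..<k} (regroup (on_snd (isometry_map E W) (swap_last \<omega>)))"
      and "extension ((A \<times> B) \<times> E) {..<k} \<rho> \<omega>" using mem by blast
    then have "state (((A \<times> {..<m}) \<times> (B \<times> {..<n})) \<times> {..<k}) (regroup (on_snd (isometry_map E W) (swap_last \<omega>)))"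
      using iso fin by (intro state_regroup state_on_snd_isometry state_swap_last extension_state) auto
    then show ?thesis unfolding x using fin by (intro strong_subadditivity) auto
  qed
  \<comment> \<open>Nonemptiness bounds the inner infimum from below at every isometry, not only at
    the witness.\<close>
  have "?C m n W \<noteq> {}" for m n :: nat and W using extension_exists[OF st] by blast
  then have nonneg_Inf: "0 \<le> Inf (?C m n W)" if "isometry E ({..<m} \<times> {..<n}) W" for m n :: nat and W
    using nonneg[OF _ that] by (rule cInf_greatest)
  obtain m n :: nat and W where W: "isometry E ({..<m} \<times> {..<n}) W"
    and sep: "regroup2 (on_snd (isometry_map E W) \<rho>) \<in> sep_states (A \<times> {..<m}) (B \<times> {..<n})"
    using \<rho> by (auto simp: S_J_star_def)
  obtain N :: nat and \<tau> where \<tau>: "\<And>k. k < N \<Longrightarrow> psd ((A \<times> {..<m}) \<times> (B \<times> {..<n})) (\<tau> k)"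
    "\<And>k. k < N \<Longrightarrow> \<tau> k \<in> ops ((A \<times> {..<m}) \<times> (B \<times> {..<n}))"
    "(\<lambda>i j. \<Sum>k<N. \<tau> k i j) = regroup2 (on_snd (isometry_map E W) \<rho>)"
    "cmi (A \<times> {..<m}) (B \<times> {..<n}) {..<N} (block {..<N} \<tau>) = 0"
    by (rule sep_states_flag[OF _ _ sep]) (use fin in auto)
  \<comment> \<open>Separability refers to the order (AG)(BH), the isometry produces (AB)(GH);
    \<open>\<tau>'\<close> writes the summands in the latter order.\<close>
  let ?h = "\<lambda>((a, b), (g, h)). ((a, g), (b, h))"
  have h: "bij_betw ?h ((A \<times> B) \<times> ({..<m} \<times> {..<n})) ((A \<times> {..<m}) \<times> (B \<times> {..<n}))"
    by (auto simp: bij_betw_def inj_on_def image_iff)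
  define \<tau>' where "\<tau>' k = (\<lambda>i j. \<tau> k (?h i) (?h j))" for k
  obtain \<omega> where \<omega>: "extension ((A \<times> B) \<times> E) {..<N} \<rho> \<omega>"
    "on_snd (isometry_map E W) (swap_last \<omega>) = swap_last (block {..<N} \<tau>')"
  proof (rule isometry_flag_extension[OF W st finAB fin(3)])
    show "psd ((A \<times> B) \<times> ({..<m} \<times> {..<n})) (\<tau>' k)" if "k < N" for k
      unfolding \<tau>'_def psd_reindex[OF h] by (rule \<tau>(1)[OF that])
    show "\<tau>' k \<in> ops ((A \<times> B) \<times> ({..<m} \<times> {..<n}))" if "k < N" for k
      using \<tau>(2)[OF that] by (auto simp: \<tau>'_def ops_def)
    have "(\<Sum>k<N. \<tau>' k i j) = regroup2 (on_snd (isometry_map E W) \<rho>) (?h i) (?h j)" for i j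
      unfolding \<tau>(3)[symmetric] \<tau>'_def ..
    then show "(\<lambda>i j. \<Sum>k<N. \<tau>' k i j) = on_snd (isometry_map E W) \<rho>"
      by (auto simp: regroup2_def fun_eq_iff)
  qed (use that in auto)
  have "regroup (on_snd (isometry_map E W) (swap_last \<omega>)) = block {..<N} \<tau>"
    unfolding \<omega>(2) by (auto simp: regroup_def swap_last_def block_def \<tau>'_def fun_eq_iff)
  then have "0 \<in> ?C m n W" using \<omega>(1) \<tau>(4) by force
  then have "Inf (?C m n W) = 0" using nonneg[OF _ W] by (rule Inf_eq_zero)
  \<comment> \<open>The outer infimum is attained: the inner one is 0 at \<open>W\<close> and
    nonnegative elsewhere.\<close>
  then show "J_down_star A B E \<rho> = 0"
    unfolding J_down_star_def using W nonneg_Inf by (intro Inf_eq_zero) force+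
next
  note fin = assms
  fix \<rho> assume \<rho>: "\<rho> \<in> S_J A B E"
  then have st: "state ((A \<times> B) \<times> E) \<rho>" by (simp add: S_J_def S_all_def)
  let ?C = "\<lambda>m n \<phi>. {cmi (A \<times> {..<m}) (B \<times> {..<n}) {..<k} (on_snd T (regroup (pure \<phi>))) | (k::nat) T.
                 quantum_operation E {..<k} T}"
  have nonneg: "0 \<le> x" if mem: "x \<in> ?C m n \<phi>" and pur: "purification ((A \<times> B) \<times> E) ({..<m} \<times> {..<n}) \<rho> \<phi>" for x and m n :: nat and \<phi>
  proof -
    obtain k :: nat and T where x: "x = cmi (A \<times> {..<m}) (B \<times> {..<n}) {..<k} (on_snd T (regroup (pure \<phi>)))"
      and "quantum_operation E {..<k} T" using mem by blast
    then have "state (((A \<times> {..<m}) \<times> (B \<times> {..<n})) \<times> {..<k}) (on_snd T (regroup (pure \<phi>)))"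
      using pur fin st by (intro state_on_snd state_regroup state_pure) auto
    then show ?thesis unfolding x using fin by (intro strong_subadditivity) auto
  qed
  obtain T1 where "quantum_operation E {..<1::nat} T1" using quantum_operation_exists[OF fin(3)] .
  then have "?C m n \<phi> \<noteq> {}" for m n :: nat and \<phi> by blast
  then have nonneg_Inf: "0 \<le> Inf (?C m n \<phi>)" if "purification ((A \<times> B) \<times> E) ({..<m} \<times> {..<n}) \<rho> \<phi>" for m n :: nat and \<phi>
    using nonneg[OF _ that] by (rule cInf_greatest)
  obtain m n :: nat and \<phi> where \<phi>: "purification ((A \<times> B) \<times> E) ({..<m} \<times> {..<n}) \<rho> \<phi>"
    and sep: "tr_snd E (regroup (pure \<phi>)) \<in> sep_states (A \<times> {..<m}) (B \<times> {..<n})"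
    using \<rho> by (auto simp: S_J_def)
  \<comment> \<open>The purifying vector with \<open>E\<close> moved to the end, where the
    measurement acts.\<close>
  define \<psi> where "\<psi> = (\<lambda>(((a, g), (b, h)), e). \<phi> (((a, b), e), (g, h)))"
  have \<psi>: "regroup (pure \<phi>) = pure \<psi>"
    by (auto simp: regroup_def pure_def \<psi>_def fun_eq_iff)
  obtain N :: nat and \<tau> where \<tau>: "0 < N" "\<And>k. k < N \<Longrightarrow> psd ((A \<times> {..<m}) \<times> (B \<times> {..<n})) (\<tau> k)"
    "\<And>k. k < N \<Longrightarrow> \<tau> k \<in> ops ((A \<times> {..<m}) \<times> (B \<times> {..<n}))"
    "(\<lambda>i j. \<Sum>k<N. \<tau> k i j) = tr_snd E (regroup (pure \<phi>))"
    "cmi (A \<times> {..<m}) (B \<times> {..<n}) {..<N} (block {..<N} \<tau>) = 0"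
    by (rule sep_states_flag[OF _ _ sep]) (use fin in auto)
  obtain T where T: "quantum_operation E {..<N} T" "on_snd T (pure \<psi>) = block {..<N} \<tau>"
  proof (rule steering[of "(A \<times> {..<m}) \<times> (B \<times> {..<n})" E N \<psi> \<tau>])
    show "\<psi> i = 0" if "i \<notin> ((A \<times> {..<m}) \<times> (B \<times> {..<n})) \<times> E" for i
    proof -
      obtain a g b h e where i: "i = (((a, g), (b, h)), e)" by (metis surj_pair)
      then have "(((a, b), e), (g, h)) \<notin> ((A \<times> B) \<times> E) \<times> ({..<m} \<times> {..<n})" using that by auto
      then have "\<phi> (((a, b), e), (g, h)) = 0" using \<phi> unfolding purification_def by blast
      then show ?thesis by (simp add: i \<psi>_def)
    qed
  qed (use \<tau> fin \<psi> that in auto)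
  have "0 \<in> ?C m n \<phi>" using T \<tau>(5) \<psi> by force
  then have "Inf (?C m n \<phi>) = 0" using nonneg[OF _ \<phi>] by (rule Inf_eq_zero)
  then show "J_down A B E \<rho> = 0"
    unfolding J_down_def using \<phi> nonneg_Inf by (intro Inf_eq_zero) force+
qed

end
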